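(* Let $k\in\mathbb N$, let $s\ge2$ be real, and suppose that $\Delta_s^*$ is an admissible exponent for minor arcs with $\Delta_s^*<0$. Let $\theta$ be a real number with $0<\theta\le k/2$. Then for every $\varepsilon>0$ there exists $\eta>0$ such that, for all sufficiently large $P$, all $R$ with $2\le R\le P^\eta$ and all $Q$ with $P^\theta\le Q\le P^{k/2}$, one has \[ \int_{\mathfrak m(Q)}|f(\alpha;P,R)|^s\,d\alpha\ll P^{s-k}Q^{\varepsilon-2|\Delta_s^*|/k}, \] where the implied constant depends only on $\varepsilon,\eta,k,s,\theta$.
   Context: For real $P,R\ge1$, $\mathscr A(P,R)$ is the set of integers $n\in[1,P]$ all of whose prime divisors are at most $R$; $e(z)=e^{2\pi iz}$; $f(\alpha;P,R)=\sum_{x\in\mathscr A(P,R)}e(\alpha x^k)$; $U_u(P,R)=\int_0^1|f(\alpha;P,R)|^u\,d\alpha$. A real $\Delta_u$ is an admissible exponent (for $k$) if for every $\varepsilon>0$ there is $\eta>0$ (depending on $\varepsilon,k,u$) such that for $P$ sufficiently large and $1\le R\le P^\eta$ one has $U_u(P,R)\le CP^{u-k+\Delta_u+\varepsilon}$ with $C=C(\varepsilon,\eta,k,u)$. With admissible exponents $\Delta_u$ fixed for each $u$ under consideration, $\tau(k)=\max_{w\in\mathbb N}(k-2\Delta_{2w})/(4w^2)$ (assumed attained), and $\Delta_s^*=\min_{0\le t\le s-2}(\Delta_{s-t}-t\tau(k))$ is called an admissible exponent for minor arcs. For $1\le Q\le P^{k/2}$, $\mathfrak M(Q,P)$ is the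 union over integers $1\le q\le Q$, $0\le a\le q$, $(a,q)=1$ of $\{\alpha\in[0,1):|q\alpha-a|\le QP^{-k}\}$, and $\mathfrak m(Q)=[0,1]\setminus\mathfrak M(Q,P)$. *)

theory Defs
  imports "HOL-Analysis.Analysis" "HOL-Computational_Algebra.Primes"
begin

definition smooth_set :: "real \<Rightarrow> real \<Rightarrow> nat set" where
  "smooth_set P R = {n::nat. 1 \<le> n \<and> real n \<le> P \<and> (\<forall>p. prime p \<and> p dvd n \<longrightarrow> real p \<le> R)}"

definition e :: "real \<Rightarrow> complex" where
  "e z = exp (2 * complex_of_real pi * \<i> * complex_of_real z)"

definition fsum :: "nat \<Rightarrow> real \<Rightarrow> real \<Rightarrow> real \<Rightarrow> complex" where
  "fsum k \<alpha> P R = (\<Sum>x\<in>smooth_set P R. e (\<alpha> * real x ^ k))"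

definition Umean :: "nat \<Rightarrow> real \<Rightarrow> real \<Rightarrow> real \<Rightarrow> real" where
  "Umean k u P R = integral {0..1} (\<lambda>\<alpha>. norm (fsum k \<alpha> P R) powr u)"

definition admissible :: "nat \<Rightarrow> real \<Rightarrow> real \<Rightarrow> bool" where
  "admissible k u D \<longleftrightarrow>
     (\<forall>\<epsilon>>0. \<exists>\<eta>>0. \<exists>C. \<exists>P0. \<forall>P\<ge>P0. \<forall>R.
        1 \<le> R \<and> R \<le> P powr \<eta> \<longrightarrow> Umean k u P R \<le> C * P powr (u - real k + D + \<epsilon>))"

definition is_tau :: "nat \<Rightarrow> (real \<Rightarrow> real) \<Rightarrow> real \<Rightarrow> bool" where
  "is_tau k \<Delta> \<tau> \<longleftrightarrow>
     (\<exists>w::nat. w \<ge> 1 \<and> \<tau> = (real k - 2 * \<Delta> (2 * real w)) / (4 * real w ^ 2)) \<and>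
     (\<forall>w::nat. w \<ge> 1 \<longrightarrow> (real k - 2 * \<Delta> (2 * real w)) / (4 * real w ^ 2) \<le> \<tau>)"

definition is_minor_exp :: "real \<Rightarrow> (real \<Rightarrow> real) \<Rightarrow> real \<Rightarrow> real \<Rightarrow> bool" where
  "is_minor_exp s \<Delta> \<tau> D \<longleftrightarrow>
     (\<exists>t\<in>{0..s-2}. D = \<Delta> (s - t) - t * \<tau>) \<and>
     (\<forall>t\<in>{0..s-2}. D \<le> \<Delta> (s - t) - t * \<tau>)"

definition major_arcs :: "nat \<Rightarrow> real \<Rightarrow> real \<Rightarrow> real set" where
  "major_arcs k Q P = (\<Union>q\<in>{q::nat. 1 \<le> q \<and> real q \<le> Q}. \<Union>a\<in>{a::nat. a \<le> q \<and> coprime a q}.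
      {\<alpha>. 0 \<le> \<alpha> \<and> \<alpha> < 1 \<and> \<bar>real q * \<alpha> - real a\<bar> \<le> Q * P powr (- real k)})"

definition minor_arcs :: "nat \<Rightarrow> real \<Rightarrow> real \<Rightarrow> real set" where
  "minor_arcs k Q P = {0..1} - major_arcs k Q P"

end

theory Submission
  imports Defs
begin

text \<open>The minor arcs are cut into boundedly many pieces, on which \<open>\<alpha>\<close> lies outside the major arcs of level
  \<open>Q\<close> but inside those of level \<open>P powr \<delta> * Q\<close>. With \<open>\<Delta>\<^sub>s\<^sup>* = \<Delta>\<^bsub>s-t\<^esub> - t \<tau>\<close>, Hoelder's inequality bounds
  the integral over a piece by \<open>sup \<bar>f\<bar> ^ t\<close> times the mean value of order \<open>u = s - t\<close> over the major arcs, so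
  the pointwise bound \<open>P * Q powr (- 2 \<tau> / k)\<close> and the mean value bound \<open>P powr (u - k) * Q powr (2 \<Delta>\<^sub>u / k)\<close>
  (up to small powers of \<open>P\<close>, which \<open>Q \<ge> P powr \<theta>\<close> absorbs) give the theorem.

  Both bounds come from splitting the smooth variable as \<open>m * z\<close> with \<open>z\<close> of size \<open>Q powr (2 / k)\<close>. If \<open>\<alpha>\<close> is near
  \<open>a / q\<close> and \<open>m\<close> is coprime to \<open>q\<close>, then \<open>\<alpha> * m ^ k\<close> runs over short disjoint intervals around the reduced
  fractions with denominator \<open>q\<close>, and the mean value of order \<open>u\<close> for the sum of length \<open>Q powr (2 / k)\<close> applies;
  pointwise, the sum of that length is estimated by splitting it once more into two variables of equal
  size. Common factors \<open>d = gcd q (m ^ k)\<close> shorten the natural length to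
  \<open>(Q / d) powr (2 / k)\<close>, but they also restrict \<open>m\<close> to multiples of an integer of size at least
  \<open>d powr (1 / k)\<close>, and \<open>\<Delta>\<^sub>u \<ge> k - u / 2\<close> makes this restriction sufficient.\<close>

subsection \<open>Smooth exponential sums\<close>

text \<open>The length \<open>Q powr (2 / k)\<close> is forced by spacing. For \<open>m\<close> of
  size \<open>P / Q powr (2 / k)\<close> the factor \<open>m ^ k\<close> dilates an arc around
  \<open>a / q\<close> to radius about \<open>1 / (q * Q)\<close>, while different fractions with
  denominators \<open>q, q' \<le> Q\<close> are at least \<open>1 / (q * q')\<close> apart; a longer
  outer variable would make the arcs overlap. At \<open>Q = P powr (k / 2)\<close> the inner length
  is \<open>P\<close> itself, so beyond that level the mean value over the whole interval takes
  over. A single use of Hoelder's inequality fails because the supremum over all minor arcs is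
  governed by their lowest level, whereas a mean value over a large set of arcs is governed by the
  highest one. On a piece of ratio \<open>P powr \<delta>\<close> both levels agree up to a
  negligible power, whatever the sign of \<open>\<Delta>\<^sub>u\<close>. The lower bound for
  admissible exponents expresses that moments cannot beat square-root cancellation. Besides
  controlling common factors, it yields \<open>\<tau> \<le> 1 / 2\<close> and makes moment bounds
  uniform down to very short sums.\<close>

lemma e_add: "e (x + y) = e x * e y"
  by (simp add: e_def distrib_left exp_add)

lemma norm_e [simp]: "norm (e x) = 1"
proof -
  have "e x = exp (\<i> * complex_of_real (2 * pi * x))" by (simp add: e_def mult_ac)
  then show ?thesis by (simp only: norm_exp_i_times)
qed

lemma e_0 [simp]: "e 0 = 1" by (simp add: e_def)

lemma e_int [simp]: "e (of_int n) = 1"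
proof -
  have "e (of_int n) = exp (of_int n * (of_real (2 * pi) * \<i>))" by (simp add: e_def mult_ac)
  also have "\<dots> = 1" by (simp add: exp_eq_1)
  finally show ?thesis .
qed

lemma e_minus: "e (- x) = cnj (e x)"
  by (simp add: e_def exp_cnj)

lemma e_power: "e (x * real n) = e x ^ n"
  by (induction n) (auto simp: e_add algebra_simps)

lemma continuous_on_e [continuous_intros]: "continuous_on S f \<Longrightarrow> continuous_on S (\<lambda>x. e (f x))"
  unfolding e_def by (intro continuous_intros)

lemma finite_smooth_set [simp]: "finite (smooth_set P R)"
proof (rule finite_subset)
  show "smooth_set P R \<subseteq> {..nat \<lfloor>P\<rfloor>}"
    unfolding smooth_set_def by (auto simp: le_nat_iff le_floor_iff)
qed auto

lemma card_smooth_set_le: "P \<ge> 0 \<Longrightarrow> real (card (smooth_set P R)) \<le> P"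
proof -
  assume P: "P \<ge> 0"
  have "smooth_set P R \<subseteq> {1..nat \<lfloor>P\<rfloor>}"
    unfolding smooth_set_def by (auto simp: le_nat_iff le_floor_iff)
  from card_mono[OF _ this] have "card (smooth_set P R) \<le> nat \<lfloor>P\<rfloor>" by simp
  then show ?thesis using P by linarith
qed

text \<open>Integer smoothness bounds are wanted because the factorisation of smooth numbers
  replaces the bound by the last prime used.\<close>

lemma smooth_set_floor: "R \<ge> 0 \<Longrightarrow> smooth_set P (real (nat \<lfloor>R\<rfloor>)) = smooth_set P R"
proof -
  assume "R \<ge> 0"
  then have "real p \<le> real (nat \<lfloor>R\<rfloor>) \<longleftrightarrow> real p \<le> R" for p :: nat
  proof -
    have "real p \<le> real (nat \<lfloor>R\<rfloor>) \<longleftrightarrow> int p \<le> \<lfloor>R\<rfloor>" 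
      using \<open>R \<ge> 0\<close> by (simp only: of_nat_le_iff) (simp add: le_nat_iff)
    also have "\<dots> \<longleftrightarrow> real p \<le> R" by (simp add: le_floor_iff)
    finally show ?thesis .
  qed
  then show ?thesis unfolding smooth_set_def by simp
qed

lemma fsum_floor: "R \<ge> 0 \<Longrightarrow> fsum k \<alpha> P (real (nat \<lfloor>R\<rfloor>)) = fsum k \<alpha> P R"
  unfolding fsum_def by (simp only: smooth_set_floor)

lemma norm_fsum_le: "P \<ge> 0 \<Longrightarrow> norm (fsum k \<alpha> P R) \<le> P"
proof -
  assume P: "P \<ge> 0"
  have "norm (fsum k \<alpha> P R) \<le> (\<Sum>x\<in>smooth_set P R. 1)"
    unfolding fsum_def by (rule sum_norm_le) simp
  then show ?thesis using card_smooth_set_le[OF P, of R] by simp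
qed

lemma continuous_on_fsum [continuous_intros]:
  "continuous_on S f \<Longrightarrow> continuous_on S (\<lambda>x. fsum k (f x) P R)"
  unfolding fsum_def by (intro continuous_intros)

lemma continuous_on_fsum_powr [continuous_intros]:
  assumes "continuous_on S f" "u > 0"
  shows "continuous_on S (\<lambda>x. norm (fsum k (f x) P R) powr u)"
  by (rule continuous_on_powr') (use assms in \<open>auto intro!: continuous_intros\<close>)

lemma fsum_add_int: "fsum k (\<alpha> + of_int n) P R = fsum k \<alpha> P R"
proof -
  have "e ((\<alpha> + of_int n) * real x ^ k) = e (\<alpha> * real x ^ k)" for x :: nat
  proof -
    have "(\<alpha> + of_int n) * real x ^ k = \<alpha> * real x ^ k + of_int (n * int x ^ k)"
      by (simp add: algebra_simps)
    then show ?thesis by (simp only: e_add e_int mult_1_right)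
  qed
  then show ?thesis by (simp add: fsum_def)
qed

subsection \<open>Divisors and the number of smooth integers\<close>

lemma card_divisors_coprime_le:
  fixes a b :: nat
  assumes "a > 0" "b > 0" "coprime a b"
  shows "card {d. d dvd a * b} \<le> card {d. d dvd a} * card {d. d dvd b}"
proof -
  have "{d. d dvd a * b} \<subseteq> (\<lambda>(x, y). x * y) ` ({d. d dvd a} \<times> {d. d dvd b})"
  proof
    fix d assume "d \<in> {d. d dvd a * b}"
    then have "d dvd a * b" by simp
    then obtain x y where "d = x * y" "x dvd a" "y dvd b"
      by (rule division_decomp[THEN exE]) blast
    then show "d \<in> (\<lambda>(x, y). x * y) ` ({d. d dvd a} \<times> {d. d dvd b})" by auto
  qed
  then have "card {d. d dvd a * b} \<le> card ({d. d dvd a} \<times> {d. d dvd b})"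
    using assms by (intro surj_card_le) auto
  then show ?thesis by (simp add: card_cartesian_product)
qed

lemma card_divisors_prime_power:
  fixes p :: nat
  assumes "prime p"
  shows "card {d. d dvd p ^ a} = a + 1"
proof -
  have "{d. d dvd p ^ a} = (\<lambda>i. p ^ i) ` {..a}"
    using divides_primepow_nat[OF assms] by (auto simp: image_def)
  moreover have "inj_on (\<lambda>i. p ^ i) {..a}"
    using prime_gt_1_nat[OF assms] by (auto intro!: inj_onI simp: power_inject_exp)
  ultimately show ?thesis by (simp add: card_image)
qed

text \<open>The left side counts the divisors of a prime power. The linear factor is dominated
  through \<open>1 + x \<le> exp x\<close>, with a constant depending neither on \<open>p\<close>
  nor on \<open>a\<close>, so it serves all small primes at once.\<close>

lemma Suc_le_bound_powr:
  fixes a :: nat and \<epsilon> :: real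
  assumes "\<epsilon> > 0" "p \<ge> 2"
  shows "real a + 1 \<le> (1 + 1 / (\<epsilon> * ln 2)) * p powr (\<epsilon> * real a)"
proof -
  have "1 + \<epsilon> * real a * ln 2 \<le> exp (\<epsilon> * real a * ln 2)" by (rule exp_ge_add_one_self)
  also have "\<dots> = 2 powr (\<epsilon> * real a)" by (simp add: powr_def)
  also have "\<dots> \<le> p powr (\<epsilon> * real a)" using assms by (intro powr_mono2) auto
  finally have *: "1 + \<epsilon> * real a * ln 2 \<le> p powr (\<epsilon> * real a)" .
  have l: "\<epsilon> * ln 2 > (0::real)" using assms by simp
  have "real a + 1 \<le> (1 + 1 / (\<epsilon> * ln 2)) * (1 + \<epsilon> * real a * ln 2)"
  proof -
    have "(1 + 1 / (\<epsilon> * ln 2)) * (1 + \<epsilon> * real a * ln 2) = 1 + \<epsilon> * real a * ln 2 + 1 / (\<epsilon> * ln 2) + real a"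
      using l assms by (simp add: field_simps)
    moreover have "0 \<le> \<epsilon> * real a * ln 2 + 1 / (\<epsilon> * ln 2)"
      using assms l by (intro add_nonneg_nonneg) auto
    ultimately show ?thesis by linarith
  qed
  also have "\<dots> \<le> (1 + 1 / (\<epsilon> * ln 2)) * p powr (\<epsilon> * real a)"
    using l by (intro mult_left_mono *) (auto intro: add_nonneg_nonneg)
  finally show ?thesis .
qed

text \<open>Only the primes below \<open>2 powr (1 / \<epsilon>)\<close> contribute a factor larger than \<open>1\<close>.\<close>
lemma divisor_bound:
  assumes "\<epsilon> > (0::real)"
  shows "\<exists>C\<ge>1. \<forall>n\<ge>1. real (card {d::nat. d dvd n}) \<le> C * real n powr \<epsilon>"
proof -
  define K where "K = 1 + 1 / (\<epsilon> * ln 2)"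
  have K: "K \<ge> 1" using assms by (simp add: K_def)
  define B where "B = nat \<lceil>2 powr (1 / \<epsilon>)\<rceil>"
  define c where "c p = (if p < B then K else 1)" for p :: nat
  have c1: "c p \<ge> 1" for p using K by (simp add: c_def)
  have fac: "real a + 1 \<le> c p * real p powr (\<epsilon> * real a)" if "prime p" for p a :: nat
  proof (cases "p < B")
    case True
    then show ?thesis using Suc_le_bound_powr[OF assms, of "real p" a] prime_ge_2_nat[OF that]
      by (simp add: c_def K_def)
  next
    case False
    then have "2 powr (1 / \<epsilon>) \<le> real p" unfolding B_def by linarith
    then have "(2 powr (1 / \<epsilon>)) powr (\<epsilon> * real a) \<le> real p powr (\<epsilon> * real a)"
      using assms by (intro powr_mono2) auto
    moreover have "(2 powr (1 / \<epsilon>)) powr (\<epsilon> * real a) = 2 ^ a"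
      using assms by (simp add: powr_powr powr_realpow)
    moreover have "real a + 1 \<le> 2 ^ a"
      using less_exp[of a] by (metis Suc_leI add.commute of_nat_Suc of_nat_le_iff of_nat_numeral of_nat_power)
    ultimately show ?thesis using False by (simp add: c_def)
  qed
  \<comment> \<open>The product runs over any finite set of primes containing the prime factors. The
    induction then removes one element \<open>p\<close> of \<open>S\<close> at a time, with exponent
    \<open>0\<close> if \<open>p\<close> does not divide \<open>n\<close>.\<close>
  have main: "real (card {d::nat. d dvd n}) \<le> (\<Prod>p\<in>S. c p) * real n powr \<epsilon>"
    if "finite S" "n \<ge> 1" "prime_factors n \<subseteq> S" "\<forall>p\<in>S. prime p" for S n
    using that
  proof (induction S arbitrary: n rule: finite_induct)
    case empty
    then have "\<not> (\<exists>p. prime p \<and> p dvd n)" by (auto simp: prime_factors_dvd)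
    then have "n = 1" using prime_factor_nat[of n] by blast
    then show ?case by simp
  next
    case (insert p S)
    define a where "a = multiplicity p n"
    obtain m where m: "n = p ^ a * m" "\<not> p dvd m"
      using multiplicity_decompose'[of n p] insert.prems by (metis a_def not_one_le_zero not_prime_unit insertI1)
    have p: "prime p" using insert.prems by auto
    have m1: "m \<ge> 1" using m insert.prems by (cases "m = 0") auto
    have cop: "coprime (p ^ a) m" using p m(2) by (simp add: prime_imp_coprime)
    have sub: "prime_factors m \<subseteq> S"
    proof
      fix r assume r: "r \<in> prime_factors m"
      then have "r dvd n" "prime r" "r dvd m" using m by auto
      then have "r \<in> insert p S" using insert.prems by (auto simp: prime_factors_dvd)
      moreover have "r \<noteq> p" using \<open>r dvd m\<close> m by auto
      ultimately show "r \<in> S" by auto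
    qed
    have "real (card {d. d dvd n}) \<le> real (card {d. d dvd p ^ a}) * real (card {d. d dvd m})"
      using card_divisors_coprime_le[of "p ^ a" m] m m1 cop p
      by (metis of_nat_le_iff of_nat_mult prime_gt_0_nat zero_less_power less_eq_Suc_le One_nat_def)
    also have "\<dots> = (real a + 1) * real (card {d. d dvd m})"
      using card_divisors_prime_power[OF p] by simp
    also have "\<dots> \<le> (c p * real p powr (\<epsilon> * real a)) * ((\<Prod>p\<in>S. c p) * real m powr \<epsilon>)"
      using insert.IH[OF m1 sub] insert.prems fac[OF p, of a] c1[of p]
      by (intro mult_mono) auto
    also have "\<dots> = (\<Prod>p\<in>insert p S. c p) * real n powr \<epsilon>"
    proof -
      have "real n powr \<epsilon> = real p powr (\<epsilon> * real a) * real m powr \<epsilon>"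
        using prime_gt_0_nat[OF p] unfolding m(1)
        by (simp add: powr_mult powr_powr mult.commute flip: powr_realpow)
      then show ?thesis using insert.hyps by simp
    qed
    finally show ?case .
  qed
  define C where "C = (\<Prod>p\<in>{..<B}. K)"
  have "real (card {d::nat. d dvd n}) \<le> C * real n powr \<epsilon>" if "n \<ge> 1" for n
  proof -
    have "real (card {d::nat. d dvd n}) \<le> (\<Prod>p\<in>prime_factors n. c p) * real n powr \<epsilon>"
      using that by (intro main) auto
    \<comment> \<open>Adding all indices below \<open>B\<close>, prime or not, only inserts factors
      at least \<open>1\<close> and makes the bound independent of \<open>n\<close>; from
      \<open>B\<close> on \<open>c\<close> equals \<open>1\<close>.\<close>
    also have "(\<Prod>p\<in>prime_factors n. c p) \<le> (\<Prod>p\<in>prime_factors n \<union> {..<B}. c p)"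
      using c1 by (intro prod_mono2) (auto intro: order_trans[OF zero_le_one])
    also have "\<dots> = (\<Prod>p\<in>{..<B}. c p)"
      by (intro prod.mono_neutral_right) (auto simp: c_def)
    also have "\<dots> = C" by (simp add: C_def c_def)
    finally show ?thesis by (simp add: mult_right_mono)
  qed
  moreover have "C \<ge> 1" unfolding C_def using K by (intro prod_ge_1) auto
  ultimately show ?thesis by blast
qed

text \<open>Multiply \<open>j\<close> integers up to \<open>P powr (1 / j)\<close>: the product is
  smooth and at most \<open>P\<close>. There are about \<open>P\<close> such tuples, and a product
  \<open>x\<close> arises at most as often as there are \<open>j\<close>-tuples of divisors of
  \<open>x\<close>, which is a negligible power of \<open>P\<close>.\<close>

lemma card_smooth_set_ge:
  assumes "\<epsilon> > (0::real)" "j \<ge> (1::nat)"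
  shows "\<exists>c>0. \<forall>P\<ge>1. c * P powr (1 - \<epsilon>) \<le> real (card (smooth_set P (P powr (1 / j))))"
proof -
  \<comment> \<open>The exponent \<open>\<epsilon> / j\<close> makes the \<open>j\<close>-th power
    of the divisor bound lose \<open>P powr \<epsilon>\<close>.\<close>
  obtain C where C: "C \<ge> 1" "\<And>n. n \<ge> 1 \<Longrightarrow> real (card {d::nat. d dvd n}) \<le> C * real n powr (\<epsilon> / j)"
    using divisor_bound[of "\<epsilon> / j"] assms by auto
  have "(1 / (2 * C)) ^ j * P powr (1 - \<epsilon>) \<le> real (card (smooth_set P (P powr (1 / j))))" if P: "P \<ge> 1" for P
  proof -
    define A where "A = smooth_set P (P powr (1 / j))"
    define N where "N = nat \<lfloor>P powr (1 / j)\<rfloor>"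
    have P1: "P powr (1 / j) \<ge> 1" using P by (intro ge_one_powr_ge_zero) auto
    then have N: "P powr (1 / j) / 2 \<le> real N" "real N \<le> P powr (1 / j)" "N \<ge> 1"
    proof -
      have "real N = of_int \<lfloor>P powr (1 / j)\<rfloor>" using P1 unfolding N_def by (intro of_nat_nat) simp
      moreover have "N \<ge> 1" using P1 unfolding N_def by (subst le_nat_iff) auto
      ultimately show "P powr (1 / j) / 2 \<le> real N" "real N \<le> P powr (1 / j)" "N \<ge> 1"
        by linarith+
    qed
    have Pj: "(P powr (1 / j)) ^ j = P"
    proof -
      have "(P powr (1 / j)) ^ j = (P powr (1 / j)) powr real j"
        using P by (intro powr_realpow[symmetric]) simp
      also have "\<dots> = P" using P assms by (simp only: powr_powr) simp
      finally show ?thesis .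
    qed
    have sub: "PiE {..<j} (\<lambda>_. {1..N}) \<subseteq> (\<Union>x\<in>A. PiE {..<j} (\<lambda>_. {d. d dvd x}))"
    proof
      fix g assume g: "g \<in> PiE {..<j} (\<lambda>_. {1..N})"
      define x where "x = (\<Prod>i<j. g i)"
      have gi: "1 \<le> g i" "g i \<le> N" if "i < j" for i
        using PiE_mem[OF g, of i] that by simp_all
      have "x > 0" using gi by (auto simp: x_def Suc_le_eq intro!: prod_pos)
      have "real x \<le> (\<Prod>i<j. P powr (1 / j))"
        unfolding x_def of_nat_prod
        using order_trans[OF of_nat_mono[OF gi(2)] N(2)] by (intro prod_mono) auto
      then have "real x \<le> P" using Pj by simp
      moreover have "real p \<le> P powr (1 / j)" if p: "prime p" "p dvd x" for p
      proof -
        obtain i where "i < j" "p dvd g i"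
          using prime_dvd_prod_iff[of "{..<j}" p g] p by (auto simp: x_def)
        then have "p \<le> N" using gi[of i] dvd_imp_le[of p "g i"] by (simp add: Suc_le_eq)
        then show ?thesis using N by linarith
      qed
      ultimately have "x \<in> A" using \<open>x > 0\<close> by (auto simp: A_def smooth_set_def)
      moreover have "g \<in> PiE {..<j} (\<lambda>_. {d. d dvd x})"
        using g by (auto simp: x_def PiE_iff intro!: dvd_prodI)
      ultimately show "g \<in> (\<Union>x\<in>A. PiE {..<j} (\<lambda>_. {d. d dvd x}))" by blast
    qed
    have A: "finite A" "\<And>x. x \<in> A \<Longrightarrow> x \<ge> 1 \<and> real x \<le> P"
      by (simp add: A_def) (simp add: A_def smooth_set_def)
    have "N ^ j = card (PiE {..<j} (\<lambda>_. {1..N}))" by (simp add: card_PiE)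
    also have "\<dots> \<le> card (\<Union>x\<in>A. PiE {..<j} (\<lambda>_. {d. d dvd x}))"
      using A by (intro card_mono sub finite_UN_I finite_PiE) (auto simp: finite_divisors_nat Suc_le_eq)
    also have "\<dots> \<le> (\<Sum>x\<in>A. card (PiE {..<j} (\<lambda>_. {d. d dvd x})))"
      by (rule card_UN_le[OF A(1)])
    finally have "real (N ^ j) \<le> (\<Sum>x\<in>A. real (card {d. d dvd x}) ^ j)"
      by (simp add: card_PiE flip: of_nat_power of_nat_sum)
    also have "\<dots> \<le> (\<Sum>x\<in>A. (C * P powr (\<epsilon> / j)) ^ j)"
    proof (intro sum_mono power_mono)
      fix x assume x: "x \<in> A"
      have "real (card {d. d dvd x}) \<le> C * real x powr (\<epsilon> / j)" using C(2) A x by blast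
      also have "\<dots> \<le> C * P powr (\<epsilon> / j)"
        using C(1) A(2)[OF x] assms by (intro mult_left_mono powr_mono2) auto
      finally show "real (card {d. d dvd x}) \<le> C * P powr (\<epsilon> / j)" .
    qed auto
    also have "\<dots> = real (card A) * C ^ j * P powr \<epsilon>"
    proof -
      have "(P powr (\<epsilon> / j)) ^ j = (P powr (\<epsilon> / j)) powr real j"
        using P by (intro powr_realpow[symmetric]) simp
      also have "\<dots> = P powr \<epsilon>" using P assms by (simp only: powr_powr) simp
      finally show ?thesis by (simp add: power_mult_distrib)
    qed
    finally have 1: "real N ^ j \<le> real (card A) * C ^ j * P powr \<epsilon>" by simp
    have "P / 2 ^ j = (P powr (1 / j) / 2) ^ j" by (simp add: power_divide Pj)
    also have "\<dots> \<le> real N ^ j" using N P1 by (intro power_mono) auto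
    finally have "P / 2 ^ j \<le> real (card A) * C ^ j * P powr \<epsilon>" using 1 by simp
    then have "(1 / (2 * C)) ^ j * (P / P powr \<epsilon>) \<le> real (card A)"
      using C(1) P by (simp add: field_simps power_mult_distrib)
    moreover have "P / P powr \<epsilon> = P powr (1 - \<epsilon>)" using P by (simp add: powr_diff)
    ultimately show ?thesis by (simp add: A_def)
  qed
  moreover have "(1 / (2 * C)) ^ j > 0" using C(1) by simp
  ultimately show ?thesis by blast
qed

subsection \<open>Power means\<close>

text \<open>The convex function \<open>x powr u\<close> lies above its tangent at \<open>c\<close>;
  this is Young's inequality. Summed or integrated with a suitable \<open>c\<close> it yields the
  power mean inequalities below.\<close>

lemma powr_tangent_le:
  fixes x c u :: real
  assumes "x \<ge> 0" "c \<ge> 0" "u \<ge> 1"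
  shows "u * x * c powr (u - 1) \<le> x powr u + (u - 1) * c powr u"
proof (cases "u = 1")
  case False
  then have u: "u > 1" using assms by simp
  have "x * c powr (u - 1) \<le> x powr u / u + (c powr (u - 1)) powr (u / (u - 1)) / (u / (u - 1))"
    using u assms by (intro Youngs_inequality) (auto simp: field_simps)
  also have "(c powr (u - 1)) powr (u / (u - 1)) = c powr u" using u by (simp add: powr_powr)
  finally show ?thesis using u by (simp add: field_simps)
qed (use assms in \<open>auto simp: powr_one_gt_zero_iff\<close>)

lemma weighted_power_mean:
  fixes w x :: "'a \<Rightarrow> real"
  assumes "u \<ge> 1" "\<And>i. i \<in> I \<Longrightarrow> w i \<ge> 0" "\<And>i. i \<in> I \<Longrightarrow> x i \<ge> 0"
  shows "(\<Sum>i\<in>I. w i * x i) powr u \<le> (\<Sum>i\<in>I. w i) powr (u - 1) * (\<Sum>i\<in>I. w i * x i powr u)"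
proof (cases "(\<Sum>i\<in>I. w i * x i) = 0")
  case True
  then show ?thesis using assms by (auto intro!: mult_nonneg_nonneg sum_nonneg)
next
  case False
  define W S where "W = (\<Sum>i\<in>I. w i)" and "S = (\<Sum>i\<in>I. w i * x i)"
  have S: "S > 0" using False assms by (auto simp: S_def less_le intro!: sum_nonneg)
  then have fin: "finite I" by (cases "finite I") (auto simp: S_def)
  have "W \<noteq> 0"
  proof
    assume "W = 0"
    then have "w i = 0" if "i \<in> I" for i
      using that fin assms(2) by (simp add: W_def sum_nonneg_eq_0_iff)
    then show False using S by (simp add: S_def)
  qed
  then have W: "W > 0" using assms by (auto simp: W_def less_le intro!: sum_nonneg)
  \<comment> \<open>The tangent is taken at the weighted mean, where the summed linear terms combine
    to Jensen's inequality.\<close>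
  define c where "c = S / W"
  have c: "c > 0" using S W by (simp add: c_def)
  have "(\<Sum>i\<in>I. w i * (u * x i * c powr (u - 1))) \<le> (\<Sum>i\<in>I. w i * (x i powr u + (u - 1) * c powr u))"
    using assms c by (intro sum_mono mult_left_mono powr_tangent_le) auto
  also have "\<dots> = (\<Sum>i\<in>I. w i * x i powr u) + W * (u - 1) * c powr u"
    by (simp only: distrib_left sum.distrib W_def sum_distrib_right mult.assoc)
  also have "(\<Sum>i\<in>I. w i * (u * x i * c powr (u - 1))) = u * c powr (u - 1) * S"
    by (simp add: S_def sum_distrib_left mult_ac)
  also have "S = W * c" using W by (simp add: c_def)
  also have "u * c powr (u - 1) * (W * c) = u * W * c powr u"
    using c by (simp add: powr_diff)
  finally have "W * c powr u \<le> (\<Sum>i\<in>I. w i * x i powr u)" by (simp add: algebra_simps)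
  then have "W powr (u - 1) * (W * c powr u) \<le> W powr (u - 1) * (\<Sum>i\<in>I. w i * x i powr u)"
    by (intro mult_left_mono) auto
  moreover have "W powr (u - 1) * (W * c powr u) = S powr u"
    using W S by (simp add: c_def powr_divide powr_diff)
  ultimately show ?thesis by (simp add: W_def S_def)
qed

lemma power_mean:
  fixes x :: "'a \<Rightarrow> real"
  assumes "u \<ge> 1" "\<And>i. i \<in> I \<Longrightarrow> x i \<ge> 0"
  shows "(\<Sum>i\<in>I. x i) powr u \<le> real (card I) powr (u - 1) * (\<Sum>i\<in>I. x i powr u)"
  using weighted_power_mean[of u I "\<lambda>_. 1" x] assms by simp

subsection \<open>Integrals of continuous functions over bounded sets\<close>

lemma set_integrable_continuous:
  fixes g :: "real \<Rightarrow> real"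
  assumes "S \<in> sets borel" "bounded S" "continuous_on UNIV g"
  shows "set_integrable lborel S g"
proof -
  obtain a b where ab: "S \<subseteq> cbox a b" using bounded_subset_cbox_symmetric[OF assms(2)] by metis
  have "set_integrable lborel (cbox a b) g"
    unfolding set_integrable_def
    by (rule borel_integrable_compact) (use assms(3) continuous_on_subset in auto)
  then show ?thesis by (rule set_integrable_subset) (use assms ab in auto)
qed

lemma set_integral_le_sum:
  fixes g :: "real \<Rightarrow> real" and h :: "'i \<Rightarrow> real \<Rightarrow> real"
  assumes S: "S \<in> sets borel" "bounded S" "continuous_on UNIV g"
    and I: "\<And>i. i \<in> I \<Longrightarrow> T i \<in> sets borel \<and> bounded (T i) \<and> continuous_on UNIV (h i)"
    and le: "\<And>x. indicat_real S x * g x \<le> (\<Sum>i\<in>I. c i * (indicat_real (T i) x * h i x))"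
  shows "(LBINT x:S. g x) \<le> (\<Sum>i\<in>I. c i * (LBINT x:T i. h i x))"
proof -
  have int: "integrable lborel (\<lambda>x. indicat_real (T i) x * h i x)" if "i \<in> I" for i
    using set_integrable_continuous[of "T i" "h i"] I[OF that] by (simp add: set_integrable_def)
  have "(LBINT x:S. g x) \<le> (LBINT x. \<Sum>i\<in>I. c i * (indicat_real (T i) x * h i x))"
    unfolding set_lebesgue_integral_def
    using set_integrable_continuous[OF S] le int
    by (intro integral_mono Bochner_Integration.integrable_sum integrable_mult_right)
       (auto simp: set_integrable_def)
  also have "\<dots> = (\<Sum>i\<in>I. c i * (LBINT x:T i. h i x))"
    using int by (simp add: Bochner_Integration.integral_sum set_lebesgue_integral_def)
  finally show ?thesis .
qed

lemma set_integral_le_cover: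
  fixes g :: "real \<Rightarrow> real"
  assumes "finite I" "S \<in> sets borel" "bounded S" "continuous_on UNIV g" "\<And>x. g x \<ge> 0"
    and T: "\<And>i. i \<in> I \<Longrightarrow> T i \<in> sets borel \<and> bounded (T i)"
    and "S \<subseteq> (\<Union>i\<in>I. T i)"
  shows "(LBINT x:S. g x) \<le> (\<Sum>i\<in>I. (LBINT x:T i. g x))"
proof -
  have "(LBINT x:S. g x) \<le> (\<Sum>i\<in>I. 1 * (LBINT x:T i. g x))"
  proof (rule set_integral_le_sum)
    fix x
    show "indicat_real S x * g x \<le> (\<Sum>i\<in>I. 1 * (indicat_real (T i) x * g x))"
    proof (cases "x \<in> S")
      case True
      then obtain i where i: "i \<in> I" "x \<in> T i" using assms by auto
      then have "indicat_real S x * g x = indicat_real (T i) x * g x" using True by simp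
      also have "\<dots> \<le> (\<Sum>i\<in>I. indicat_real (T i) x * g x)"
        using i assms by (intro member_le_sum) auto
      finally show ?thesis by simp
    qed (use assms in \<open>auto intro!: sum_nonneg\<close>)
  qed (use assms in auto)
  then show ?thesis by simp
qed

lemma set_integral_sum_disjoint_le:
  fixes g :: "real \<Rightarrow> real"
  assumes "finite I" "continuous_on UNIV g" "\<And>x. g x \<ge> 0"
    and S: "S \<in> sets borel" "bounded S"
    and T: "\<And>i. i \<in> I \<Longrightarrow> T i \<in> sets borel \<and> T i \<subseteq> S"
    and disj: "\<And>i j x. i \<in> I \<Longrightarrow> j \<in> I \<Longrightarrow> x \<in> T i \<Longrightarrow> x \<in> T j \<Longrightarrow> i = j"
  shows "(\<Sum>i\<in>I. (LBINT x:T i. g x)) \<le> (LBINT x:S. g x)"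
proof -
  have int: "integrable lborel (\<lambda>x. indicat_real (T i) x * g x)" if "i \<in> I" for i
    using set_integrable_continuous[of "T i" g] T[OF that] assms(2) bounded_subset[OF S(2), of "T i"]
    by (simp add: set_integrable_def)
  have "(\<Sum>i\<in>I. (LBINT x:T i. g x)) = (LBINT x. \<Sum>i\<in>I. indicat_real (T i) x * g x)"
    using int by (simp add: Bochner_Integration.integral_sum set_lebesgue_integral_def)
  also have "\<dots> \<le> (LBINT x:S. g x)"
    unfolding set_lebesgue_integral_def
  proof (rule integral_mono)
    fix x
    show "(\<Sum>i\<in>I. indicat_real (T i) x * g x) \<le> indicat_real S x *\<^sub>R g x"
    proof (cases "\<exists>i\<in>I. x \<in> T i")
      case True
      then obtain i where i: "i \<in> I" "x \<in> T i" by auto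
      have "(\<Sum>j\<in>I. indicat_real (T j) x * g x) = (\<Sum>j\<in>{i}. indicat_real (T j) x * g x)"
        using i assms by (intro sum.mono_neutral_right) (auto simp: indicator_def)
      then show ?thesis using i T by (auto simp: indicator_def)
    qed (use assms in auto)
  qed (use int set_integrable_continuous[OF S assms(2)] in \<open>auto simp: set_integrable_def\<close>)
  finally show ?thesis .
qed

lemma set_integral_mono_set:
  fixes g :: "real \<Rightarrow> real"
  assumes "S \<in> sets borel" "S \<subseteq> T" "T \<in> sets borel" "bounded T" "continuous_on UNIV g" "\<And>x. g x \<ge> 0"
  shows "(LBINT x:S. g x) \<le> (LBINT x:T. g x)"
  using set_integral_sum_disjoint_le[of "{()}" g T "\<lambda>_. S"] assms by simp

lemma set_integral_mono_continuous:
  fixes g h :: "real \<Rightarrow> real"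
  assumes "S \<in> sets borel" "bounded S" "continuous_on UNIV g" "continuous_on UNIV h"
    "\<And>x. x \<in> S \<Longrightarrow> g x \<le> h x"
  shows "(LBINT x:S. g x) \<le> (LBINT x:S. h x)"
  using assms by (intro set_integral_mono set_integrable_continuous) auto

lemma set_integral_nonneg': "(\<And>x. g x \<ge> (0::real)) \<Longrightarrow> (LBINT x:S. g x) \<ge> 0"
  unfolding set_lebesgue_integral_def by (rule Bochner_Integration.integral_nonneg) auto

text \<open>One substitution serves both the dilation of arcs by \<open>m ^ k\<close>
  (\<open>t = 0\<close>) and translation by integers (\<open>m = 1\<close>).\<close>

lemma set_integral_scale_shift:
  fixes g :: "real \<Rightarrow> real"
  assumes "m > 0"
  shows "(LBINT x:{x. \<bar>x - c\<bar> \<le> r}. g (x * m + t)) = (LBINT y:{y. \<bar>y - (c * m + t)\<bar> \<le> r * m}. g y) / m"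
proof -
  have eq: "indicat_real {y. \<bar>y - (c * m + t)\<bar> \<le> r * m} (t + m * x) *\<^sub>R g (t + m * x)
      = indicat_real {x. \<bar>x - c\<bar> \<le> r} x *\<^sub>R g (x * m + t)" for x
  proof -
    have "t + m * x - (c * m + t) = (x - c) * m" by (simp add: algebra_simps)
    then have "\<bar>t + m * x - (c * m + t)\<bar> \<le> r * m \<longleftrightarrow> \<bar>x - c\<bar> \<le> r"
      using assms by (simp add: abs_mult)
    then show ?thesis by (simp add: indicator_def mult.commute add.commute)
  qed
  have "(LBINT y:{y. \<bar>y - (c * m + t)\<bar> \<le> r * m}. g y) = \<bar>m\<bar> *\<^sub>R (LBINT x:{x. \<bar>x - c\<bar> \<le> r}. g (x * m + t))"
    unfolding set_lebesgue_integral_def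
    by (subst lborel_integral_real_affine[of m _ t]) (use assms in simp, simp only: eq)
  then show ?thesis using assms by simp
qed

section \<open>Integrals of functions of period 1\<close>

lemma periodic_of_int:
  fixes g :: "real \<Rightarrow> real"
  assumes "\<And>x. g (x + 1) = g x"
  shows "g (x + of_int n) = g x"
proof (induction n rule: int_induct[where k = 0])
  case (step1 i)
  then show ?case using assms[of "x + of_int i"] by (simp add: add.assoc)
next
  case (step2 i)
  then show ?case using assms[of "x + of_int (i - 1)"] by (simp add: algebra_simps)
qed simp

lemma set_integral_periodic_shift:
  fixes g :: "real \<Rightarrow> real"
  assumes "\<And>x. g (x + 1) = g x"
  shows "(LBINT x:{x. \<bar>x - (c + of_int n)\<bar> \<le> r}. g x) = (LBINT x:{x. \<bar>x - c\<bar> \<le> r}. g x)"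
  using set_integral_scale_shift[of 1 c r g "of_int n"] periodic_of_int[of g _ n, OF assms] by simp

text \<open>The dilated arcs around fractions in \<open>[0,1)\<close> will have radius at most
  \<open>1\<close> and so stay inside \<open>[-1,2]\<close>, which is compared here with one
  period.\<close>

lemma set_integral_three_periods:
  fixes g :: "real \<Rightarrow> real"
  assumes "\<And>x. g (x + 1) = g x" "continuous_on UNIV g" "\<And>x. g x \<ge> 0"
  shows "(LBINT x:{-1..2}. g x) \<le> 3 * (LBINT x:{0..1}. g x)"
proof -
  have eq: "{of_int n..of_int n + 1} = {x. \<bar>x - (1 / 2 + of_int n)\<bar> \<le> (1 / 2 :: real)}" for n
    by (rule set_eqI) (auto simp only: atLeastAtMost_iff mem_Collect_eq abs_le_iff; linarith)
  have per: "(LBINT x:{of_int n..of_int n + 1}. g x) = (LBINT x:{0..1}. g x)" for n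
    unfolding eq set_integral_periodic_shift[where g = g, OF assms(1)] using eq[of 0] by simp
  have "(LBINT x:{-1..2}. g x) \<le> (\<Sum>n\<in>{-1,0,1}. (LBINT x:{of_int n..of_int n + 1}. g x))"
    by (rule set_integral_le_cover) (use assms in auto)
  then show ?thesis unfolding per by simp
qed

section \<open>Moments of smooth exponential sums\<close>

lemma Umean_eq: 
  assumes "u > 0"
  shows "Umean k u P R = (LBINT \<alpha>:{0..1}. norm (fsum k \<alpha> P R) powr u)"
  unfolding Umean_def
  by (rule set_borel_integral_eq_integral(2)[symmetric], rule set_integrable_continuous)
     (use assms in \<open>auto intro!: continuous_intros\<close>)

lemma Umean_nonneg: "Umean k u P R \<ge> 0"
  unfolding Umean_def
  by (cases "(\<lambda>\<alpha>. norm (fsum k \<alpha> P R) powr u) integrable_on {0..1}")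
     (auto intro: Henstock_Kurzweil_Integration.integral_nonneg simp: not_integrable_integral)

lemma Umean_le: 
  assumes "u > 0" "P \<ge> 0"
  shows "Umean k u P R \<le> P powr u"
proof -
  have "Umean k u P R \<le> (LBINT \<alpha>:{0..1::real}. P powr u)"
    unfolding Umean_eq[OF assms(1)]
    by (rule set_integral_mono_continuous)
       (use assms norm_fsum_le in \<open>auto intro!: continuous_intros powr_mono2\<close>)
  then show ?thesis by (simp add: set_integral_const)
qed

subsection \<open>Parseval's identity\<close>

lemma has_integral_e: "((\<lambda>x. e (x * of_int n)) has_integral (if n = 0 then 1 else 0)) {0..1}"
proof (cases "n = 0")
  case False
  define c where "c = 2 * complex_of_real pi * \<i> * of_int n"
  have c: "c \<noteq> 0" using False by (simp add: c_def)
  have e: "e (x * of_int n) = exp (c * of_real x)" for x by (simp add: e_def c_def mult_ac)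
  have "((\<lambda>x. exp (c * of_real x)) has_integral (exp (c * of_real 1) / c - exp (c * of_real 0) / c)) {0..1}"
  proof (rule fundamental_theorem_of_calculus)
    fix x :: real
    have "((\<lambda>z. exp (c * z) / c) has_field_derivative exp (c * of_real x)) (at (of_real x))"
      by (auto intro!: derivative_eq_intros simp: c)
    then show "((\<lambda>x. exp (c * of_real x) / c) has_vector_derivative exp (c * of_real x)) (at x within {0..1})"
      by (intro has_vector_derivative_real_field has_vector_derivative_at_within[where S = "{0..1}"])
  qed simp
  moreover have "exp (c * of_real 1) = 1" using e[of 1] by simp
  ultimately show ?thesis using False by (simp add: e)
qed (simp add: has_integral_const_real[of 1 0 1, simplified])

lemma parseval:
  fixes p :: "complex poly"
  shows "integral {0..1} (\<lambda>x. norm (poly p (e x)) ^ 2) = (\<Sum>i\<le>degree p. norm (coeff p i) ^ 2)"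
proof -
  have "((\<lambda>x. \<Sum>i\<le>degree p. \<Sum>j\<le>degree p. (coeff p i * cnj (coeff p j)) * e (x * of_int (int i - int j)))
      has_integral (\<Sum>i\<le>degree p. \<Sum>j\<le>degree p. (coeff p i * cnj (coeff p j)) * (if int i - int j = 0 then 1 else 0))) {0..1}"
    by (intro has_integral_sum has_integral_mult_right has_integral_e) auto
  moreover have "(\<Sum>i\<le>degree p. \<Sum>j\<le>degree p. (coeff p i * cnj (coeff p j)) * e (x * of_int (int i - int j)))
      = complex_of_real (norm (poly p (e x)) ^ 2)" for x
  proof -
    have "e (x * of_int (int i - int j)) = e x ^ i * cnj (e x ^ j)" for i j
      using e_add[of "x * real i" "- (x * real j)"]
      by (simp add: e_power e_minus right_diff_distrib flip: complex_cnj_power)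
    then have "(\<Sum>i\<le>degree p. \<Sum>j\<le>degree p. (coeff p i * cnj (coeff p j)) * e (x * of_int (int i - int j)))
       = poly p (e x) * cnj (poly p (e x))"
      by (simp add: poly_altdef sum_product mult_ac)
    then show ?thesis by (simp only: complex_norm_square)
  qed
  ultimately have "((\<lambda>x. complex_of_real (norm (poly p (e x)) ^ 2)) has_integral
     (\<Sum>i\<le>degree p. complex_of_real (norm (coeff p i) ^ 2))) {0..1}"
    by (simp only: complex_norm_square) (simp add: if_distrib[of "\<lambda>x. _ * x"] cong: if_cong)
  from has_integral_linear[OF this bounded_linear_Re]
  have "((\<lambda>x. norm (poly p (e x)) ^ 2) has_integral (\<Sum>i\<le>degree p. norm (coeff p i) ^ 2)) {0..1}"
    by (simp add: o_def)
  then show ?thesis by (rule integral_unique)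
qed

text \<open>As a polynomial in \<open>e \<theta>\<close> an exponential sum over \<open>k\<close>-th
  powers has its power \<open>w\<close> computed by convolution of coefficients, its mean square by
  Parseval and its total mass by the value at \<open>1\<close>. The coefficient type is generic
  because complex weights and real counts both occur.\<close>

definition kpoly :: "nat \<Rightarrow> nat set \<Rightarrow> (nat \<Rightarrow> 'a) \<Rightarrow> 'a::comm_ring_1 poly" where
  "kpoly k A b = (\<Sum>z\<in>A. monom (b z) (z ^ k))"

lemma poly_kpoly_e: "poly (kpoly k A b) (e \<theta>) = (\<Sum>z\<in>A. b z * e (\<theta> * real z ^ k))"
  by (simp add: kpoly_def poly_sum poly_monom e_power[of _ "_ ^ k", simplified])

lemma poly_kpoly_1: "poly (kpoly k A b) 1 = (\<Sum>z\<in>A. b z)"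
  by (simp add: kpoly_def poly_sum poly_monom)

lemma degree_kpoly_le: 
  assumes "\<And>z. z \<in> A \<Longrightarrow> z ^ k \<le> N"
  shows "degree (kpoly k A b) \<le> N"
proof (intro degree_le allI impI)
  fix i assume "N < i"
  then show "coeff (kpoly k A b) i = 0"
    using assms by (force simp: kpoly_def coeff_sum intro!: sum.neutral)
qed

text \<open>Moments come from complex polynomials through Parseval, representation numbers from real
  ones; this identifies the two.\<close>

lemma coeff_kpoly_power_of_real:
  "coeff (kpoly k A (\<lambda>_. 1) ^ w) i = complex_of_real (coeff (kpoly k A (\<lambda>_. 1) ^ w) i)"
proof (induction w arbitrary: i)
  case (Suc w)
  have "coeff (kpoly k A (\<lambda>_. 1)) i = complex_of_real (coeff (kpoly k A (\<lambda>_. 1)) i)" for i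
    by (simp add: kpoly_def coeff_sum if_distrib[of complex_of_real] cong: if_cong)
  with Suc show ?case by (simp add: coeff_mult)
qed (simp add: coeff_1)

text \<open>The coefficient of \<open>kpoly k A (\<lambda>_. 1) ^ w\<close> at \<open>h\<close> counts the representations of \<open>h\<close> as a
  sum of \<open>w\<close> elements of \<open>A\<close> to the power \<open>k\<close>.\<close>
lemma norm_coeff_kpoly_power_le:
  fixes b :: "nat \<Rightarrow> 'a::{comm_ring_1,real_normed_algebra_1}"
  assumes "A \<subseteq> A'" "finite A'" "\<And>z. z \<in> A \<Longrightarrow> norm (b z) \<le> 1"
  shows "norm (coeff (kpoly k A b ^ w) i) \<le> coeff (kpoly k A' (\<lambda>_. 1) ^ w) i"
proof (induction w arbitrary: i)
  case (Suc w)
  have *: "norm (coeff (kpoly k A b) i) \<le> coeff (kpoly k A' (\<lambda>_. 1)) i" for i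
  proof -
    have "norm (coeff (kpoly k A b) i) \<le> (\<Sum>z\<in>A. if z ^ k = i then 1 else 0)"
      unfolding kpoly_def coeff_sum using assms(3) by (intro sum_norm_le) auto
    also have "\<dots> \<le> (\<Sum>z\<in>A'. if z ^ k = i then 1 else 0)"
      using assms by (intro sum_mono2) auto
    finally show ?thesis by (simp add: kpoly_def coeff_sum)
  qed
  have "norm (coeff (kpoly k A b ^ Suc w) i) \<le> (\<Sum>j\<le>i. coeff (kpoly k A' (\<lambda>_. 1)) j * coeff (kpoly k A' (\<lambda>_. 1) ^ w) (i - j))"
    unfolding power_Suc coeff_mult
    using * Suc by (intro sum_norm_le order_trans[OF norm_mult_ineq] mult_mono) (auto intro: order_trans[OF norm_ge_zero])
  then show ?case by (simp add: coeff_mult)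
qed (simp add: coeff_1)

lemma sum_coeff_power2_extend:
  fixes p :: "'a::{zero,real_normed_vector} poly"
  assumes "degree p \<le> N"
  shows "(\<Sum>i\<le>degree p. norm (coeff p i) ^ 2) = (\<Sum>i\<le>N. norm (coeff p i) ^ 2)"
  using assms by (intro sum.mono_neutral_left) (auto simp: coeff_eq_0)

text \<open>\<open>N\<close> may be any bound for the degree because the bilinear estimate sums the
  counts and the kernel over one fixed range.\<close>

lemma Umean_even_eq:
  assumes "w \<ge> 1" "degree (kpoly k (smooth_set P R) (\<lambda>_. 1 :: real) ^ w) \<le> N"
  shows "Umean k (2 * real w) P R = (\<Sum>i\<le>N. coeff (kpoly k (smooth_set P R) (\<lambda>_. 1 :: real) ^ w) i ^ 2)"
proof -
  define p where "p = kpoly k (smooth_set P R) (\<lambda>_. 1 :: complex) ^ w"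
  define r where "r = kpoly k (smooth_set P R) (\<lambda>_. 1 :: real) ^ w"
  have pr: "coeff p i = of_real (coeff r i)" for i
    unfolding p_def r_def by (rule coeff_kpoly_power_of_real)
  have "degree p \<le> N"
    using assms(2) by (intro degree_le) (auto simp: pr coeff_eq_0 r_def)
  have "Umean k (2 * real w) P R = integral {0..1} (\<lambda>x. norm (poly p (e x)) ^ 2)"
    unfolding Umean_def
  proof (rule integral_cong)
    fix x
    have "poly p (e x) = fsum k x P R ^ w"
      by (simp add: p_def poly_kpoly_e fsum_def poly_power)
    moreover have "norm (fsum k x P R) powr (2 * real w) = norm (fsum k x P R) ^ (2 * w)"
      using assms(1) by (cases "fsum k x P R = 0") (auto simp flip: powr_realpow)
    ultimately show "norm (fsum k x P R) powr (2 * real w) = norm (poly p (e x)) ^ 2"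
      by (simp add: norm_power power_mult power_mult[of _ w 2] mult.commute[of 2 w])
  qed
  also have "\<dots> = (\<Sum>i\<le>N. coeff r i ^ 2)"
    using \<open>degree p \<le> N\<close> by (simp only: parseval sum_coeff_power2_extend) (simp add: pr)
  finally show ?thesis by (simp add: r_def)
qed

lemma Umean_2_eq: "k \<ge> 1 \<Longrightarrow> Umean k 2 P R = real (card (smooth_set P R))"
proof -
  assume k: "k \<ge> 1"
  define A where "A = smooth_set P R"
  define N where "N = max (degree (kpoly k A (\<lambda>_. 1 :: real))) (Max (insert 0 ((\<lambda>z. z ^ k) ` A)))"
  have fin: "finite A" by (simp add: A_def)
  have "Umean k 2 P R = (\<Sum>i\<le>N. coeff (kpoly k A (\<lambda>_. 1 :: real)) i ^ 2)"
    using Umean_even_eq[of 1 k P R N] by (simp add: A_def N_def)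
  also have "\<dots> = (\<Sum>i\<in>(\<lambda>z. z ^ k) ` A. 1)"
  proof -
    have inj: "x = y" if "x ^ k = y ^ k" for x y :: nat
      using that k by (simp add: power_eq_iff_eq_base)
    \<comment> \<open>Distinct bases have distinct \<open>k\<close>-th powers, so every
      representation number is \<open>0\<close> or \<open>1\<close>.\<close>
    have "coeff (kpoly k A (\<lambda>_. 1 :: real)) i = (if i \<in> (\<lambda>z. z ^ k) ` A then 1 else 0)" for i
    proof (cases "i \<in> (\<lambda>z. z ^ k) ` A")
      case True
      then obtain z where z: "z \<in> A" "i = z ^ k" by auto
      have "coeff (kpoly k A (\<lambda>_. 1 :: real)) i = (\<Sum>y\<in>A. if y = z then 1 else 0)"
        using inj z by (auto simp: kpoly_def coeff_sum intro!: sum.cong)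
      then show ?thesis using z fin by simp
    qed (auto simp: kpoly_def coeff_sum intro!: sum.neutral)
    moreover have "(\<lambda>z. z ^ k) ` A \<subseteq> {..N}"
      using fin by (auto simp: N_def intro!: le_trans[OF Max_ge max.cobounded2])
    ultimately show ?thesis
      by (intro sum.mono_neutral_cong_right) auto
  qed
  also have "\<dots> = real (card A)"
    using k by (simp add: card_image inj_on_def power_eq_iff_eq_base)
  finally show ?thesis by (simp add: A_def)
qed

subsection \<open>Kernel sums over well-spaced points\<close>

text \<open>Up to \<open>pi / 3\<close> the mean value theorem applies with
  \<open>cos \<ge> 1 / 2\<close>; beyond, \<open>sin y\<close> is at least
  \<open>sqrt 3 / 2\<close>, which exceeds \<open>pi / 4\<close>.\<close>

lemma half_le_sin:
  assumes "0 \<le> y" "y \<le> pi / 2"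
  shows "y / 2 \<le> sin y"
proof (cases "y \<le> pi / 3")
  case True
  show ?thesis
  proof (cases "y = 0")
    case False
    then have "0 < y" using assms by simp
    from MVT2[OF this, of sin cos] obtain z where z: "0 < z" "z < y" "sin y - sin 0 = (y - 0) * cos z"
      by (auto intro: DERIV_sin)
    have "cos (pi / 3) \<le> cos z" using z True pi_gt_zero by (intro cos_monotone_0_pi_le) auto
    then have "y * (1 / 2) \<le> y * cos z" using assms by (intro mult_left_mono) (auto simp: cos_60)
    then show ?thesis using z by simp
  qed simp
next
  case False
  have "sin (pi / 3) \<le> sin y" using False assms pi_gt_zero by (intro sin_monotone_2pi_le) auto
  moreover have "sqrt 3 / 2 \<ge> (8 / 5) / 2"
    by (intro divide_right_mono real_le_rsqrt) (auto simp: power2_eq_square)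
  moreover have "pi < 3.2" using pi_less_4 pi_approx by simp
  ultimately show ?thesis using assms by (simp add: sin_60)
qed

lemma norm_one_minus_e: 
  assumes "\<bar>x\<bar> \<le> 1 / 2"
  shows "2 * \<bar>x\<bar> \<le> norm (1 - e x)"
proof -
  have "norm (1 - e x) ^ 2 = (2 * sin (pi * x)) ^ 2"
  proof -
    have "e x = cis (2 * (pi * x))" by (simp add: e_def cis_conv_exp mult_ac)
    then have "norm (1 - e x) ^ 2 = (1 - cos (2 * (pi * x))) ^ 2 + sin (2 * (pi * x)) ^ 2"
      by (simp add: cmod_power2)
    also have "\<dots> = 2 - 2 * cos (2 * (pi * x))"
      using sin_cos_squared_add[of "2 * (pi * x)"] by (simp add: power2_eq_square algebra_simps)
    also have "\<dots> = (2 * sin (pi * x)) ^ 2"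
      by (simp add: cos_double_sin power2_eq_square)
    finally show ?thesis .
  qed
  then have "norm (1 - e x) = \<bar>2 * sin (pi * x)\<bar>"
    using power2_eq_imp_eq[of "norm (1 - e x)" "\<bar>2 * sin (pi * x)\<bar>"]
    by (simp only: power2_abs norm_ge_zero abs_ge_zero)
  also have "\<dots> = 2 * sin (pi * \<bar>x\<bar>)"
  proof -
    have "sin (pi * \<bar>x\<bar>) \<ge> 0" using assms pi_gt_zero
      by (intro sin_ge_zero) (auto simp: mult_le_cancel_left1)
    then show ?thesis by (cases "x \<ge> 0") auto
  qed
  also have "\<dots> \<ge> 2 * (pi * \<bar>x\<bar> / 2)"
    using assms pi_gt_zero by (intro mult_left_mono half_le_sin) (auto simp: field_simps)
  moreover have "2 * \<bar>x\<bar> \<le> pi * \<bar>x\<bar>" using pi_gt3 by (intro mult_right_mono) auto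
  ultimately show ?thesis by simp
qed

text \<open>After removal of the nearest integer the geometric series is at most
  \<open>2 / norm (1 - e y)\<close>, independently of its length.\<close>

lemma norm_sum_e_le: 
  assumes "\<bar>x - of_int c\<bar> \<le> 1 / 2" "x \<noteq> of_int c"
  shows "norm (\<Sum>h\<le>H. e (x * real h)) \<le> 1 / \<bar>x - of_int c\<bar>"
proof -
  define y where "y = x - of_int c"
  have y: "\<bar>y\<bar> \<le> 1 / 2" "y \<noteq> 0" using assms by (auto simp: y_def)
  have ex: "e x = e y" using e_add[of y "of_int c"] by (simp add: y_def)
  have 2: "2 * \<bar>y\<bar> \<le> norm (1 - e y)" by (rule norm_one_minus_e[OF y(1)])
  then have ne: "e y \<noteq> 1" using y by auto
  have "(\<Sum>h\<le>H. e (x * real h)) = (\<Sum>h<Suc H. e y ^ h)"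
    by (simp add: e_power ex lessThan_Suc_atMost)
  also have "\<dots> = (e y ^ Suc H - 1) / (e y - 1)" using ne by (rule geometric_sum)
  finally have "norm (\<Sum>h\<le>H. e (x * real h)) = norm (e y ^ Suc H - 1) / norm (e y - 1)"
    by (simp add: norm_divide)
  also have "\<dots> \<le> 2 / (2 * \<bar>y\<bar>)"
  proof (intro frac_le)
    show "norm (e y ^ Suc H - 1) \<le> 2"
      using norm_triangle_ineq4[of "e y ^ Suc H" 1] by (simp add: norm_power del: power_Suc)
  qed (use 2 y in \<open>auto simp: norm_minus_commute\<close>)
  finally show ?thesis using y by (simp add: y_def)
qed

lemma harm_le: "harm n \<le> 1 + ln (real (max 1 n))"
proof (induction n)
  case (Suc n)
  show ?case
  proof (cases "n = 0")
    case False
    have "ln (real n / real (Suc n)) \<le> real n / real (Suc n) - 1"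
      using False by (intro ln_le_minus_one) auto
    then have "1 / real (Suc n) \<le> ln (real (Suc n)) - ln (real n)"
      using False by (simp add: ln_div field_simps)
    then show ?thesis using Suc False by (simp add: harm_Suc inverse_eq_divide max_def split: if_splits)
  qed (simp add: harm_expand)
qed (simp add: harm_expand)

lemma sum_union_le:
  fixes g :: "'a \<Rightarrow> real"
  assumes "finite A" "finite B" "\<And>x. g x \<ge> 0"
  shows "sum g (A \<union> B) \<le> sum g A + sum g B"
  using sum.union_inter[OF assms(1,2), of g] sum_nonneg[of "A \<inter> B" g] assms(3) by simp

text \<open>Sort the points into bins of width \<open>\<delta>\<close>; separation puts at most one
  point into each. The two bins next to \<open>0\<close> receive the trivial bound \<open>N\<close>,
  and the others contribute a harmonic sum on either side.\<close>

lemma sum_separated_le: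
  fixes x f :: "'i \<Rightarrow> real"
  assumes fin: "finite I" and \<delta>: "\<delta> > 0" and N: "N \<ge> 0"
    and x: "\<And>i. i \<in> I \<Longrightarrow> \<bar>x i\<bar> \<le> 1 / 2"
    and sep: "\<And>i j. i \<in> I \<Longrightarrow> j \<in> I \<Longrightarrow> i \<noteq> j \<Longrightarrow> \<bar>x i - x j\<bar> \<ge> \<delta>"
    and f: "\<And>i. i \<in> I \<Longrightarrow> f i \<le> N" "\<And>i. i \<in> I \<Longrightarrow> x i \<noteq> 0 \<Longrightarrow> f i \<le> 1 / \<bar>x i\<bar>"
  shows "(\<Sum>i\<in>I. f i) \<le> 2 * N + 2 * harm (nat \<lfloor>1 / \<delta>\<rfloor>) / \<delta>"
proof -
  define J where "J = nat \<lfloor>1 / \<delta>\<rfloor>"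
  define \<phi> where "\<phi> i = \<lfloor>x i / \<delta>\<rfloor>" for i
  \<comment> \<open>Bin \<open>j\<close> is the interval from \<open>j * \<delta>\<close> to
    \<open>(j + 1) * \<delta>\<close>. For negative \<open>j\<close> its endpoint nearest to
    \<open>0\<close> is the right one, hence \<open>- j - 1\<close>, and the bins \<open>-1\<close>
    and \<open>0\<close> both touch \<open>0\<close>.\<close>
  define g :: "int \<Rightarrow> real" where "g j = (if j \<ge> 1 then 1 / (of_int j * \<delta>) else if j \<le> -2 then 1 / (of_int (- j - 1) * \<delta>) else N)" for j
  have inj: "inj_on \<phi> I"
  proof (rule inj_onI, rule ccontr)
    fix i j assume ij: "i \<in> I" "j \<in> I" "\<phi> i = \<phi> j" "i \<noteq> j"
    then have "\<bar>x i / \<delta> - x j / \<delta>\<bar> < 1" unfolding \<phi>_def by linarith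
    then have "\<bar>x i - x j\<bar> / \<delta> < 1" using \<delta> by (simp flip: diff_divide_distrib)
    then show False using sep[OF ij(1,2,4)] \<delta> by simp
  qed
  have fg: "f i \<le> g (\<phi> i)" if i: "i \<in> I" for i
  proof -
    have b: "of_int (\<phi> i) \<le> x i / \<delta>" "x i / \<delta> < of_int (\<phi> i) + 1" unfolding \<phi>_def by linarith+
    consider "\<phi> i \<ge> 1" | "\<phi> i \<le> -2" | "\<phi> i < 1" "\<phi> i > -2" by linarith
    then show ?thesis
    proof cases
      case 1
      then have "0 < real_of_int (\<phi> i) * \<delta>" "real_of_int (\<phi> i) * \<delta> \<le> \<bar>x i\<bar>" using b \<delta> by (auto simp: field_simps)
      then have "f i \<le> 1 / \<bar>x i\<bar>" "1 / \<bar>x i\<bar> \<le> 1 / (of_int (\<phi> i) * \<delta>)"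
        using f(2)[OF i] by (auto intro!: divide_left_mono)
      then show ?thesis using 1 by (simp add: g_def)
    next
      case 2
      have "real_of_int (- \<phi> i - 1) \<le> - (x i / \<delta>)" using b by simp
      also have "\<dots> \<le> \<bar>x i / \<delta>\<bar>" by (rule abs_ge_minus_self)
      also have "\<dots> = \<bar>x i\<bar> / \<delta>" using \<delta> by simp
      finally have "real_of_int (- \<phi> i - 1) \<le> \<bar>x i\<bar> / \<delta>" .
      then have "0 < real_of_int (- \<phi> i - 1) * \<delta>" "real_of_int (- \<phi> i - 1) * \<delta> \<le> \<bar>x i\<bar>"
        using 2 \<delta> by (simp_all add: pos_le_divide_eq)
      then have "f i \<le> 1 / \<bar>x i\<bar>" "1 / \<bar>x i\<bar> \<le> 1 / (real_of_int (- \<phi> i - 1) * \<delta>)"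
        using f(2)[OF i] by (auto intro!: divide_left_mono)
      then show ?thesis using 2 by (simp add: g_def)
    qed (use f(1)[OF i] in \<open>simp add: g_def\<close>)
  qed
  have g0: "g j \<ge> 0" for j using \<delta> N by (auto simp: g_def)
  have rng: "\<phi> ` I \<subseteq> {- int J - 1..int J}"
  proof
    fix j assume "j \<in> \<phi> ` I"
    then obtain i where i: "i \<in> I" "j = \<phi> i" by auto
    have "\<bar>x i / \<delta>\<bar> \<le> 1 / \<delta>" using x[OF i(1)] \<delta> by (simp add: field_simps)
    moreover have "int J = \<lfloor>1 / \<delta>\<rfloor>" using \<delta> by (simp add: J_def)
    ultimately show "j \<in> {- int J - 1..int J}" unfolding i \<phi>_def atLeastAtMost_iff by linarith
  qed
  have "(\<Sum>i\<in>I. f i) \<le> (\<Sum>i\<in>I. g (\<phi> i))" by (intro sum_mono fg)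
  also have "\<dots> = (\<Sum>j\<in>\<phi> ` I. g j)" using inj by (simp add: sum.reindex)
  also have "\<dots> \<le> (\<Sum>j\<in>{- int J - 1..int J}. g j)" using g0 rng by (intro sum_mono2) auto
  also have "\<dots> \<le> (\<Sum>j\<in>{-1, 0} \<union> (\<lambda>n. int n) ` {1..J} \<union> (\<lambda>n. - int n - 1) ` {1..J}. g j)"
  proof (intro sum_mono2)
    show "{- int J - 1..int J} \<subseteq> {-1, 0} \<union> (\<lambda>n. int n) ` {1..J} \<union> (\<lambda>n. - int n - 1) ` {1..J}"
    proof
      fix j assume j: "j \<in> {- int J - 1..int J}"
      consider "j \<ge> 1" | "j \<le> -2" | "j = 0 \<or> j = -1" by linarith
      then show "j \<in> {-1, 0} \<union> (\<lambda>n. int n) ` {1..J} \<union> (\<lambda>n. - int n - 1) ` {1..J}"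
      proof cases
        case 1 then have "j = int (nat j)" "nat j \<in> {1..J}" using j by auto
        then show ?thesis by blast
      next
        case 2 then have "j = - int (nat (- j - 1)) - 1" "nat (- j - 1) \<in> {1..J}" using j by auto
        then show ?thesis by blast
      qed auto
    qed
  qed (use g0 in auto)
  also have "\<dots> \<le> (\<Sum>j\<in>{-1, 0}. g j) + (\<Sum>j\<in>(\<lambda>n. int n) ` {1..J}. g j) + (\<Sum>j\<in>(\<lambda>n. - int n - 1) ` {1..J}. g j)"
    using g0 by (intro order_trans[OF sum_union_le] add_mono order_refl) auto
  also have "(\<Sum>j\<in>(\<lambda>n. int n) ` {1..J}. g j) = (\<Sum>n\<in>{1..J}. 1 / (real n * \<delta>))"
    by (subst sum.reindex) (auto simp: inj_on_def g_def intro!: sum.cong)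
  also have "\<dots> = harm J / \<delta>" by (simp add: harm_def sum_divide_distrib field_simps)
  also have "(\<Sum>j\<in>(\<lambda>n. - int n - 1) ` {1..J}. g j) = (\<Sum>n\<in>{1..J}. 1 / (real n * \<delta>))"
    by (subst sum.reindex) (auto simp: inj_on_def g_def intro!: sum.cong)
  also have "\<dots> = harm J / \<delta>" by (simp add: harm_def sum_divide_distrib field_simps)
  also have "(\<Sum>j\<in>{-1, 0}. g j) = 2 * N" by (simp add: g_def)
  finally show ?thesis by (simp add: J_def)
qed

text \<open>Differences of \<open>\<gamma> * n\<close> within \<open>K + 1\<close> consecutive
  integers are \<open>\<gamma> * l\<close> with \<open>l \<le> K\<close>, so the hypothesis says
  that the points are \<open>\<delta>\<close>-separated modulo \<open>1\<close>. Subtracting nearest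
  integers moves them to \<open>[-1/2, 1/2]\<close>.\<close>

lemma sum_kernel_block_le:
  fixes \<gamma> y \<delta> :: real and K :: nat
  assumes \<delta>: "\<delta> > 0"
    and sp: "\<And>l c. 1 \<le> l \<Longrightarrow> l \<le> K \<Longrightarrow> \<bar>\<gamma> * real l - of_int c\<bar> \<ge> \<delta>"
  shows "(\<Sum>n\<in>{a..a+K}. norm (\<Sum>h\<le>H. e ((y - \<gamma> * real n) * real h)))
    \<le> 2 * (real H + 1) + 2 * harm (nat \<lfloor>1 / \<delta>\<rfloor>) / \<delta>"
proof (rule sum_separated_le)
  define x where "x n = y - \<gamma> * real n" for n
  fix i j assume ij: "i \<in> {a..a+K}" "j \<in> {a..a+K}" "i \<noteq> j"
  show "\<delta> \<le> \<bar>(x i - of_int (round (x i))) - (x j - of_int (round (x j)))\<bar>"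
    using ij
  proof (induction i j rule: linorder_wlog)
    case (le i j)
    then have "\<delta> \<le> \<bar>\<gamma> * real (j - i) - of_int (round (x i) - round (x j))\<bar>"
      by (intro sp) auto
    also have "\<gamma> * real (j - i) - of_int (round (x i) - round (x j)) = (x i - of_int (round (x i))) - (x j - of_int (round (x j)))"
      using le by (simp add: x_def of_nat_diff algebra_simps)
    finally show ?case .
  qed (metis abs_minus_commute)
next
  fix n
  have *: "\<bar>(y - \<gamma> * real n) - of_int (round (y - \<gamma> * real n))\<bar> \<le> 1 / 2"
    using of_int_round_abs_le[of "y - \<gamma> * real n"] by (simp only: abs_minus_commute)
  then show "\<bar>(y - \<gamma> * real n) - of_int (round (y - \<gamma> * real n))\<bar> \<le> 1 / 2" .
  show "norm (\<Sum>h\<le>H. e ((y - \<gamma> * real n) * real h)) \<le> real H + 1"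
    by (rule order_trans[OF sum_norm_le[where g = "\<lambda>_. 1"]]) auto
  assume "(y - \<gamma> * real n) - of_int (round (y - \<gamma> * real n)) \<noteq> 0"
  then show "norm (\<Sum>h\<le>H. e ((y - \<gamma> * real n) * real h))
      \<le> 1 / \<bar>(y - \<gamma> * real n) - of_int (round (y - \<gamma> * real n))\<bar>"
    using * by (intro norm_sum_e_le) auto
qed (use \<delta> in auto)

text \<open>Blocks of length \<open>K + 1\<close> are the longest on which the spacing hypothesis
  controls all differences; the \<open>+ 1\<close> in the first factor allows for an incomplete last
  block.\<close>

lemma sum_kernel_le:
  fixes \<gamma> y \<delta> :: real and K :: nat
  assumes \<delta>: "\<delta> > 0"
    and sp: "\<And>l c. 1 \<le> l \<Longrightarrow> l \<le> K \<Longrightarrow> \<bar>\<gamma> * real l - of_int c\<bar> \<ge> \<delta>"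
  shows "(\<Sum>n\<le>N. norm (\<Sum>h\<le>H. e ((y - \<gamma> * real n) * real h)))
    \<le> (real N / (real K + 1) + 1) * (2 * (real H + 1) + 2 * harm (nat \<lfloor>1 / \<delta>\<rfloor>) / \<delta>)"
proof -
  define B where "B = 2 * (real H + 1) + 2 * harm (nat \<lfloor>1 / \<delta>\<rfloor>) / \<delta>"
  define F where "F n = norm (\<Sum>h\<le>H. e ((y - \<gamma> * real n) * real h))" for n
  have B0: "B \<ge> 0" using \<delta> harm_nonneg[where ?'a = real] unfolding B_def
    by (intro add_nonneg_nonneg divide_nonneg_pos mult_nonneg_nonneg) auto
  have "(\<Sum>n\<le>N. F n) \<le> (\<Sum>n\<in>(\<Union>b\<le>N div (K+1). {b*(K+1)..b*(K+1)+K}). F n)"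
  proof (intro sum_mono2)
    show "{..N} \<subseteq> (\<Union>b\<le>N div (K+1). {b*(K+1)..b*(K+1)+K})"
    proof
      fix n assume "n \<in> {..N}"
      then have "n div (K+1) \<le> N div (K+1)" by (simp add: div_le_mono)
      moreover have "n = n div (K+1) * (K+1) + n mod (K+1)" by (rule div_mult_mod_eq[symmetric])
      moreover have "n mod (K+1) \<le> K" using mod_less_divisor[of "K+1" n] by linarith
      ultimately show "n \<in> (\<Union>b\<le>N div (K+1). {b*(K+1)..b*(K+1)+K})"
        by (intro UN_I[of "n div (K+1)"]; simp only: atLeastAtMost_iff atMost_iff; linarith)
    qed
  qed (auto simp: F_def)
  also have "\<dots> = (\<Sum>b\<le>N div (K+1). \<Sum>n\<in>{b*(K+1)..b*(K+1)+K}. F n)"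
  proof (rule sum.UNION_disjoint)
    show "\<forall>i\<in>{..N div (K+1)}. \<forall>j\<in>{..N div (K+1)}. i \<noteq> j \<longrightarrow> {i*(K+1)..i*(K+1)+K} \<inter> {j*(K+1)..j*(K+1)+K} = {}"
    proof (intro ballI impI, rule ccontr)
      fix i j assume "i \<noteq> j" "{i*(K+1)..i*(K+1)+K} \<inter> {j*(K+1)..j*(K+1)+K} \<noteq> {}"
      then obtain n where n: "i*(K+1) \<le> n" "n \<le> i*(K+1)+K" "j*(K+1) \<le> n" "n \<le> j*(K+1)+K"
        unfolding ex_in_conv[symmetric] Int_iff atLeastAtMost_iff by blast
      have "n div (K+1) = i" by (rule div_nat_eqI) (use n in \<open>auto simp: mult.commute\<close>)
      moreover have "n div (K+1) = j" by (rule div_nat_eqI) (use n in \<open>auto simp: mult.commute\<close>)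
      ultimately show False using \<open>i \<noteq> j\<close> by simp
    qed
  qed auto
  also have "\<dots> \<le> (\<Sum>b\<le>N div (K+1). B)"
    unfolding F_def B_def by (intro sum_mono sum_kernel_block_le \<delta> sp)
  also have "\<dots> = (real (N div (K+1)) + 1) * B" by (simp add: algebra_simps)
  also have "\<dots> \<le> (real N / (real K + 1) + 1) * B"
  proof (intro mult_right_mono add_right_mono B0)
    have "real (N div (K+1) * (K+1)) \<le> real N" by (simp only: of_nat_le_iff div_times_less_eq_dividend)
    then show "real (N div (K+1)) \<le> real N / (real K + 1)" by (simp add: pos_le_divide_eq algebra_simps)
  qed
  finally show ?thesis by (simp add: F_def B_def)
qed

subsection \<open>Bilinear sums\<close>

text \<open>Dual form of the large sieve. Opening the square gives a Hermitian form in the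
  coefficients; \<open>2 * c i * c j \<le> c i ^ 2 + c j ^ 2\<close> and the symmetry of the
  absolute values of the kernel reduce it to row sums, which \<open>D\<close> bounds.\<close>

lemma large_sieve:
  fixes p :: "complex poly"
  assumes deg: "degree p \<le> N"
    and D: "\<And>n. n \<le> N \<Longrightarrow> (\<Sum>n'\<le>N. norm (\<Sum>h\<le>H. e ((\<gamma> * real n - \<gamma> * real n') * real h))) \<le> D"
  shows "(\<Sum>h\<le>H. norm (poly p (e (\<gamma> * real h))) ^ 2) \<le> D * (\<Sum>i\<le>N. norm (coeff p i) ^ 2)"
proof -
  define K where "K i j = norm (\<Sum>h\<le>H. e ((\<gamma> * real i - \<gamma> * real j) * real h))" for i j :: nat
  define c where "c i = norm (coeff p i)" for i
  have sym: "K i j = K j i" for i j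
  proof -
    have "(\<Sum>h\<le>H. e ((\<gamma> * real i - \<gamma> * real j) * real h)) = cnj (\<Sum>h\<le>H. e ((\<gamma> * real j - \<gamma> * real i) * real h))"
      by (simp add: algebra_simps flip: e_minus)
    then show ?thesis by (simp only: K_def complex_mod_cnj)
  qed
  have poly: "poly p (e (\<gamma> * real h)) = (\<Sum>i\<le>N. coeff p i * e (\<gamma> * real i * real h))" for h
  proof -
    have "poly p (e (\<gamma> * real h)) = (\<Sum>i\<le>N. coeff p i * e (\<gamma> * real h) ^ i)"
      unfolding poly_altdef using deg by (intro sum.mono_neutral_left) (auto simp: coeff_eq_0)
    then show ?thesis by (simp add: mult_ac flip: e_power)
  qed
  have "complex_of_real (\<Sum>h\<le>H. norm (poly p (e (\<gamma> * real h))) ^ 2)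
      = (\<Sum>h\<le>H. \<Sum>i\<le>N. \<Sum>j\<le>N. coeff p i * cnj (coeff p j) * e ((\<gamma> * real i - \<gamma> * real j) * real h))"
  proof -
    have "complex_of_real (norm (poly p (e (\<gamma> * real h))) ^ 2)
        = (\<Sum>i\<le>N. \<Sum>j\<le>N. coeff p i * cnj (coeff p j) * e ((\<gamma> * real i - \<gamma> * real j) * real h))" for h
    proof -
      have "e ((\<gamma> * real i - \<gamma> * real j) * real h) = e (\<gamma> * real i * real h) * cnj (e (\<gamma> * real j * real h))" for i j
        by (simp add: left_diff_distrib flip: e_add e_minus)
      then show ?thesis
        unfolding complex_norm_square poly by (simp add: sum_product mult_ac)
    qed
    then show ?thesis by simp
  qed
  also have "\<dots> = (\<Sum>i\<le>N. \<Sum>j\<le>N. coeff p i * cnj (coeff p j) * (\<Sum>h\<le>H. e ((\<gamma> * real i - \<gamma> * real j) * real h)))"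
    by (subst sum.swap, rule sum.cong[OF refl], subst sum.swap) (simp add: sum_distrib_left)
  finally have "norm (complex_of_real (\<Sum>h\<le>H. norm (poly p (e (\<gamma> * real h))) ^ 2)) \<le> (\<Sum>i\<le>N. \<Sum>j\<le>N. c i * c j * K i j)"
    by (simp only:) (intro sum_norm_le, simp add: norm_mult c_def K_def)
  then have "(\<Sum>h\<le>H. norm (poly p (e (\<gamma> * real h))) ^ 2) \<le> (\<Sum>i\<le>N. \<Sum>j\<le>N. c i * c j * K i j)"
    by (simp only: norm_of_real abs_of_nonneg sum_nonneg zero_le_power2)
  also have "\<dots> \<le> (\<Sum>i\<le>N. \<Sum>j\<le>N. (c i ^ 2 / 2) * K i j + (c j ^ 2 / 2) * K i j)"
  proof (intro sum_mono)
    fix i j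
    have "c i * c j \<le> c i ^ 2 / 2 + c j ^ 2 / 2" using sum_squares_bound[of "c i" "c j"] by simp
    then have "c i * c j * K i j \<le> (c i ^ 2 / 2 + c j ^ 2 / 2) * K i j"
      by (intro mult_right_mono) (auto simp: K_def)
    then show "c i * c j * K i j \<le> (c i ^ 2 / 2) * K i j + (c j ^ 2 / 2) * K i j" by (simp add: algebra_simps)
  qed
  also have "\<dots> = (\<Sum>i\<le>N. c i ^ 2 / 2 * (\<Sum>j\<le>N. K i j)) + (\<Sum>j\<le>N. c j ^ 2 / 2 * (\<Sum>i\<le>N. K j i))"
    unfolding sum.distrib
    by (subst (2) sum.swap) (simp add: sum_distrib_left sym)
  also have "\<dots> = (\<Sum>i\<le>N. c i ^ 2 * (\<Sum>j\<le>N. K i j))"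
    by (simp add: field_simps flip: sum.distrib)
  also have "\<dots> \<le> (\<Sum>i\<le>N. c i ^ 2 * D)"
    using D by (intro sum_mono mult_left_mono) (auto simp: K_def)
  finally show ?thesis by (simp add: c_def sum_distrib_left mult.commute)
qed

lemma weighted_power_mean_nat:
  fixes w x :: "'a \<Rightarrow> real"
  assumes "n \<ge> 1" "\<And>i. i \<in> I \<Longrightarrow> w i \<ge> 0" "\<And>i. i \<in> I \<Longrightarrow> x i \<ge> 0"
  shows "(\<Sum>i\<in>I. w i * x i) ^ n \<le> (\<Sum>i\<in>I. w i) ^ (n - 1) * (\<Sum>i\<in>I. w i * x i ^ n)"
proof -
  have nn: "(\<Sum>i\<in>I. w i * x i) \<ge> 0" "(\<Sum>i\<in>I. w i) \<ge> 0" "(\<Sum>i\<in>I. w i * x i ^ n) \<ge> 0"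
    using assms by (auto intro!: sum_nonneg)
  have "(\<Sum>i\<in>I. w i * x i) ^ n = (\<Sum>i\<in>I. w i * x i) powr real n"
    using assms(1) nn by (intro powr_realpow'[symmetric]) auto
  also have "\<dots> \<le> (\<Sum>i\<in>I. w i) powr (real n - 1) * (\<Sum>i\<in>I. w i * x i powr real n)"
    using assms by (intro weighted_power_mean) auto
  also have "(\<Sum>i\<in>I. w i * x i powr real n) = (\<Sum>i\<in>I. w i * x i ^ n)"
    using assms by (intro sum.cong refl) (simp add: powr_realpow')
  \<comment> \<open>Only an inequality: for \<open>n = 1\<close> and vanishing total weight,
    \<open>powr\<close> gives \<open>0\<close> where the power gives \<open>1\<close>.\<close>
  also have "(\<Sum>i\<in>I. w i) powr (real n - 1) \<le> (\<Sum>i\<in>I. w i) ^ (n - 1)"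
    using powr_realpow'[OF nn(2), of "n - 1"] assms(1) by (cases "n = 1") (auto simp: of_nat_diff)
  finally show ?thesis using nn by (simp add: mult_right_mono)
qed

lemma degree_kpoly_power_le:
  assumes "w \<ge> 1" "\<And>z. z \<in> A \<Longrightarrow> w * z ^ k \<le> L"
  shows "degree (kpoly k A c ^ w) \<le> L"
proof -
  have "degree (kpoly k A c) \<le> L div w"
  proof (rule degree_kpoly_le)
    fix z assume "z \<in> A"
    then show "z ^ k \<le> L div w" using assms by (simp add: less_eq_div_iff_mult_less_eq mult.commute)
  qed
  then have "degree (kpoly k A c) * w \<le> L div w * w" by (rule mult_right_mono) simp
  also have "\<dots> \<le> L" by simp
  finally show ?thesis using degree_power_le[of "kpoly k A c" w] by linarith
qed

lemma cnj_sgn_mult: "cnj (sgn z) * z = of_real (norm z)"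
proof (cases "z = 0")
  case False
  have "cnj (sgn z) * z = z * cnj z / of_real (norm z)"
    by (simp add: sgn_eq)
  also have "\<dots> = of_real (norm z)"
    using False by (simp only: complex_norm_square[symmetric]) (simp add: power2_eq_square)
  finally show ?thesis .
qed simp

text \<open>Hoelder's inequality is applied in both variables, so that the coefficients are replaced by the
  representation numbers of sums of \<open>w\<close> powers, whose \<open>l\<^sup>2\<close> norms are moments of order \<open>2 * w\<close>.\<close>
lemma bilinear_bound:
  fixes a b :: "nat \<Rightarrow> complex"
  assumes w: "w \<ge> 1"
    and M: "finite M'" "M \<subseteq> M'" "\<And>m. m \<in> M' \<Longrightarrow> w * m ^ k \<le> N" "\<And>m. m \<in> M \<Longrightarrow> norm (a m) \<le> 1"
    and Z: "finite Z'" "Z \<subseteq> Z'" "\<And>z. z \<in> Z' \<Longrightarrow> w * z ^ k \<le> H" "\<And>z. z \<in> Z \<Longrightarrow> norm (b z) \<le> 1"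
    and D: "\<And>n. n \<le> N \<Longrightarrow> (\<Sum>n'\<le>N. norm (\<Sum>h\<le>H. e ((\<gamma> * real n - \<gamma> * real n') * real h))) \<le> D"
    and EM: "(\<Sum>i\<le>N. coeff (kpoly k M' (\<lambda>_. 1 :: real) ^ w) i ^ 2) \<le> EM"
    and EZ: "(\<Sum>i\<le>H. coeff (kpoly k Z' (\<lambda>_. 1 :: real) ^ w) i ^ 2) \<le> EZ"
  shows "norm (\<Sum>m\<in>M. \<Sum>z\<in>Z. a m * b z * e (\<gamma> * real m ^ k * real z ^ k)) ^ (w * w)
    \<le> real (card M) ^ ((w - 1) * w) * real (card Z) ^ (w * (w - 1)) * sqrt (EZ * (D * EM))"
proof -
  have fin: "finite M" "finite Z" using finite_subset[OF M(2,1)] finite_subset[OF Z(2,1)] .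
  have deg: "degree (kpoly k A c ^ w) \<le> L" if "A \<subseteq> A'" "\<And>z. z \<in> A' \<Longrightarrow> w * z ^ k \<le> L"
    for A A' L and c :: "nat \<Rightarrow> 'b::comm_ring_1"
    using that by (intro degree_kpoly_power_le w) auto
  define pz where "pz = kpoly k Z b"
  define x where "x m = e (\<gamma> * real m ^ k)" for m :: nat
  have px: "poly pz (x m) = (\<Sum>z\<in>Z. b z * e (\<gamma> * real m ^ k * real z ^ k))" for m
    by (simp add: pz_def x_def poly_kpoly_e)
  \<comment> \<open>These factors of modulus at most \<open>1\<close> absorb the absolute values, so
    that the sum over \<open>m\<close> can be moved inside and becomes the polynomial
    \<open>pm\<close>.\<close>
  define \<epsilon> where "\<epsilon> m = cnj (sgn (poly (pz ^ w) (x m)))" for m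
  have \<epsilon>1: "norm (\<epsilon> m) \<le> 1" for m by (simp add: \<epsilon>_def norm_sgn)
  have \<epsilon>2: "\<epsilon> m * poly (pz ^ w) (x m) = norm (poly (pz ^ w) (x m))" for m
    unfolding \<epsilon>_def by (rule cnj_sgn_mult)
  define pm where "pm = kpoly k M \<epsilon>"
  define \<rho> where "\<rho> h = coeff (kpoly k Z' (\<lambda>_. 1 :: real) ^ w) h" for h
  \<comment> \<open>Hoelder's inequality uses the exact total mass \<open>card Z ^ w\<close>, so the
    counts for \<open>Z\<close> itself are kept; those for \<open>Z'\<close> enter only through
    their mean square.\<close>
  define \<rho>Z where "\<rho>Z h = coeff (kpoly k Z (\<lambda>_. 1 :: real) ^ w) h" for h
  have bz: "norm (coeff (pz ^ w) h) \<le> \<rho>Z h" for h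
    unfolding pz_def \<rho>Z_def by (rule norm_coeff_kpoly_power_le) (use Z fin in auto)
  have \<rho>Z0: "\<rho>Z h \<ge> 0" for h using bz[of h] norm_ge_zero order_trans by blast
  have \<rho>Z: "\<rho>Z h \<le> \<rho> h" for h
    using norm_coeff_kpoly_power_le[of Z Z' "\<lambda>_. 1 :: real" k w h] Z by (simp add: \<rho>Z_def \<rho>_def)
  define S where "S = (\<Sum>m\<in>M. \<Sum>z\<in>Z. a m * b z * e (\<gamma> * real m ^ k * real z ^ k))"
  define T where "T = (\<Sum>m\<in>M. norm (poly (pz ^ w) (x m)))"
  define \<Phi> where "\<Phi> h = norm (poly pm (e (\<gamma> * real h)))" for h :: nat
  have 1: "norm S ^ w \<le> real (card M) ^ (w - 1) * T"
  proof -
    have "S = (\<Sum>m\<in>M. a m * poly pz (x m))" by (simp add: S_def px sum_distrib_left mult_ac)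
    also have "norm \<dots> \<le> (\<Sum>m\<in>M. 1 * norm (poly pz (x m)))"
      using M(4) by (intro sum_norm_le) (auto simp: norm_mult intro!: mult_left_le_one_le)
    finally have "norm S ^ w \<le> (\<Sum>m\<in>M. 1 * norm (poly pz (x m))) ^ w" by (intro power_mono) auto
    also have "\<dots> \<le> (\<Sum>m\<in>M. 1) ^ (w - 1) * (\<Sum>m\<in>M. 1 * norm (poly pz (x m)) ^ w)"
      using w by (intro weighted_power_mean_nat) auto
    finally show ?thesis by (simp add: T_def norm_power)
  qed
  have 2: "T \<le> (\<Sum>h\<le>H. \<rho>Z h * \<Phi> h)"
  proof -
    have "complex_of_real T = (\<Sum>m\<in>M. \<epsilon> m * poly (pz ^ w) (x m))" by (simp only: T_def \<epsilon>2 of_real_sum)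
    also have "\<dots> = (\<Sum>m\<in>M. \<Sum>h\<le>H. \<epsilon> m * (coeff (pz ^ w) h * x m ^ h))"
    proof (intro sum.cong refl)
      fix m
      have "poly (pz ^ w) (x m) = (\<Sum>h\<le>H. coeff (pz ^ w) h * x m ^ h)"
        unfolding poly_altdef using deg[of Z Z' H b] Z
        by (intro sum.mono_neutral_left) (auto simp: coeff_eq_0 pz_def)
      then show "\<epsilon> m * poly (pz ^ w) (x m) = (\<Sum>h\<le>H. \<epsilon> m * (coeff (pz ^ w) h * x m ^ h))"
        by (simp only: sum_distrib_left)
    qed
    also have "\<dots> = (\<Sum>h\<le>H. coeff (pz ^ w) h * poly pm (e (\<gamma> * real h)))"
    proof (subst sum.swap, intro sum.cong refl)
      fix h
      have "x m ^ h = e (\<gamma> * real h * real m ^ k)" for m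
        unfolding x_def by (simp add: mult_ac flip: e_power)
      then show "(\<Sum>m\<in>M. \<epsilon> m * (coeff (pz ^ w) h * x m ^ h)) = coeff (pz ^ w) h * poly pm (e (\<gamma> * real h))"
        by (simp add: pm_def poly_kpoly_e sum_distrib_left mult_ac)
    qed
    finally have "norm (complex_of_real T) \<le> (\<Sum>h\<le>H. \<rho>Z h * \<Phi> h)"
      by (simp only:) (intro sum_norm_le, use bz in \<open>auto simp: norm_mult \<Phi>_def intro!: mult_right_mono\<close>)
    moreover have "T \<ge> 0" by (simp add: T_def sum_nonneg)
    ultimately show ?thesis by simp
  qed
  have T0: "T \<ge> 0" by (simp add: T_def sum_nonneg)
  have 3: "(\<Sum>h\<le>H. \<rho>Z h) = real (card Z) ^ w"
  proof -
    have "(\<Sum>h\<le>H. \<rho>Z h) = poly (kpoly k Z (\<lambda>_. 1 :: real) ^ w) 1"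
      unfolding poly_altdef \<rho>Z_def using deg[of Z Z' H] Z
      by (intro sum.mono_neutral_cong_right) (auto simp: coeff_eq_0)
    then show ?thesis by (simp add: poly_kpoly_1)
  qed
  have 4: "T ^ w \<le> real (card Z) ^ (w * (w - 1)) * (\<Sum>h\<le>H. \<rho>Z h * \<Phi> h ^ w)"
  proof -
    have "T ^ w \<le> (\<Sum>h\<le>H. \<rho>Z h * \<Phi> h) ^ w" using 2 T0 by (intro power_mono) auto
    also have "\<dots> \<le> (\<Sum>h\<le>H. \<rho>Z h) ^ (w - 1) * (\<Sum>h\<le>H. \<rho>Z h * \<Phi> h ^ w)"
      using w \<rho>Z0 by (intro weighted_power_mean_nat) (auto simp: \<Phi>_def)
    finally show ?thesis by (simp only: 3 power_mult)
  qed
  \<comment> \<open>Cauchy-Schwarz separates the representation numbers of \<open>z\<close> from the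
    sum over \<open>m\<close>; the power \<open>w\<close> of the latter is again a polynomial value,
    to which the large sieve applies.\<close>
  have 5: "(\<Sum>h\<le>H. \<rho>Z h * \<Phi> h ^ w) \<le> sqrt (EZ * (D * EM))"
  proof -
    have D0: "D \<ge> 0" by (rule order_trans[OF sum_nonneg D[of 0]]) auto
    have "(\<Sum>h\<le>H. \<rho>Z h * \<Phi> h ^ w) ^ 2 \<le> (\<Sum>h\<le>H. \<rho>Z h ^ 2) * (\<Sum>h\<le>H. (\<Phi> h ^ w) ^ 2)"
      by (rule Cauchy_Schwarz_ineq_sum)
    also have "\<dots> \<le> EZ * (D * EM)"
    proof (intro mult_mono)
      have "(\<Sum>h\<le>H. \<rho>Z h ^ 2) \<le> (\<Sum>h\<le>H. \<rho> h ^ 2)"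
        using \<rho>Z \<rho>Z0 by (intro sum_mono power_mono) auto
      then show EZ: "(\<Sum>h\<le>H. \<rho>Z h ^ 2) \<le> EZ" using EZ by (simp add: \<rho>_def)
      have "(\<Sum>h\<le>H. (\<Phi> h ^ w) ^ 2) = (\<Sum>h\<le>H. norm (poly (pm ^ w) (e (\<gamma> * real h))) ^ 2)"
        by (simp add: \<Phi>_def norm_power)
      also have "\<dots> \<le> D * (\<Sum>i\<le>N. norm (coeff (pm ^ w) i) ^ 2)"
        using M by (intro large_sieve D) (auto simp: pm_def intro!: deg)
      also have "(\<Sum>i\<le>N. norm (coeff (pm ^ w) i) ^ 2) \<le> EM"
        by (rule order_trans[OF _ EM], intro sum_mono power_mono, unfold pm_def, rule norm_coeff_kpoly_power_le)
           (use M \<epsilon>1 in auto)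
      finally show "(\<Sum>h\<le>H. (\<Phi> h ^ w) ^ 2) \<le> D * EM" using D0 by (simp add: mult_left_mono)
      show "EZ \<ge> 0" by (rule order_trans[OF sum_nonneg EZ]) auto
    qed (auto intro!: sum_nonneg)
    finally show ?thesis by (rule real_le_rsqrt)
  qed
  have "norm S ^ (w * w) = (norm S ^ w) ^ w" by (simp add: power_mult)
  also have "\<dots> \<le> (real (card M) ^ (w - 1) * T) ^ w" using 1 by (intro power_mono) auto
  also have "\<dots> = real (card M) ^ ((w - 1) * w) * T ^ w" by (simp add: power_mult_distrib power_mult)
  also have "\<dots> \<le> real (card M) ^ ((w - 1) * w) * (real (card Z) ^ (w * (w - 1)) * sqrt (EZ * (D * EM)))"
    by (intro mult_left_mono order_trans[OF 4] 5) auto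
  finally show ?thesis by (simp add: S_def mult_ac)
qed

text \<open>The condition \<open>z \<le> V\<close> is detected by additive characters modulo
  \<open>L\<close>. The majorant \<open>C\<close> does not depend on \<open>V\<close> and has
  logarithmic mass, so a cutoff that varies with another variable can be removed at the cost of a
  logarithm.\<close>

lemma fourier_initial_segment:
  assumes "L \<ge> (1::nat)"
  obtains C :: "nat \<Rightarrow> real" where "\<And>j. C j > 0" "(\<Sum>j<L. C j) \<le> 1 + 2 * harm L"
    "\<And>V. V < L \<Longrightarrow> \<exists>c. (\<forall>j<L. norm (c j) \<le> C j) \<and>
        (\<forall>z<L. (\<Sum>j<L. c j * e (real j / real L * real z)) = (if z \<le> V then 1 else 0))"
proof
  \<comment> \<open>Geometric sums give \<open>1 / j\<close> or \<open>1 / (L - j)\<close>,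
    depending on which end of the period is nearer; the sum of both covers either case. For
    \<open>j \<ge> L\<close> the value \<open>1\<close> just keeps \<open>C\<close> positive, since
    it will be divided by.\<close>
  define C :: "nat \<Rightarrow> real" where "C j = (if j = 0 \<or> j \<ge> L then 1 else 1 / real j + 1 / real (L - j))" for j
  show "C j > 0" for j by (auto simp: C_def add_pos_pos)
  show "(\<Sum>j<L. C j) \<le> 1 + 2 * harm L"
  proof -
    have "{..<L} = insert 0 {1..<L}" using assms by auto
    then have "(\<Sum>j<L. C j) = 1 + (\<Sum>j\<in>{1..<L}. 1 / real j + 1 / real (L - j))"
      by (simp add: C_def)
    also have "(\<Sum>j\<in>{1..<L}. 1 / real j + 1 / real (L - j)) = (\<Sum>j\<in>{1..<L}. 1 / real j) + (\<Sum>j\<in>{1..<L}. 1 / real (L - j))"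
      by (rule sum.distrib)
    also have "(\<Sum>j\<in>{1..<L}. 1 / real (L - j)) = (\<Sum>j\<in>{1..<L}. 1 / real j)"
      by (rule sum.reindex_bij_witness[of _ "\<lambda>j. L - j" "\<lambda>j. L - j"]) auto
    also have "(\<Sum>j\<in>{1..<L}. 1 / real j) \<le> harm L"
      unfolding harm_def by (simp only: inverse_eq_divide) (intro sum_mono2, auto)
    finally show ?thesis by simp
  qed
  fix V assume V: "V < L"
  define c where "c j = (\<Sum>y\<le>V. e (- (real j / real L) * real y)) / of_nat L" for j
  have "norm (c j) \<le> C j" if j: "j < L" for j
  proof (cases "j = 0")
    case True
    then show ?thesis using V by (simp add: c_def C_def norm_divide field_simps flip: of_nat_Suc)
  next
    case False
    have L: "real L > 0" using j by simp
    define x where "x = - (real j / real L)"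
    have "norm (\<Sum>y\<le>V. e (x * real y)) \<le> real L * C j"
    proof (cases "2 * j \<le> L")
      case True
      have "norm (\<Sum>y\<le>V. e (x * real y)) \<le> 1 / \<bar>x - of_int 0\<bar>"
        using True False L by (intro norm_sum_e_le) (auto simp: x_def field_simps)
      also have "\<dots> = real L * (1 / real j)" using L by (simp add: x_def)
      also have "\<dots> \<le> real L * C j" using False j by (intro mult_left_mono) (auto simp: C_def)
      finally show ?thesis .
    next
      \<comment> \<open>Here the integer nearest to \<open>- j / L\<close> is
        \<open>-1\<close>.\<close>
      case F: False
      have xx: "x - of_int (-1) = real (L - j) / real L" using j L by (simp add: x_def field_simps of_nat_diff)
      have "norm (\<Sum>y\<le>V. e (x * real y)) \<le> 1 / \<bar>x - of_int (-1)\<bar>"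
      proof (intro norm_sum_e_le)
        show "\<bar>x - of_int (-1)\<bar> \<le> 1 / 2" unfolding xx using F j L by (simp add: field_simps)
        have "x - of_int (-1) > 0" unfolding xx using j by simp
        then show "x \<noteq> of_int (-1)" by auto
      qed
      also have "\<dots> = real L * (1 / real (L - j))" unfolding xx using L j by simp
      also have "\<dots> \<le> real L * C j" using False j by (intro mult_left_mono) (auto simp: C_def)
      finally show ?thesis .
    qed
    then show ?thesis using L by (simp add: c_def x_def norm_divide field_simps)
  qed
  moreover have "(\<Sum>j<L. c j * e (real j / real L * real z)) = (if z \<le> V then 1 else 0)" if z: "z < L" for z
  proof -
    have orth: "(\<Sum>j<L. e ((real z - real y) / real L) ^ j) = (if y = z then of_nat L else 0)" if y: "y < L" for y
    proof (cases "y = z")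
      case False
      define x where "x = (real z - real y) / real L"
      have L: "real L > 0" using z by simp
      have "\<bar>real z - real y\<bar> < real L" "real z \<noteq> real y" using y z False by auto
      then have x: "\<bar>x\<bar> < 1" "x \<noteq> 0" using L by (auto simp: x_def field_simps)
      have "e x \<noteq> 1"
      proof
        assume "e x = 1"
        then have "exp (2 * complex_of_real pi * \<i> * complex_of_real x) = 1" by (simp add: e_def)
        then obtain n :: int where "2 * pi * x = of_int (2 * n) * pi" by (auto simp: exp_eq_1)
        then have "x = of_int n" by simp
        then show False using x by auto
      qed
      moreover have "e x ^ L = 1"
      proof -
        have "x * real L = of_int (int z - int y)" using L by (simp add: x_def)
        then show ?thesis by (metis e_power e_int)
      qed
      ultimately show ?thesis using False by (simp add: geometric_sum flip: x_def)
    qed simp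
    have "(\<Sum>j<L. c j * e (real j / real L * real z)) = (\<Sum>j<L. \<Sum>y\<le>V. e ((real z - real y) / real L) ^ j / of_nat L)"
    proof (intro sum.cong refl)
      fix j
      have "e (- (real j / real L) * real y) * e (real j / real L * real z) = e ((real z - real y) / real L) ^ j" for y
        by (simp add: algebra_simps diff_divide_distrib flip: e_power e_add)
      then show "c j * e (real j / real L * real z) = (\<Sum>y\<le>V. e ((real z - real y) / real L) ^ j / of_nat L)"
        by (simp add: c_def sum_distrib_right sum_divide_distrib)
    qed
    also have "\<dots> = (\<Sum>y\<le>V. (\<Sum>j<L. e ((real z - real y) / real L) ^ j) / of_nat L)"
      by (subst sum.swap) (simp add: sum_divide_distrib)
    also have "\<dots> = (\<Sum>y\<le>V. if y = z then 1 else 0)"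
      using V by (intro sum.cong refl) (simp add: orth)
    finally show ?thesis by simp
  qed
  ultimately show "\<exists>c. (\<forall>j<L. norm (c j) \<le> C j) \<and>
        (\<forall>z<L. (\<Sum>j<L. c j * e (real j / real L * real z)) = (if z \<le> V then 1 else 0))"
    by blast
qed

subsection \<open>Factorisation of smooth numbers\<close>

lemma smooth_set_less_1: "P < 1 \<Longrightarrow> smooth_set P R = {}"
  by (auto simp: smooth_set_def)

lemma one_in_smooth_set: "P \<ge> 1 \<Longrightarrow> 1 \<in> smooth_set P R"
  by (auto simp: smooth_set_def)

text \<open>The cofactor of the largest prime \<open>p\<close> is smooth with bound
  \<open>p\<close>, so a set of the same shape recurs; only \<open>1\<close>, without prime factors,
  stands apart.\<close>

lemma smooth_set_largest_prime:
  assumes "Y \<ge> (1::real)"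
  shows "smooth_set Y (real r) =
    insert 1 (\<Union>p\<in>{p. prime p \<and> p \<le> r \<and> real p \<le> Y}. (\<lambda>z. p * z) ` smooth_set (Y / real p) (real p))"
    (is "_ = insert 1 (\<Union>p\<in>?Q. _)")
proof (intro equalityI subsetI)
  fix x assume x: "x \<in> smooth_set Y (real r)"
  then have x1: "x \<ge> 1" "real x \<le> Y" "\<And>p. prime p \<Longrightarrow> p dvd x \<Longrightarrow> p \<le> r" by (auto simp: smooth_set_def)
  show "x \<in> insert 1 (\<Union>p\<in>?Q. (\<lambda>z. p * z) ` smooth_set (Y / real p) (real p))"
  proof (cases "x = 1")
    case False
    define p where "p = Max (prime_factors x)"
    have ne: "prime_factors x \<noteq> {}"
      using False x1 prime_factor_nat[of x] by (auto simp: prime_factors_dvd)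
    then have "p \<in> prime_factors x" unfolding p_def by (intro Max_in) auto
    then have p: "prime p" "p dvd x" by auto
    have pm: "q \<le> p" if "prime q" "q dvd x" for q
      unfolding p_def using that x1 by (intro Max_ge) (auto simp: prime_factors_dvd)
    obtain z where z: "x = p * z" using p(2) by (rule dvdE)
    have "p \<le> x" using p(2) x1 by (auto intro: dvd_imp_le)
    then have Q: "p \<in> ?Q" using p x1 by (auto intro: order_trans[of "real p" "real x"])
    have "z \<in> smooth_set (Y / real p) (real p)"
      using x1 pm p prime_gt_0_nat[OF p(1)] by (auto simp: smooth_set_def z field_simps Suc_le_eq)
    then show ?thesis using Q z by blast
  qed simp
next
  fix x assume "x \<in> insert 1 (\<Union>p\<in>?Q. (\<lambda>z. p * z) ` smooth_set (Y / real p) (real p))"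
  then consider "x = 1" | p z where "p \<in> ?Q" "z \<in> smooth_set (Y / real p) (real p)" "x = p * z" by blast
  then show "x \<in> smooth_set Y (real r)"
  proof cases
    case 2
    then have p: "prime p" "p \<le> r" and z: "z \<ge> 1" "real z \<le> Y / real p" "\<And>q. prime q \<Longrightarrow> q dvd z \<Longrightarrow> q \<le> p"
      by (auto simp: smooth_set_def)
    have "q \<le> r" if "prime q" "q dvd p * z" for q
      using that p z(3)[of q] by (auto simp: prime_dvd_mult_iff dest: primes_dvd_imp_eq)
    then show ?thesis using 2 p z prime_gt_0_nat[OF p(1)]
      by (auto simp: smooth_set_def field_simps Suc_le_eq)
  qed (use assms one_in_smooth_set in simp)
qed

text \<open>The largest prime factor can be read off the product, so the sets belonging to different
  primes are disjoint.\<close>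

lemma largest_prime_unique:
  assumes "prime p" "prime p'" "z \<in> smooth_set Y (real p)" "z' \<in> smooth_set Y' (real p')" "p * z = p' * z'"
  shows "p = (p' :: nat)"
proof -
  have "p \<le> p'" if "prime p" "prime p'" "z' \<in> smooth_set Y' (real p')" "p * z = p' * z'" for p p' z z' Y'
  proof -
    have "p dvd p' * z'" using that by (metis dvd_triv_left)
    then have "p dvd p' \<or> p dvd z'" using that by (simp add: prime_dvd_mult_iff)
    then show ?thesis using that by (auto simp: smooth_set_def dest: primes_dvd_imp_eq)
  qed
  from this[OF assms(1,2,4,5)] this[OF assms(2,1,3) assms(5)[symmetric]] show ?thesis by simp
qed

lemma sum_smooth_set_largest_prime:
  fixes G :: "nat \<Rightarrow> complex"
  assumes "Y \<ge> 1"
  shows "(\<Sum>z\<in>smooth_set Y (real r). G z) =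
    G 1 + (\<Sum>p\<in>{p. prime p \<and> p \<le> r \<and> real p \<le> Y}. \<Sum>z\<in>smooth_set (Y / real p) (real p). G (p * z))"
proof -
  define Q where "Q = {p. prime p \<and> p \<le> r \<and> real p \<le> Y}"
  have finQ: "finite Q" unfolding Q_def by (rule finite_subset[of _ "{..r}"]) auto
  have "(\<Sum>z\<in>smooth_set Y (real r). G z) = G 1 + (\<Sum>x\<in>(\<Union>p\<in>Q. (\<lambda>z. p * z) ` smooth_set (Y / real p) (real p)). G x)"
    unfolding smooth_set_largest_prime[OF assms] Q_def[symmetric]
  proof (rule sum.insert)
    show "1 \<notin> (\<Union>p\<in>Q. (\<lambda>z. p * z) ` smooth_set (Y / real p) (real p))"
      by (auto simp: Q_def)
  qed (use finQ in auto)
  also have "(\<Sum>x\<in>(\<Union>p\<in>Q. (\<lambda>z. p * z) ` smooth_set (Y / real p) (real p)). G x)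
      = (\<Sum>p\<in>Q. \<Sum>x\<in>(\<lambda>z. p * z) ` smooth_set (Y / real p) (real p). G x)"
  proof (rule sum.UNION_disjoint[OF finQ])
    show "\<forall>i\<in>Q. \<forall>j\<in>Q. i \<noteq> j \<longrightarrow> (\<lambda>z. i * z) ` smooth_set (Y / real i) (real i) \<inter> (\<lambda>z. j * z) ` smooth_set (Y / real j) (real j) = {}"
    proof (intro ballI impI, rule ccontr)
      fix i j assume ij: "i \<in> Q" "j \<in> Q" "i \<noteq> j"
        "(\<lambda>z. i * z) ` smooth_set (Y / real i) (real i) \<inter> (\<lambda>z. j * z) ` smooth_set (Y / real j) (real j) \<noteq> {}"
      then obtain z z' where zz: "z \<in> smooth_set (Y / real i) (real i)" "z' \<in> smooth_set (Y / real j) (real j)" "i * z = j * z'"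
        by blast
      have "prime i" "prime j" using ij(1,2) by (simp_all add: Q_def)
      then have "i = j" using zz by (rule largest_prime_unique)
      then show False using ij by simp
    qed
  qed auto
  also have "\<dots> = (\<Sum>p\<in>Q. \<Sum>z\<in>smooth_set (Y / real p) (real p). G (p * z))"
  proof (rule sum.cong[OF refl])
    fix p assume "p \<in> Q"
    then have "p > 0" by (auto simp: Q_def prime_gt_0_nat)
    then show "(\<Sum>x\<in>(\<lambda>z. p * z) ` smooth_set (Y / real p) (real p). G x) = (\<Sum>z\<in>smooth_set (Y / real p) (real p). G (p * z))"
      by (subst sum.reindex) (auto simp: inj_on_def)
  qed
  finally show ?thesis by (simp add: Q_def)
qed

text \<open>Multiply the prime factors of each smooth number together in decreasing order and stop as soon
  as the partial product satisfies \<open>St\<close>. The numbers for which this never happens are collected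
  in \<open>E\<close>; \<open>B\<close> consists of the partial products reached, with the last prime used.\<close>
lemma smooth_sum_stopping_aux:
  fixes St :: "nat \<Rightarrow> bool" and P :: real
  assumes "m \<ge> 1" "r \<ge> 1"
  shows "\<exists>E B. finite E \<and> finite B \<and>
    (\<forall>F :: nat \<Rightarrow> complex. (\<Sum>z\<in>smooth_set (P / real m) (real r). F (m * z)) =
       (\<Sum>x\<in>E. F x) + (\<Sum>(m', p)\<in>B. \<Sum>z\<in>smooth_set (P / real m') (real p). F (m' * z))) \<and>
    (\<forall>x\<in>E. \<not> St x \<and> (\<exists>z\<in>smooth_set (P / real m) (real r). x = m * z)) \<and>
    (\<forall>(m', p)\<in>B. St m' \<and> 1 \<le> p \<and> p \<le> r \<and> (\<exists>z\<in>smooth_set (P / real m) (real r). m' = m * z) \<and>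
       (m' = m \<or> (\<exists>p0. prime p0 \<and> p0 \<le> r \<and> p0 dvd m' \<and> \<not> St (m' div p0))))"
  using assms
proof (induction "nat \<lfloor>P / real m\<rfloor>" arbitrary: m r rule: less_induct)
  case less
  consider "P / real m < 1" | "P / real m \<ge> 1" "St m" | "P / real m \<ge> 1" "\<not> St m" by linarith
  then show ?case
  proof cases
    case 1
    then show ?thesis by (intro exI[of _ "{}"]) (simp add: smooth_set_less_1)
  next
    case 2
    then show ?thesis using less.prems one_in_smooth_set[OF 2(1), of "real r"]
      by (intro exI[of _ "{}"] exI[of _ "{(m, r)}"]) (auto intro!: bexI[of _ 1])
  next
    case 3
    define Y where "Y = P / real m"
    define Q where "Q = {p. prime p \<and> p \<le> r \<and> real p \<le> Y}"
    have finQ: "finite Q" unfolding Q_def by (rule finite_subset[of _ "{..r}"]) auto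
    have Yp: "P / real (m * p) = Y / real p" for p by (simp add: Y_def)
    define ok where "ok p E B \<longleftrightarrow> finite E \<and> finite B \<and>
      (\<forall>F :: nat \<Rightarrow> complex. (\<Sum>z\<in>smooth_set (Y / real p) (real p). F (m * p * z)) =
         (\<Sum>x\<in>E. F x) + (\<Sum>(m', p)\<in>B. \<Sum>z\<in>smooth_set (P / real m') (real p). F (m' * z))) \<and>
      (\<forall>x\<in>E. \<not> St x \<and> (\<exists>z\<in>smooth_set (Y / real p) (real p). x = m * p * z)) \<and>
      (\<forall>(m', p')\<in>B. St m' \<and> 1 \<le> p' \<and> p' \<le> p \<and> (\<exists>z\<in>smooth_set (Y / real p) (real p). m' = m * p * z) \<and>
         (m' = m * p \<or> (\<exists>p0. prime p0 \<and> p0 \<le> p \<and> p0 dvd m' \<and> \<not> St (m' div p0))))" for p E B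
    have "\<exists>E B. ok p E B" if p: "p \<in> Q" for p
    proof -
      have p2: "p \<ge> 2" using p by (auto simp: Q_def prime_ge_2_nat)
      \<comment> \<open>Division by a prime at least halves \<open>Y \<ge> 1\<close>, so its integer
        part drops strictly; this is the measure of the induction.\<close>
      have "Y / real p \<le> Y / 2" using p2 3(1) by (intro divide_left_mono) (auto simp: Y_def)
      moreover have "Y \<ge> 1" using 3(1) by (simp add: Y_def)
      then have "1 \<le> \<lfloor>Y\<rfloor>" by simp
      then have "Y / 2 < real_of_int \<lfloor>Y\<rfloor>" using real_of_int_floor_gt_diff_one[of Y] by (cases "Y < 2") linarith+
      then have "\<lfloor>Y / 2\<rfloor> < \<lfloor>Y\<rfloor>" by (simp only: floor_less_iff)
      ultimately have "\<lfloor>Y / real p\<rfloor> < \<lfloor>Y\<rfloor>" using floor_mono[of "Y / real p" "Y / 2"] by linarith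
      then have "nat \<lfloor>P / real (m * p)\<rfloor> < nat \<lfloor>P / real m\<rfloor>"
        using 3(1) unfolding Yp Y_def[symmetric] by linarith
      from less.hyps[OF this, of p] show ?thesis using p2 less.prems unfolding ok_def Yp by simp
    qed
    then obtain E B where ok: "\<And>p. p \<in> Q \<Longrightarrow> ok p (E p) (B p)" by metis
    have EB: "\<And>p. p \<in> Q \<Longrightarrow> finite (E p)" "\<And>p. p \<in> Q \<Longrightarrow> finite (B p)"
      "\<And>p F. p \<in> Q \<Longrightarrow> (\<Sum>z\<in>smooth_set (Y / real p) (real p). F (m * p * z) :: complex) =
         (\<Sum>x\<in>E p. F x) + (\<Sum>(m', p)\<in>B p. \<Sum>z\<in>smooth_set (P / real m') (real p). F (m' * z))"
      "\<And>p x. p \<in> Q \<Longrightarrow> x \<in> E p \<Longrightarrow> \<not> St x \<and> (\<exists>z\<in>smooth_set (Y / real p) (real p). x = m * p * z)"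
      "\<And>p m' p'. p \<in> Q \<Longrightarrow> (m', p') \<in> B p \<Longrightarrow> St m' \<and> 1 \<le> p' \<and> p' \<le> p \<and> (\<exists>z\<in>smooth_set (Y / real p) (real p). m' = m * p * z) \<and>
         (m' = m * p \<or> (\<exists>p0. prime p0 \<and> p0 \<le> p \<and> p0 dvd m' \<and> \<not> St (m' div p0)))"
      subgoal using ok unfolding ok_def by blast
      subgoal using ok unfolding ok_def by blast
      subgoal using ok unfolding ok_def by blast
      subgoal using ok unfolding ok_def by blast
      subgoal for p m' p'
      proof -
        assume "p \<in> Q" "(m', p') \<in> B p"
        with ok[OF this(1)] show ?thesis unfolding ok_def by (elim conjE) (drule (1) bspec, simp)
      qed
      done
    have m0: "m > 0" using less.prems by simp
    have mem: "p * z \<in> smooth_set Y (real r)" if "p \<in> Q" "z \<in> smooth_set (Y / real p) (real p)" for p z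
      using smooth_set_largest_prime[of Y r] 3(1) that by (auto simp: Q_def Y_def)
    have uniq: "p = p'" if "p \<in> Q" "p' \<in> Q" "z \<in> smooth_set (Y / real p) (real p)" "z' \<in> smooth_set (Y / real p') (real p')"
      "m * p * z = m * p' * z'" for p p' z z'
    proof -
      have "p * z = p' * z'" using that(5) m0 by (simp add: mult.assoc)
      then show ?thesis using largest_prime_unique[of p p'] that by (auto simp: Q_def)
    qed
    have Edisj: "\<forall>p\<in>Q. \<forall>p'\<in>Q. p \<noteq> p' \<longrightarrow> E p \<inter> E p' = {}"
    proof (intro ballI impI, rule ccontr)
      fix p p' assume pp: "p \<in> Q" "p' \<in> Q" "p \<noteq> p'" "E p \<inter> E p' \<noteq> {}"
      then obtain x where x: "x \<in> E p" "x \<in> E p'" by blast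
      obtain z where "z \<in> smooth_set (Y / real p) (real p)" "x = m * p * z" using EB(4)[OF pp(1) x(1)] by blast
      moreover obtain z' where "z' \<in> smooth_set (Y / real p') (real p')" "x = m * p' * z'" using EB(4)[OF pp(2) x(2)] by blast
      ultimately show False using uniq[OF pp(1,2)] pp(3) by metis
    qed
    have Bdisj: "\<forall>p\<in>Q. \<forall>p'\<in>Q. p \<noteq> p' \<longrightarrow> B p \<inter> B p' = {}"
    proof (intro ballI impI, rule ccontr)
      fix p p' assume pp: "p \<in> Q" "p' \<in> Q" "p \<noteq> p'" "B p \<inter> B p' \<noteq> {}"
      then obtain x r where x: "(x, r) \<in> B p" "(x, r) \<in> B p'" by fast
      obtain z where "z \<in> smooth_set (Y / real p) (real p)" "x = m * p * z" using EB(5)[OF pp(1) x(1)] by blast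
      moreover obtain z' where "z' \<in> smooth_set (Y / real p') (real p')" "x = m * p' * z'" using EB(5)[OF pp(2) x(2)] by blast
      ultimately show False using uniq[OF pp(1,2)] pp(3) by metis
    qed
    have mE: "m \<notin> (\<Union>p\<in>Q. E p)"
    proof
      assume "m \<in> (\<Union>p\<in>Q. E p)"
      then obtain p z where "p \<in> Q" "m = m * p * z" using EB(4) by blast
      then have "p * z = 1" using m0 by (simp add: mult.assoc)
      then show False using \<open>p \<in> Q\<close> by (auto simp: Q_def)
    qed
    show ?thesis
    proof (intro exI conjI)
      show "finite (insert m (\<Union>p\<in>Q. E p))" "finite (\<Union>p\<in>Q. B p)" using finQ EB(1,2) by auto
      show "\<forall>F :: nat \<Rightarrow> complex. (\<Sum>z\<in>smooth_set (P / real m) (real r). F (m * z)) =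
         (\<Sum>x\<in>insert m (\<Union>p\<in>Q. E p). F x) + (\<Sum>(m', p)\<in>(\<Union>p\<in>Q. B p). \<Sum>z\<in>smooth_set (P / real m') (real p). F (m' * z))"
      proof
        fix F :: "nat \<Rightarrow> complex"
        have "(\<Sum>z\<in>smooth_set (P / real m) (real r). F (m * z)) =
          F (m * 1) + (\<Sum>p\<in>Q. \<Sum>z\<in>smooth_set (Y / real p) (real p). F (m * (p * z)))"
          unfolding Q_def Y_def by (rule sum_smooth_set_largest_prime[OF 3(1)])
        also have "(\<Sum>p\<in>Q. \<Sum>z\<in>smooth_set (Y / real p) (real p). F (m * (p * z)))
            = (\<Sum>p\<in>Q. (\<Sum>x\<in>E p. F x) + (\<Sum>(m', p)\<in>B p. \<Sum>z\<in>smooth_set (P / real m') (real p). F (m' * z)))"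
          using EB(3) by (intro sum.cong refl) (simp add: mult.assoc)
        also have "\<dots> = (\<Sum>x\<in>(\<Union>p\<in>Q. E p). F x) + (\<Sum>(m', p)\<in>(\<Union>p\<in>Q. B p). \<Sum>z\<in>smooth_set (P / real m') (real p). F (m' * z))"
          using finQ EB(1,2) Edisj Bdisj by (simp add: sum.distrib sum.UNION_disjoint)
        finally show "(\<Sum>z\<in>smooth_set (P / real m) (real r). F (m * z)) =
         (\<Sum>x\<in>insert m (\<Union>p\<in>Q. E p). F x) + (\<Sum>(m', p)\<in>(\<Union>p\<in>Q. B p). \<Sum>z\<in>smooth_set (P / real m') (real p). F (m' * z))"
          using mE finQ EB(1) by (simp add: add.assoc)
      qed
      show "\<forall>x\<in>insert m (\<Union>p\<in>Q. E p). \<not> St x \<and> (\<exists>z\<in>smooth_set (P / real m) (real r). x = m * z)"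
      proof
        fix x assume "x \<in> insert m (\<Union>p\<in>Q. E p)"
        then consider "x = m" | p where "p \<in> Q" "x \<in> E p" by blast
        then show "\<not> St x \<and> (\<exists>z\<in>smooth_set (P / real m) (real r). x = m * z)"
        proof cases
          case 1
          then show ?thesis using 3 one_in_smooth_set[OF 3(1), of "real r"] by (auto intro!: bexI[of _ 1])
        next
          case 2
          then obtain z where "\<not> St x" "z \<in> smooth_set (Y / real p) (real p)" "x = m * p * z" using EB(4) by blast
          then show ?thesis using mem[OF 2(1)] by (auto simp: Y_def mult.assoc)
        qed
      qed
      show "\<forall>(m', p)\<in>(\<Union>p\<in>Q. B p). St m' \<and> 1 \<le> p \<and> p \<le> r \<and> (\<exists>z\<in>smooth_set (P / real m) (real r). m' = m * z) \<and>
       (m' = m \<or> (\<exists>p0. prime p0 \<and> p0 \<le> r \<and> p0 dvd m' \<and> \<not> St (m' div p0)))"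
      proof (clarify)
        fix m' p' p assume p: "p \<in> Q" "(m', p') \<in> B p"
        from EB(5)[OF p] obtain z where z: "St m'" "1 \<le> p'" "p' \<le> p" "z \<in> smooth_set (Y / real p) (real p)" "m' = m * p * z"
          and *: "m' = m * p \<or> (\<exists>p0. prime p0 \<and> p0 \<le> p \<and> p0 dvd m' \<and> \<not> St (m' div p0))" by blast
        have pr: "prime p" "p \<le> r" using p by (auto simp: Q_def)
        \<comment> \<open>If the product stopped right after the prime \<open>p\<close>, its
          predecessor is \<open>m\<close>, which violates \<open>St\<close> in this case; otherwise
          the recursive call supplies the predecessor.\<close>
        have "\<exists>p0. prime p0 \<and> p0 \<le> r \<and> p0 dvd m' \<and> \<not> St (m' div p0)"
        proof (cases "m' = m * p")
          case True
          then have "m' div p = m" using prime_gt_0_nat[OF pr(1)] by simp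
          then show ?thesis using pr True 3(2) by auto
        next
          case False
          then show ?thesis using * pr by (meson order_trans)
        qed
        then show "St m' \<and> 1 \<le> p' \<and> p' \<le> r \<and> (\<exists>z\<in>smooth_set (P / real m) (real r). m' = m * z) \<and>
           (m' = m \<or> (\<exists>p0. prime p0 \<and> p0 \<le> r \<and> p0 dvd m' \<and> \<not> St (m' div p0)))"
          using z pr mem[OF p(1) z(4)] by (auto simp: Y_def mult.assoc)
      qed
    qed
  qed
qed

text \<open>The recursion started at the empty product. The predecessor \<open>m div p0\<close>
  violates \<open>St\<close>; when \<open>St\<close> says that \<open>m\<close> is large, this
  bounds \<open>m\<close> from above up to the factor \<open>r\<close>.\<close>

lemma smooth_sum_stopping:
  fixes St :: "nat \<Rightarrow> bool" and P :: real
  assumes "r \<ge> 1"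
  obtains E :: "nat set" and B :: "(nat \<times> nat) set" where "finite E" "finite B"
    "\<And>F :: nat \<Rightarrow> complex. (\<Sum>z\<in>smooth_set P (real r). F z) =
       (\<Sum>x\<in>E. F x) + (\<Sum>(m, p)\<in>B. \<Sum>z\<in>smooth_set (P / real m) (real p). F (m * z))"
    "\<And>x. x \<in> E \<Longrightarrow> \<not> St x \<and> x \<in> smooth_set P (real r)"
    "\<And>m p. (m, p) \<in> B \<Longrightarrow> St m \<and> 1 \<le> p \<and> p \<le> r \<and> m \<in> smooth_set P (real r) \<and>
       (m = 1 \<or> (\<exists>p0. prime p0 \<and> p0 \<le> r \<and> p0 dvd m \<and> \<not> St (m div p0)))"
proof -
  from smooth_sum_stopping_aux[OF le_refl assms, of P St] obtain E and B :: "(nat \<times> nat) set" where EB: "finite E" "finite B"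
    "\<forall>F :: nat \<Rightarrow> complex. (\<Sum>z\<in>smooth_set (P / real 1) (real r). F (1 * z)) =
       (\<Sum>x\<in>E. F x) + (\<Sum>(m', p)\<in>B. \<Sum>z\<in>smooth_set (P / real m') (real p). F (m' * z))"
    "\<forall>x\<in>E. \<not> St x \<and> (\<exists>z\<in>smooth_set (P / real 1) (real r). x = 1 * z)"
    "\<forall>(m', p)\<in>B. St m' \<and> 1 \<le> p \<and> p \<le> r \<and> (\<exists>z\<in>smooth_set (P / real 1) (real r). m' = 1 * z) \<and>
       (m' = 1 \<or> (\<exists>p0. prime p0 \<and> p0 \<le> r \<and> p0 dvd m' \<and> \<not> St (m' div p0)))"
    by meson
  show thesis
  proof (rule that[OF EB(1,2)])
    show "(\<Sum>z\<in>smooth_set P (real r). F z) =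
       (\<Sum>x\<in>E. F x) + (\<Sum>(m, p)\<in>B. \<Sum>z\<in>smooth_set (P / real m) (real p). F (m * z))" for F :: "nat \<Rightarrow> complex"
      using EB(3)[THEN spec, of F] by simp
    show "\<not> St x \<and> x \<in> smooth_set P (real r)" if "x \<in> E" for x
      using EB(4) that by fastforce
    show "St m \<and> 1 \<le> p \<and> p \<le> r \<and> m \<in> smooth_set P (real r) \<and>
       (m = 1 \<or> (\<exists>p0. prime p0 \<and> p0 \<le> r \<and> p0 dvd m \<and> \<not> St (m div p0)))" if "(m, p) \<in> B" for m p
      using bspec[OF EB(5) that] by simp
  qed
qed

subsection \<open>Admissible exponents\<close>

text \<open>Hoelder's inequality against the second moment, which is the number of terms by
  Parseval: the tangent inequality with exponent \<open>u / 2\<close> is applied to the squared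
  modulus, at the mean \<open>c\<close>, and integrated.\<close>

lemma Umean_ge_card:
  assumes "k \<ge> 1" "u \<ge> 2"
  shows "real (card (smooth_set P R)) powr (u / 2) \<le> Umean k u P R"
proof -
  define c where "c = real (card (smooth_set P R))"
  define v where "v = u / 2"
  have v: "v \<ge> 1" "u = 2 * v" using assms by (auto simp: v_def)
  have f2: "(norm z powr 2) powr v = norm z powr u" for z :: complex by (simp only: powr_powr v(2))
  have "(LBINT x:{0..1}. (v * c powr (v - 1)) * norm (fsum k x P R) powr 2) \<le>
    (LBINT x:{0..1}. norm (fsum k x P R) powr u + (v - 1) * c powr v)"
  proof (rule set_integral_mono_continuous)
    fix x
    show "(v * c powr (v - 1)) * norm (fsum k x P R) powr 2 \<le> norm (fsum k x P R) powr u + (v - 1) * c powr v"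
      using powr_tangent_le[of "norm (fsum k x P R) powr 2" c v] v unfolding f2 by (simp add: c_def mult_ac)
  qed (use assms in \<open>auto intro!: continuous_intros\<close>)
  also have "\<dots> = Umean k u P R + (LBINT x:{0..1::real}. (v - 1) * c powr v)"
    using assms
    by (subst set_integral_add) (auto simp: Umean_eq intro!: set_integrable_continuous continuous_intros)
  also have "(LBINT x:{0..1::real}. (v - 1) * c powr v) = (v - 1) * c powr v" by (simp add: set_integral_const)
  also have "(LBINT x:{0..1}. (v * c powr (v - 1)) * norm (fsum k x P R) powr 2) = v * c powr (v - 1) * c"
    using Umean_2_eq[OF assms(1), of P R] by (simp add: Umean_eq c_def del: powr_numeral)
  also have "v * c powr (v - 1) * c = v * c powr v"
    by (cases "c = 0") (auto simp: powr_diff c_def)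
  finally show ?thesis by (simp add: c_def v_def algebra_simps)
qed

text \<open>Even for \<open>R\<close> a fixed small power of \<open>P\<close> the sum has almost
  \<open>P\<close> terms, so its moment is at least about \<open>P powr (u / 2)\<close>. If
  \<open>D\<close> fell short by \<open>g\<close>, letting \<open>P\<close> grow would contradict
  this.\<close>

lemma admissible_ge:
  assumes "k \<ge> 1" "u \<ge> 2" "admissible k u D"
  shows "D \<ge> real k - u / 2"
proof (rule ccontr)
  assume neg: "\<not> D \<ge> real k - u / 2"
  define g where "g = real k - u / 2 - D"
  have g: "g > 0" using neg by (simp add: g_def)
  obtain \<eta> C P0 where \<eta>: "\<eta> > 0" and U: "\<And>P R. P \<ge> P0 \<Longrightarrow> 1 \<le> R \<Longrightarrow> R \<le> P powr \<eta> \<Longrightarrow>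
      Umean k u P R \<le> C * P powr (u - real k + D + g / 3)"
    using assms(3) g unfolding admissible_def by (metis divide_pos_pos zero_less_numeral)
  obtain j :: nat where j: "j \<ge> 1" "1 / real j \<le> \<eta>"
  proof -
    obtain n where n: "n > 0" "inverse (real n) < \<eta>" using reals_Archimedean[OF \<eta>] by (metis zero_less_Suc)
    then show thesis using that[of n] by (simp add: inverse_eq_divide)
  qed
  \<comment> \<open>The loss \<open>2 * g / (3 * u)\<close> becomes \<open>g / 3\<close> in the
    power \<open>u / 2\<close>. Together with the \<open>g / 3\<close> spent on admissibility this
    leaves \<open>g / 3\<close> for the contradiction, and \<open>P\<close> is chosen so that
    \<open>P powr (g / 3)\<close> beats the constants.\<close>
  obtain c where c: "c > 0" "\<And>P. P \<ge> 1 \<Longrightarrow> c * P powr (1 - 2 * g / (3 * u)) \<le> real (card (smooth_set P (P powr (1 / j))))"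
    using card_smooth_set_ge[of "2 * g / (3 * u)" j] g assms(2) j by auto
  define c' where "c' = c powr (u / 2)"
  have c': "c' > 0" using c by (simp add: c'_def)
  define P where "P = max (max 1 P0) ((\<bar>C\<bar> / c' + 1) powr (3 / g))"
  have P: "P \<ge> 1" "P \<ge> P0" "(\<bar>C\<bar> / c' + 1) powr (3 / g) \<le> P" by (auto simp: P_def)
  have "c' * P powr (u / 2 - g / 3) = (c * P powr (1 - 2 * g / (3 * u))) powr (u / 2)"
  proof -
    have "(1 - 2 * g / (3 * u)) * (u / 2) = u / 2 - g / 3" using assms(2) by (simp add: field_simps)
    then show ?thesis using c by (simp only: powr_mult powr_powr c'_def)
  qed
  also have "\<dots> \<le> real (card (smooth_set P (P powr (1 / j)))) powr (u / 2)"
    using c P assms(2) by (intro powr_mono2) auto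
  also have "\<dots> \<le> Umean k u P (P powr (1 / j))" by (rule Umean_ge_card[OF assms(1,2)])
  also have "\<dots> \<le> C * P powr (u - real k + D + g / 3)"
    using P j by (intro U powr_mono ge_one_powr_ge_zero) auto
  also have "u - real k + D + g / 3 = u / 2 - 2 * g / 3" by (simp add: g_def field_simps)
  also have "u / 2 - g / 3 = g / 3 + (u / 2 - 2 * g / 3)" by (simp add: field_simps)
  finally have "(c' * P powr (g / 3)) * P powr (u / 2 - 2 * g / 3) \<le> C * P powr (u / 2 - 2 * g / 3)"
    by (simp only: powr_add mult.assoc)
  then have "c' * P powr (g / 3) \<le> C" using P by simp
  moreover have "\<bar>C\<bar> / c' + 1 \<le> P powr (g / 3)"
  proof -
    have "((\<bar>C\<bar> / c' + 1) powr (3 / g)) powr (g / 3) \<le> P powr (g / 3)" using P g by (intro powr_mono2) auto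
    moreover have "\<bar>C\<bar> / c' + 1 > 0" using c' by (intro add_nonneg_pos) auto
    ultimately show ?thesis using g by (simp add: powr_powr)
  qed
  then have "c' * (\<bar>C\<bar> / c' + 1) \<le> c' * P powr (g / 3)" using c' by (intro mult_left_mono) auto
  moreover have "c' * (\<bar>C\<bar> / c' + 1) = \<bar>C\<bar> + c'" using c' by (simp add: field_simps)
  ultimately show False using c' by linarith
qed

text \<open>For small \<open>X\<close> the trivial bound is enough because \<open>u - k + D \<ge> 0\<close>.\<close>
lemma admissible_uniform:
  assumes "k \<ge> 1" "u \<ge> 2" "admissible k u D" "\<epsilon> > 0"
  shows "\<exists>\<eta>>0. \<exists>C\<ge>1. \<exists>P0\<ge>1. \<forall>P\<ge>P0. \<forall>X R. 1 \<le> X \<and> X \<le> P ^ 2 \<and> 1 \<le> R \<and> R \<le> P powr \<eta> \<longrightarrow>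
    Umean k u X R \<le> C * P powr \<epsilon> * X powr (u - real k + D)"
proof -
  obtain \<eta> C P0 where \<eta>: "\<eta> > 0" and U: "\<And>P R. P \<ge> P0 \<Longrightarrow> 1 \<le> R \<Longrightarrow> R \<le> P powr \<eta> \<Longrightarrow>
      Umean k u P R \<le> C * P powr (u - real k + D + \<epsilon> / 2)"
    using assms(3,4) unfolding admissible_def by (metis half_gt_zero)
  \<comment> \<open>For \<open>X \<le> P powr \<delta>\<close> the trivial bound
    \<open>X powr u\<close> does not exceed \<open>P powr \<epsilon>\<close>.\<close>
  define \<delta> where "\<delta> = \<epsilon> / u"
  have \<delta>: "\<delta> > 0" using assms by (simp add: \<delta>_def)
  have ex0: "u - real k + D \<ge> 0" using admissible_ge[OF assms(1-3)] assms(2) by simp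
  define C' P0' where "C' = max 1 C" and "P0' = max 1 P0 powr (1 / \<delta>)"
  \<comment> \<open>Once \<open>X > P powr \<delta>\<close>, the bound
    \<open>P powr (\<eta> * \<delta>)\<close> on \<open>R\<close> implies
    \<open>R \<le> X powr \<eta>\<close>, and \<open>X \<le> P ^ 2\<close> turns
    \<open>X powr (\<epsilon> / 2)\<close> into at most \<open>P powr \<epsilon>\<close>.\<close>
  have "Umean k u X R \<le> C' * P powr \<epsilon> * X powr (u - real k + D)"
    if P: "P \<ge> P0'" and X: "1 \<le> X" "X \<le> P ^ 2" and R: "1 \<le> R" "R \<le> P powr (\<eta> * \<delta>)" for P X R
  proof -
    have P0': "P0' \<ge> 1" unfolding P0'_def using \<delta> by (intro ge_one_powr_ge_zero) auto
    then have P1: "P \<ge> 1" using P by linarith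
    have X1: "X powr (u - real k + D) \<ge> 1" using ex0 X by (intro ge_one_powr_ge_zero) auto
    show ?thesis
    proof (cases "X \<le> P powr \<delta>")
      case True
      have "Umean k u X R \<le> X powr u" using X assms by (intro Umean_le) auto
      also have "\<dots> \<le> (P powr \<delta>) powr u" using True X assms by (intro powr_mono2) auto
      also have "\<dots> = P powr \<epsilon>" using assms by (simp add: powr_powr \<delta>_def)
      also have "\<dots> \<le> C' * P powr \<epsilon> * X powr (u - real k + D)"
        using mult_mono[of 1 "C' * X powr (u - real k + D)" "P powr \<epsilon>" "P powr \<epsilon>"]
          mult_mono[of 1 C' 1 "X powr (u - real k + D)"] X1 by (auto simp: C'_def mult_ac)
      finally show ?thesis .
    next
      case False
      have "max 1 P0 = P0' powr \<delta>" using \<delta> by (simp add: P0'_def powr_powr)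
      also have "\<dots> \<le> P powr \<delta>" using P P0' \<delta> by (intro powr_mono2) auto
      finally have XP: "X \<ge> P0" using False by linarith
      have "R \<le> (P powr \<delta>) powr \<eta>" using R by (simp add: powr_powr mult.commute)
      also have "\<dots> \<le> X powr \<eta>" using False \<eta> by (intro powr_mono2) auto
      finally have "Umean k u X R \<le> C * X powr (u - real k + D + \<epsilon> / 2)" using XP R by (intro U) auto
      also have "\<dots> \<le> C' * (X powr (\<epsilon> / 2) * X powr (u - real k + D))"
        by (simp add: C'_def powr_add mult.commute mult_right_mono)
      also have "X powr (\<epsilon> / 2) \<le> (P ^ 2) powr (\<epsilon> / 2)" using X assms by (intro powr_mono2) auto
      also have "(P ^ 2) powr (\<epsilon> / 2) = P powr \<epsilon>"
      proof -
        have "P ^ 2 = P powr 2" using P1 by simp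
        then show ?thesis by (simp only: powr_powr) simp
      qed
      finally show ?thesis by (simp add: C'_def mult_ac mult_left_mono mult_right_mono)
    qed
  qed
  moreover have "\<eta> * \<delta> > 0" using \<eta> \<delta> by simp
  moreover have "P0' \<ge> 1" unfolding P0'_def using \<delta> by (intro ge_one_powr_ge_zero) auto
  moreover have "C' \<ge> 1" by (simp add: C'_def)
  ultimately show ?thesis by blast
qed

subsection \<open>A Weyl estimate for smooth sums\<close>

lemma smooth_set_restrict:
  assumes "V < L" "real V \<le> Y" "Y < real V + 1" "Y \<le> x"
  shows "smooth_set Y R = {z \<in> smooth_set x R. z \<le> V}"
proof -
  have "real z \<le> Y \<longleftrightarrow> z \<le> V" for z using assms by linarith
  moreover have "real z \<le> x" if "real z \<le> Y" for z using assms that by linarith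
  ultimately show ?thesis by (auto simp: smooth_set_def)
qed

text \<open>A finite Fourier expansion removes the dependence of the range of \<open>z\<close> on \<open>m\<close>.\<close>
lemma weyl_piece:
  fixes x \<gamma> \<delta> :: real
  assumes w: "w \<ge> 1" and x: "x \<ge> 1" and r: "r \<ge> 1"
    and M: "M \<subseteq> smooth_set (real r * x) (real r)" "\<And>m. m \<in> M \<Longrightarrow> x < real m"
    and \<delta>: "\<delta> > 0" "\<And>l c. 1 \<le> l \<Longrightarrow> l \<le> K \<Longrightarrow> \<bar>\<gamma> * real l - of_int c\<bar> \<ge> \<delta>"
    and N: "real w * (real r * x) ^ k \<le> real N" and H: "real w * x ^ k \<le> real H"
    and D: "(real N / (real K + 1) + 1) * (2 * (real H + 1) + 2 * harm (nat \<lfloor>1 / \<delta>\<rfloor>) / \<delta>) \<le> D"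
    and EM: "Umean k (2 * real w) (real r * x) (real r) \<le> EM"
    and EZ: "Umean k (2 * real w) x (real p) \<le> EZ"
    and T: "T \<ge> 0" "(real r * x) ^ ((w - 1) * w) * x ^ (w * (w - 1)) * sqrt (EZ * (D * EM)) \<le> T ^ (w * w)"
  shows "norm (\<Sum>m\<in>M. \<Sum>z\<in>smooth_set (x ^ 2 / real m) (real p). e (\<gamma> * real m ^ k * real z ^ k))
    \<le> (1 + 2 * harm (Suc (nat \<lfloor>x\<rfloor>))) * T"
proof -
  \<comment> \<open>\<open>L\<close> exceeds every \<open>z \<le> x\<close>, so characters modulo
    \<open>L\<close> distinguish all values that occur.\<close>
  define L where "L = Suc (nat \<lfloor>x\<rfloor>)"
  define V where "V m = nat \<lfloor>x ^ 2 / real m\<rfloor>" for m :: nat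
  define Z where "Z = smooth_set x (real p)"
  have fin: "finite M" "finite Z" using finite_subset[OF M(1)] by (auto simp: Z_def)
  have L: "L \<ge> 1" "x < real L" by (simp add: L_def) (use x in \<open>simp add: L_def\<close>, linarith)
  have zL: "z < L" if "z \<in> Z" for z
    using that L by (auto simp: Z_def smooth_set_def)
  have xm: "0 \<le> x ^ 2 / real m" "x ^ 2 / real m < x" if "m \<in> M" for m
    using M(2)[OF that] x by (auto simp: power2_eq_square field_simps)
  have V: "V m < L" "smooth_set (x ^ 2 / real m) (real p) = {z \<in> Z. z \<le> V m}" if "m \<in> M" for m
  proof -
    have eq: "real (V m) = of_int \<lfloor>x ^ 2 / real m\<rfloor>" using xm[OF that] by (simp add: V_def)
    then have V': "real (V m) \<le> x ^ 2 / real m" "x ^ 2 / real m < real (V m) + 1" by linarith+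
    then show "V m < L" using xm(2)[OF that] L by linarith
    then show "smooth_set (x ^ 2 / real m) (real p) = {z \<in> Z. z \<le> V m}"
      unfolding Z_def using V' xm[OF that] by (intro smooth_set_restrict) auto
  qed
  obtain C where C: "\<And>j. C j > 0" "(\<Sum>j<L. C j) \<le> 1 + 2 * harm L"
    "\<And>V. V < L \<Longrightarrow> \<exists>c. (\<forall>j<L. norm (c j) \<le> C j) \<and>
        (\<forall>z<L. (\<Sum>j<L. c j * e (real j / real L * real z)) = (if z \<le> V then 1 else 0))"
    by (rule fourier_initial_segment[OF L(1)]) blast
  have "\<forall>m\<in>M. \<exists>c. (\<forall>j<L. norm (c j) \<le> C j) \<and>
        (\<forall>z<L. (\<Sum>j<L. c j * e (real j / real L * real z)) = (if z \<le> V m then 1 else 0))"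
    using C(3) V(1) by blast
  from bchoice[OF this] obtain c where c': "\<forall>m\<in>M. (\<forall>j<L. norm (c m j) \<le> C j) \<and>
        (\<forall>z<L. (\<Sum>j<L. c m j * e (real j / real L * real z)) = (if z \<le> V m then 1 else 0))" ..
  then have c: "\<And>m j. m \<in> M \<Longrightarrow> j < L \<Longrightarrow> norm (c m j) \<le> C j"
    "\<And>m z. m \<in> M \<Longrightarrow> z < L \<Longrightarrow> (\<Sum>j<L. c m j * e (real j / real L * real z)) = (if z \<le> V m then 1 else 0)"
    by blast+
  define b where "b j z = e (real j / real L * real z)" for j z :: nat
  \<comment> \<open>For fixed \<open>j\<close> the weight factors into one part depending on
    \<open>m\<close> and one depending on \<open>z\<close>, as a bilinear form requires; division by
    \<open>C j\<close> makes the first part bounded by \<open>1\<close>.\<close>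
  define S where "S j = (\<Sum>m\<in>M. \<Sum>z\<in>Z. (c m j / of_real (C j)) * b j z * e (\<gamma> * real m ^ k * real z ^ k))" for j
  have "(\<Sum>m\<in>M. \<Sum>z\<in>smooth_set (x ^ 2 / real m) (real p). e (\<gamma> * real m ^ k * real z ^ k))
     = (\<Sum>m\<in>M. \<Sum>z\<in>Z. \<Sum>j<L. c m j * b j z * e (\<gamma> * real m ^ k * real z ^ k))"
  proof (rule sum.cong[OF refl])
    fix m assume m: "m \<in> M"
    have "(\<Sum>z\<in>smooth_set (x ^ 2 / real m) (real p). e (\<gamma> * real m ^ k * real z ^ k))
      = (\<Sum>z\<in>Z. (if z \<le> V m then 1 else 0) * e (\<gamma> * real m ^ k * real z ^ k))"
      unfolding V(2)[OF m] using fin by (intro sum.mono_neutral_cong_left) auto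
    also have "\<dots> = (\<Sum>z\<in>Z. \<Sum>j<L. c m j * b j z * e (\<gamma> * real m ^ k * real z ^ k))"
      using c(2)[OF m zL] by (intro sum.cong refl) (simp add: b_def flip: sum_distrib_right)
    finally show "(\<Sum>z\<in>smooth_set (x ^ 2 / real m) (real p). e (\<gamma> * real m ^ k * real z ^ k))
      = (\<Sum>z\<in>Z. \<Sum>j<L. c m j * b j z * e (\<gamma> * real m ^ k * real z ^ k))" .
  qed
  also have "\<dots> = (\<Sum>m\<in>M. \<Sum>j<L. \<Sum>z\<in>Z. c m j * b j z * e (\<gamma> * real m ^ k * real z ^ k))"
    by (rule sum.cong[OF refl]) (rule sum.swap)
  also have "\<dots> = (\<Sum>j<L. \<Sum>m\<in>M. \<Sum>z\<in>Z. c m j * b j z * e (\<gamma> * real m ^ k * real z ^ k))"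
    by (rule sum.swap)
  also have "\<dots> = (\<Sum>j<L. of_real (C j) * S j)"
  proof (rule sum.cong[OF refl])
    fix j
    have "C j \<noteq> 0" using C(1)[of j] by simp
    then show "(\<Sum>m\<in>M. \<Sum>z\<in>Z. c m j * b j z * e (\<gamma> * real m ^ k * real z ^ k)) = of_real (C j) * S j"
      by (simp add: S_def sum_distrib_left)
  qed
  finally have "norm (\<Sum>m\<in>M. \<Sum>z\<in>smooth_set (x ^ 2 / real m) (real p). e (\<gamma> * real m ^ k * real z ^ k))
     = norm (\<Sum>j<L. of_real (C j) * S j)" by simp
  also have "\<dots> \<le> (\<Sum>j<L. C j * T)"
  proof (rule sum_norm_le)
    fix j assume j: "j \<in> {..<L}"
    define M' where "M' = smooth_set (real r * x) (real r)"
    have Mk: "w * m ^ k \<le> N" if "m \<in> M'" for m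
    proof -
      have "real m \<le> real r * x" using that by (auto simp: M'_def smooth_set_def)
      then have "real w * real m ^ k \<le> real w * (real r * x) ^ k" by (intro mult_left_mono power_mono) auto
      also note N
      finally show ?thesis by (simp flip: of_nat_mult of_nat_power)
    qed
    have Zk: "w * z ^ k \<le> H" if "z \<in> Z" for z
    proof -
      have "real z \<le> x" using that by (auto simp: Z_def smooth_set_def)
      then have "real w * real z ^ k \<le> real w * x ^ k" by (intro mult_left_mono power_mono) auto
      also note H
      finally show ?thesis by (simp flip: of_nat_mult of_nat_power)
    qed
    have "norm (S j) ^ (w * w) \<le> real (card M) ^ ((w - 1) * w) * real (card Z) ^ (w * (w - 1)) * sqrt (EZ * (D * EM))"
      unfolding S_def
    proof (rule bilinear_bound[OF w, where M' = M' and N = N and Z' = Z and H = H])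
      show "norm (c m j / of_real (C j)) \<le> 1" if "m \<in> M" for m
        using c(1)[OF that, of j] j C(1)[of j] by (simp add: norm_divide)
      show "(\<Sum>n'\<le>N. norm (\<Sum>h\<le>H. e ((\<gamma> * real n - \<gamma> * real n') * real h))) \<le> D" for n
        by (rule order_trans[OF sum_kernel_le[OF \<delta>] D])
      show "(\<Sum>i\<le>N. (coeff (kpoly k M' (\<lambda>_. 1 :: real) ^ w) i)\<^sup>2) \<le> EM"
        unfolding M'_def
        by (subst Umean_even_eq[symmetric]) (use w EM Mk in \<open>auto simp: M'_def intro!: degree_kpoly_power_le\<close>)
      show "(\<Sum>i\<le>H. (coeff (kpoly k Z (\<lambda>_. 1 :: real) ^ w) i)\<^sup>2) \<le> EZ"
        unfolding Z_def
        by (subst Umean_even_eq[symmetric]) (use w EZ Zk in \<open>auto simp: Z_def intro!: degree_kpoly_power_le\<close>)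
    qed (use M Mk Zk fin in \<open>auto simp: M'_def b_def\<close>)
    also have "\<dots> \<le> (real r * x) ^ ((w - 1) * w) * x ^ (w * (w - 1)) * sqrt (EZ * (D * EM))"
    proof (intro mult_mono power_mono)
      have "real (card M) \<le> real (card M')" using M by (simp add: M'_def card_mono)
      also have "\<dots> \<le> real r * x" unfolding M'_def using x by (intro card_smooth_set_le) auto
      finally show "real (card M) \<le> real r * x" .
      show "real (card Z) \<le> x" unfolding Z_def using x by (intro card_smooth_set_le) auto
      have "EZ \<ge> 0" "EM \<ge> 0" using EZ EM Umean_nonneg order_trans by blast+
      moreover have "D \<ge> 0"
        using \<delta>(1) harm_nonneg[where ?'a = real]
        by (intro order_trans[OF _ D] mult_nonneg_nonneg add_nonneg_nonneg divide_nonneg_pos) auto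
      ultimately show "sqrt (EZ * (D * EM)) \<ge> 0" by simp
    qed (use x in auto)
    also note T(2)
    finally have "norm (S j) ^ (w * w) \<le> T ^ (w * w)" .
    then have "norm (S j) \<le> T" using w T(1) power_mono_iff[of "norm (S j)" T "w * w"] by simp
    then show "norm (of_real (C j) * S j) \<le> C j * T"
      using C(1)[of j] by (simp add: norm_mult mult_left_mono)
  qed
  also have "\<dots> = (\<Sum>j<L. C j) * T" by (simp add: sum_distrib_right)
  also have "\<dots> \<le> (1 + 2 * harm L) * T" using C(2) T(1) by (rule mult_right_mono)
  finally show ?thesis by (simp add: L_def)
qed

text \<open>If \<open>\<gamma> * l\<close> were too close to \<open>c\<close>, comparison with \<open>b / q\<close> would force \<open>q * c = b * l\<close>, so \<open>q\<close> divides \<open>l\<close>.\<close>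
lemma minor_spacing:
  fixes x \<gamma> Y :: real and b :: int and q :: nat
  assumes x: "x \<ge> 1" and Y: "x ^ k \<le> Y" and q: "q \<ge> 1" "coprime b (int q)" "real q \<le> Y"
    and b: "(x ^ k) ^ 2 * \<bar>real q * \<gamma> - of_int b\<bar> \<le> Y"
    and eq: "real q = Y \<or> (x ^ k) ^ 2 * \<bar>real q * \<gamma> - of_int b\<bar> = Y"
    and l: "1 \<le> l" "real l \<le> (x ^ k) ^ 2 / (4 * Y)"
  shows "1 / (4 * Y) \<le> \<bar>\<gamma> * real l - of_int c\<bar>"
proof (rule ccontr)
  define \<beta> where "\<beta> = \<bar>real q * \<gamma> - of_int b\<bar>"
  define A where "A = (x ^ k) ^ 2"
  assume "\<not> ?thesis"
  then have *: "\<bar>\<gamma> * real l - of_int c\<bar> < 1 / (4 * Y)" by simp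
  have xk: "x ^ k \<ge> 1" using x by simp
  then have Y1: "Y \<ge> 1" using Y by linarith
  have A: "A \<ge> 1" unfolding A_def using xk by simp
  have AY: "A \<le> Y * Y" unfolding A_def power2_eq_square using Y xk by (intro mult_mono) auto
  have "\<beta> * A \<le> Y" using b by (simp only: A_def \<beta>_def mult.commute)
  then have b': "\<beta> \<le> Y / A" using A by (simp add: pos_le_divide_eq)
  have "\<bar>of_int (int q * c - b * int l)\<bar> = \<bar>real l * (real q * \<gamma> - of_int b) - real q * (\<gamma> * real l - of_int c)\<bar>"
    by (simp add: algebra_simps)
  also have "\<dots> \<le> \<bar>real l * (real q * \<gamma> - of_int b)\<bar> + \<bar>real q * (\<gamma> * real l - of_int c)\<bar>"
    by (rule abs_triangle_ineq4)
  also have "\<dots> = real l * \<beta> + real q * \<bar>\<gamma> * real l - of_int c\<bar>"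
    by (simp add: abs_mult \<beta>_def)
  \<comment> \<open>Each of the two products equals \<open>1 / 4\<close>; the range of
    \<open>l\<close> and the claimed distance are chosen for this, and an integer below
    \<open>1\<close> in modulus vanishes.\<close>
  also have "\<dots> \<le> A / (4 * Y) * (Y / A) + Y * (1 / (4 * Y))"
    using l b' q * Y1 A by (intro add_mono mult_mono) (auto simp: A_def \<beta>_def)
  also have "\<dots> < 1" using Y1 A by simp
  finally have "int q * c = b * int l" by linarith
  then have qc: "int q dvd b * int l" by (metis dvd_triv_left)
  then have "q dvd l" using q(2) by (simp add: coprime_commute coprime_dvd_mult_right_iff)
  then obtain j where j: "l = q * j" by (rule dvdE)
  have j1: "j \<ge> 1" using l j by (cases j) auto
  have "int q * c = int q * (b * int j)" using \<open>int q * c = b * int l\<close> by (simp add: j mult_ac)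
  then have c: "c = b * int j" using q(1) by simp
  \<comment> \<open>Now \<open>l = q * j\<close> and \<open>c = b * j\<close>. Either
    \<open>q = Y\<close> is too large to divide an admissible \<open>l\<close>, or the approximation
    error of \<open>b / q\<close> is extremal and already keeps \<open>\<gamma> * l\<close> away
    from \<open>c\<close>.\<close>
  from eq show False
  proof
    assume "real q = Y"
    have "Y \<le> real l" using j1 q by (simp add: j flip: \<open>real q = Y\<close>)
    also have "\<dots> \<le> A / (4 * Y)" using l by (simp add: A_def)
    also have "\<dots> \<le> (Y * Y) / (4 * Y)" using AY Y1 by (intro divide_right_mono) auto
    also have "\<dots> < Y" using Y1 by simp
    finally show False by simp
  next
    assume "(x ^ k) ^ 2 * \<bar>real q * \<gamma> - of_int b\<bar> = Y"
    then have "\<beta> * A = Y" by (simp only: A_def \<beta>_def mult.commute)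
    then have \<beta>: "\<beta> = Y / A" using A by (simp add: eq_divide_eq)
    have "\<gamma> * real l - of_int c = real j * (real q * \<gamma> - of_int b)" by (simp add: c j algebra_simps)
    then have "\<bar>\<gamma> * real l - of_int c\<bar> = real j * \<beta>" by (simp add: abs_mult \<beta>_def)
    also have "\<dots> \<ge> 1 * \<beta>" using j1 by (intro mult_right_mono) (auto simp: \<beta>_def)
    moreover have "1 / (4 * Y) \<le> Y / A" using AY Y1 A by (simp add: field_simps)
    ultimately show False using * \<beta> by linarith
  qed
qed

text \<open>The sum of length \<open>x ^ 2\<close> is split at the first partial product exceeding
  \<open>x\<close>, so both variables have size about \<open>x\<close> up to a factor
  \<open>r\<close>. Since \<open>Y\<close> is \<open>x ^ k\<close> up to powers of \<open>G\<close>,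
  about \<open>x ^ k\<close> consecutive multiples of \<open>\<gamma>\<close> are spaced by about
  \<open>1 / x ^ k\<close>, and the kernel sums are bounded by \<open>x ^ k\<close> up to powers of
  \<open>G\<close>: the full gain of the large sieve. All losses are collected in powers of
  \<open>G\<close>.\<close>

lemma weyl_explicit:
  fixes x \<gamma> Y G R c C1 D \<tau> :: real and b :: int and q :: nat
  assumes k: "k \<ge> 1" and w: "w \<ge> 1" and D: "D \<ge> real k - real w"
    and \<tau>: "\<tau> = (real k - 2 * D) / (4 * real w ^ 2)"
    and r: "1 \<le> r" "real r \<le> R" "R \<le> G" and x: "x \<ge> 1"
    and Y: "x ^ k \<le> Y" "Y \<le> (4 * R) ^ k * x ^ k" and q: "q \<ge> 1" "coprime b (int q)" "real q \<le> Y"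
    and b: "(x ^ k) ^ 2 * \<bar>real q * \<gamma> - of_int b\<bar> \<le> Y"
    and eq: "real q = Y \<or> (x ^ k) ^ 2 * \<bar>real q * \<gamma> - of_int b\<bar> = Y"
    and c: "c \<ge> 1" "harm (Suc (nat \<lfloor>x\<rfloor>)) \<le> c * G" "harm (nat \<lfloor>4 * Y\<rfloor>) \<le> c * G"
    and C1: "C1 \<ge> 1" "\<And>Z p. Z \<in> {x, real r * x} \<Longrightarrow> 1 \<le> p \<Longrightarrow> p \<le> r \<Longrightarrow>
        Umean k (2 * real w) Z (real p) \<le> C1 * G * Z powr (2 * real w - real k + D)"
  shows "norm (fsum k \<gamma> (x ^ 2) (real r)) \<le>
     (1 + 3 * c * C1 * ((2 * 4 ^ (k + 1) * real w + 1) * (6 * real w + 8 * c * 4 ^ k)))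
       * G powr (real w ^ 2 + 3 * real k + 5 + (2 * real w - real k + D)) * (x ^ 2) powr (1 - \<tau>)"
proof -
  define \<sigma> where "\<sigma> = 2 * real w - real k + D"
  define C2 where "C2 = (2 * 4 ^ (k + 1) * real w + 1) * (6 * real w + 8 * c * 4 ^ k)"
  define DD where "DD = C2 * G ^ (3 * k + 1) * x ^ k"
  define EE where "EE = real w ^ 2 + 3 * real k + 3 + \<sigma>"
  define T where "T = C1 * C2 * G powr EE * (x ^ 2) powr (1 - \<tau>)"
  have \<sigma>0: "\<sigma> \<ge> real w" using D by (simp add: \<sigma>_def)
  have G: "G \<ge> 1" using r by linarith
  have R0: "R \<ge> 1" using r by linarith
  have xk: "x ^ k = x powr real k" "x ^ k \<ge> 1" using x by (auto simp: powr_realpow)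
  have YG: "Y \<le> 4 ^ k * G ^ k * x ^ k"
  proof -
    have "(4 * R) ^ k \<le> 4 ^ k * G ^ k" using R0 r(3) unfolding power_mult_distrib[symmetric] by (intro power_mono) auto
    then have "(4 * R) ^ k * x ^ k \<le> 4 ^ k * G ^ k * x ^ k" using x by (intro mult_right_mono) auto
    with Y show ?thesis by linarith
  qed
  have Y1: "Y \<ge> 1" using Y xk by linarith
  have C2: "C2 \<ge> 1"
  proof -
    have "1 * 1 \<le> (2 * 4 ^ (k + 1) * real w + 1) * (6 * real w + 8 * c * 4 ^ k)"
      using w c by (intro mult_mono) (auto intro: add_increasing2)
    then show ?thesis by (simp add: C2_def)
  qed
  define N where "N = nat \<lceil>real w * (real r * x) ^ k\<rceil>"
  define H where "H = nat \<lceil>real w * x ^ k\<rceil>"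
  \<comment> \<open>The largest shift \<open>l\<close> to which \<open>minor_spacing\<close>
    applies.\<close>
  define K where "K = nat \<lfloor>(x ^ k) ^ 2 / (4 * Y)\<rfloor>"
  have N: "real w * (real r * x) ^ k \<le> real N" by (simp add: N_def real_nat_ceiling_ge)
  have H: "real w * x ^ k \<le> real H" by (simp add: H_def real_nat_ceiling_ge)
  have N': "real N \<le> 2 * real w * G ^ k * x ^ k"
  proof -
    have "1 \<le> real r * x" using r x mult_mono[of 1 "real r" 1 x] by simp
    then have "1 \<le> (real r * x) ^ k" by simp
    then have "1 \<le> real w * (real r * x) ^ k" using w mult_mono[of 1 "real w" 1 "(real r * x) ^ k"] by simp
    then have "real N \<le> 2 * (real w * (real r * x) ^ k)" unfolding N_def by linarith
    also have "2 * (real w * (real r * x) ^ k) \<le> 2 * (real w * (G ^ k * x ^ k))"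
      using r x unfolding power_mult_distrib[symmetric]
      by (intro mult_left_mono power_mono mult_right_mono) auto
    finally show ?thesis by (simp add: mult_ac)
  qed
  have H': "real H + 1 \<le> 3 * real w * x ^ k"
  proof -
    have "1 \<le> real w * x ^ k" using w xk mult_mono[of 1 "real w" 1 "x ^ k"] by simp
    then show ?thesis unfolding H_def by linarith
  qed
  have K': "(x ^ k) ^ 2 / (4 * Y) \<le> real K + 1"
  proof -
    have "0 \<le> (x ^ k) ^ 2 / (4 * Y)" using Y1 by simp
    then show ?thesis unfolding K_def by linarith
  qed
  have Gx: "G > 0" "x > 0" using G x by auto
  have D1: "real N / (real K + 1) + 1 \<le> (2 * 4 ^ (k + 1) * real w + 1) * G ^ (2 * k)"
  proof -
    have "real N / (real K + 1) \<le> (2 * real w * G ^ k * x ^ k) / ((x ^ k) ^ 2 / (4 * Y))"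
    proof (intro frac_le K' N')
      show "0 < (x ^ k)\<^sup>2 / (4 * Y)" using Gx Y1 by simp
      show "0 \<le> 2 * real w * G ^ k * x ^ k" using Gx by simp
    qed
    also have "\<dots> = 8 * real w * G ^ k * Y / x ^ k" using Gx Y1 by (simp add: power2_eq_square field_simps)
    also have "\<dots> \<le> 8 * real w * G ^ k * (4 ^ k * G ^ k * x ^ k) / x ^ k"
      using Gx by (intro divide_right_mono mult_left_mono YG) auto
    also have "\<dots> = 2 * 4 ^ (k + 1) * real w * G ^ (2 * k)"
      using Gx by (simp add: mult_2 power_add)
    finally have "real N / (real K + 1) \<le> 2 * 4 ^ (k + 1) * real w * G ^ (2 * k)" .
    moreover have "1 \<le> G ^ (2 * k)" using G by simp
    ultimately show ?thesis by (simp add: algebra_simps)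
  qed
  have D2: "2 * (real H + 1) + 2 * harm (nat \<lfloor>1 / (1 / (4 * Y))\<rfloor>) / (1 / (4 * Y))
      \<le> (6 * real w + 8 * c * 4 ^ k) * (G ^ (k + 1) * x ^ k)"
  proof -
    have "2 * harm (nat \<lfloor>4 * Y\<rfloor>) * (4 * Y) \<le> 2 * (c * G) * (4 * (4 ^ k * G ^ k * x ^ k))"
      using c YG Y1 Gx by (intro mult_mono mult_nonneg_nonneg) (auto intro: harm_nonneg)
    also have "\<dots> = 8 * c * 4 ^ k * (G ^ (k + 1) * x ^ k)" by (simp add: mult_ac)
    finally have 1: "2 * harm (nat \<lfloor>4 * Y\<rfloor>) * (4 * Y) \<le> 8 * c * 4 ^ k * (G ^ (k + 1) * x ^ k)" .
    have "1 * x ^ k \<le> G ^ (k + 1) * x ^ k" using G Gx by (intro mult_right_mono one_le_power) auto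
    then have "6 * real w * x ^ k \<le> 6 * real w * (G ^ (k + 1) * x ^ k)" by (intro mult_left_mono) auto
    moreover have "2 * (real H + 1) \<le> 6 * real w * x ^ k" using H' by (simp add: mult.assoc)
    ultimately have "2 * (real H + 1) \<le> 6 * real w * (G ^ (k + 1) * x ^ k)" by (rule order_trans[rotated])
    with 1 show ?thesis by (simp add: distrib_right)
  qed
  have DD: "(real N / (real K + 1) + 1) * (2 * (real H + 1) + 2 * harm (nat \<lfloor>1 / (1 / (4 * Y))\<rfloor>) / (1 / (4 * Y))) \<le> DD"
  proof -
    have "(real N / (real K + 1) + 1) * (2 * (real H + 1) + 2 * harm (nat \<lfloor>1 / (1 / (4 * Y))\<rfloor>) / (1 / (4 * Y)))
       \<le> ((2 * 4 ^ (k + 1) * real w + 1) * G ^ (2 * k)) * ((6 * real w + 8 * c * 4 ^ k) * (G ^ (k + 1) * x ^ k))"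
      using Y1 G by (intro mult_mono D1 D2 add_nonneg_nonneg mult_nonneg_nonneg divide_nonneg_nonneg harm_nonneg) auto
    also have "\<dots> = C2 * (G ^ (2 * k) * G ^ (k + 1)) * x ^ k" by (simp only: C2_def mult_ac)
    also have "G ^ (2 * k) * G ^ (k + 1) = G ^ (3 * k + 1)" by (simp only: power_add[symmetric]) simp
    finally show ?thesis by (simp add: DD_def)
  qed
  define EZ EM where "EZ = C1 * G * x powr \<sigma>" and "EM = C1 * G * (G powr \<sigma> * x powr \<sigma>)"
  have EM: "Umean k (2 * real w) (real r * x) (real r) \<le> EM"
  proof -
    have "Umean k (2 * real w) (real r * x) (real r) \<le> C1 * G * (real r * x) powr \<sigma>"
      using C1(2)[of "real r * x" r] r by (simp add: \<sigma>_def)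
    also have "(real r * x) powr \<sigma> \<le> (G * x) powr \<sigma>"
      using r x \<sigma>0 by (intro powr_mono2 mult_right_mono) auto
    also have "(G * x) powr \<sigma> = G powr \<sigma> * x powr \<sigma>" using Gx by (simp add: powr_mult)
    finally show ?thesis using C1 Gx by (simp add: EM_def mult_left_mono)
  qed
  have EZ: "Umean k (2 * real w) x (real p) \<le> EZ" if "1 \<le> p" "p \<le> r" for p
    using C1(2)[of x p] that by (simp add: EZ_def \<sigma>_def)
  have sq: "sqrt (EZ * (DD * EM)) \<le> C1 * C2 * G powr (3 * real k + 3 + \<sigma>) * x powr (\<sigma> + real k / 2)"
  proof (rule real_le_lsqrt)
    have "EZ * (DD * EM) = C1 ^ 2 * C2 * (G * G * G ^ (3 * k + 1) * G powr \<sigma>) * (x powr \<sigma> * x powr \<sigma> * x ^ k)"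
      by (simp add: EZ_def DD_def EM_def power2_eq_square mult_ac)
    also have "G * G * G ^ (3 * k + 1) * G powr \<sigma> = G powr (3 * real k + 3 + \<sigma>)"
    proof -
      have "G * G * G ^ (3 * k + 1) = G ^ (3 * k + 3)" by (simp add: numeral_3_eq_3)
      also have "\<dots> = G powr real (3 * k + 3)" by (rule powr_realpow[OF Gx(1), symmetric])
      finally show ?thesis by (simp flip: powr_add)
    qed
    also have "x powr \<sigma> * x powr \<sigma> * x ^ k = (x powr (\<sigma> + real k / 2)) ^ 2"
      unfolding xk power2_eq_square by (simp only: powr_add[symmetric]) (rule arg_cong[of _ _ "(powr) x"], simp)
    also have "C1 ^ 2 * C2 * G powr (3 * real k + 3 + \<sigma>) * (x powr (\<sigma> + real k / 2)) ^ 2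
      \<le> C1 ^ 2 * C2 ^ 2 * (G powr (3 * real k + 3 + \<sigma>)) ^ 2 * (x powr (\<sigma> + real k / 2)) ^ 2"
    proof -
      have g1: "G powr (3 * real k + 3 + \<sigma>) \<ge> 1" using G \<sigma>0 by (intro ge_one_powr_ge_zero) auto
      then have "G powr (3 * real k + 3 + \<sigma>) \<le> (G powr (3 * real k + 3 + \<sigma>)) ^ 2"
        using power_increasing[of 1 2 "G powr (3 * real k + 3 + \<sigma>)"] by simp
      moreover have "C2 \<le> C2 ^ 2" using power_increasing[of 1 2 C2] C2 by simp
      ultimately show ?thesis using C2 by (intro mult_right_mono mult_mono mult_left_mono) auto
    qed
    finally show "EZ * (DD * EM) \<le> (C1 * C2 * G powr (3 * real k + 3 + \<sigma>) * x powr (\<sigma> + real k / 2)) ^ 2"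
      by (simp only: power_mult_distrib)
  qed (use C1 C2 in auto)
  have T0: "T \<ge> 0" using C1 C2 by (simp add: T_def)
  have w1: "real w \<ge> 1" "w * w \<ge> 1" using w by auto
  have T: "(real r * x) ^ ((w - 1) * w) * x ^ (w * (w - 1)) * sqrt (EZ * (DD * EM)) \<le> T ^ (w * w)"
  proof -
    have "(real r * x) ^ ((w - 1) * w) * x ^ (w * (w - 1)) * sqrt (EZ * (DD * EM))
       \<le> (G ^ (w * w) * x ^ (w * (w - 1))) * x ^ (w * (w - 1)) * (C1 * C2 * G powr (3 * real k + 3 + \<sigma>) * x powr (\<sigma> + real k / 2))"
    proof (intro mult_mono sq order_refl)
      have "(real r * x) ^ ((w - 1) * w) = real r ^ ((w - 1) * w) * x ^ (w * (w - 1))"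
        by (simp add: power_mult_distrib mult.commute)
      also have "real r ^ ((w - 1) * w) \<le> G ^ ((w - 1) * w)" using r by (intro power_mono) auto
      also have "G ^ ((w - 1) * w) \<le> G ^ (w * w)" using G by (intro power_increasing mult_right_mono) auto
      finally show "(real r * x) ^ ((w - 1) * w) \<le> G ^ (w * w) * x ^ (w * (w - 1))"
        using x by (simp add: mult_right_mono)
      show "sqrt (EZ * (DD * EM)) \<ge> 0"
        using C1 C2 Gx by (auto simp: EZ_def EM_def DD_def intro!: mult_nonneg_nonneg)
    qed (use x Gx in auto)
    also have "\<dots> = (C1 * C2) * G powr EE * (x powr (2 * real w * (real w - 1) + \<sigma> + real k / 2))"
    proof -
      have "G ^ (w * w) = G powr (real w ^ 2)" using Gx by (simp add: powr_realpow[symmetric] power2_eq_square)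
      moreover have "x ^ (w * (w - 1)) = x powr (real w * (real w - 1))"
        using Gx w by (simp add: powr_realpow[symmetric] of_nat_diff)
      ultimately have "(G ^ (w * w) * x ^ (w * (w - 1))) * x ^ (w * (w - 1)) * (C1 * C2 * G powr (3 * real k + 3 + \<sigma>) * x powr (\<sigma> + real k / 2))
        = (C1 * C2) * (G powr (real w ^ 2) * G powr (3 * real k + 3 + \<sigma>))
          * (x powr (real w * (real w - 1)) * x powr (real w * (real w - 1)) * x powr (\<sigma> + real k / 2))"
        by (simp only: mult_ac)
      also have "G powr (real w ^ 2) * G powr (3 * real k + 3 + \<sigma>) = G powr EE"
        by (simp only: powr_add[symmetric] EE_def) (simp add: add_ac)
      also have "x powr (real w * (real w - 1)) * x powr (real w * (real w - 1)) * x powr (\<sigma> + real k / 2)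
         = x powr (2 * real w * (real w - 1) + \<sigma> + real k / 2)"
        by (simp only: powr_add[symmetric]) (rule arg_cong[of _ _ "(powr) x"], simp)
      finally show ?thesis .
    qed
    \<comment> \<open>The source of \<open>\<tau>\<close>: the left side is
      \<open>2 * w ^ 2 - (k - 2 * D) / 2\<close>. The term \<open>k / 2\<close> is the square root
      of the kernel bound, and \<open>\<sigma>\<close> comes from the two moments.\<close>
    also have "2 * real w * (real w - 1) + \<sigma> + real k / 2 = 2 * real (w * w) * (1 - \<tau>)"
      using w1 by (simp add: \<tau> \<sigma>_def power2_eq_square field_simps)
    also have "x powr (2 * real (w * w) * (1 - \<tau>)) = ((x ^ 2) powr (1 - \<tau>)) ^ (w * w)"
    proof -
      have "x ^ 2 = x powr 2" using Gx by simp
      then have "((x ^ 2) powr (1 - \<tau>)) ^ (w * w) = (x powr (2 * (1 - \<tau>))) ^ (w * w)"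
        by (simp only: powr_powr)
      also have "\<dots> = (x powr (2 * (1 - \<tau>))) powr real (w * w)"
        using Gx by (intro powr_realpow[symmetric]) simp
      also have "\<dots> = x powr (2 * (1 - \<tau>) * real (w * w))" by (rule powr_powr)
      also have "2 * (1 - \<tau>) * real (w * w) = 2 * real (w * w) * (1 - \<tau>)" by (simp only: mult_ac)
      finally show ?thesis by (rule sym)
    qed
    \<comment> \<open>Factors at least \<open>1\<close> are raised to the power
      \<open>w * w\<close>, so that a root can be taken without fractional exponents on the
      constants.\<close>
    also have "C1 * C2 * G powr EE * ((x ^ 2) powr (1 - \<tau>)) ^ (w * w) \<le> T ^ (w * w)"
    proof -
      have "C1 * C2 \<ge> 1" using C1 C2 mult_mono[of 1 C1 1 C2] by simp
      moreover have "G powr EE \<ge> 1" using G \<sigma>0 by (intro ge_one_powr_ge_zero) (auto simp: EE_def)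
      ultimately have "C1 * C2 * G powr EE \<ge> 1" using mult_mono[of 1 "C1 * C2" 1 "G powr EE"] by simp
      then have "C1 * C2 * G powr EE \<le> (C1 * C2 * G powr EE) ^ (w * w)"
        using power_increasing[of 1 "w * w" "C1 * C2 * G powr EE"] w1 by simp
      then show ?thesis unfolding T_def power_mult_distrib[of _ "(x ^ 2) powr (1 - \<tau>)"]
        by (intro mult_right_mono) auto
    qed
    finally show ?thesis .
  qed
  \<comment> \<open>This says that no more than a square root is saved, so the at most
    \<open>x\<close> numbers that never exceed the stopping bound are harmless.\<close>
  have \<tau>2: "\<tau> \<le> 1 / 2"
  proof -
    have "real k - 2 * D \<le> 2 * real w" using D by simp
    also have "\<dots> \<le> 2 * real w ^ 2" using w1(1) by (simp add: power2_eq_square mult_left_mono)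
    finally show ?thesis using w1 by (simp add: \<tau> field_simps)
  qed
  have xT: "x \<le> (x ^ 2) powr (1 - \<tau>)"
  proof -
    have "x = (x ^ 2) powr (1 / 2)" using x by (simp add: powr_half_sqrt)
    also have "\<dots> \<le> (x ^ 2) powr (1 - \<tau>)" using x \<tau>2 by (intro powr_mono) auto
    finally show ?thesis .
  qed
  obtain E B where E: "finite E" "finite B"
    "\<And>F :: nat \<Rightarrow> complex. (\<Sum>z\<in>smooth_set (x ^ 2) (real r). F z) =
       (\<Sum>x\<in>E. F x) + (\<Sum>(m, p)\<in>B. \<Sum>z\<in>smooth_set (x ^ 2 / real m) (real p). F (m * z))"
    "\<And>y. y \<in> E \<Longrightarrow> \<not> x < real y \<and> y \<in> smooth_set (x ^ 2) (real r)"
    "\<And>m p. (m, p) \<in> B \<Longrightarrow> x < real m \<and> 1 \<le> p \<and> p \<le> r \<and> m \<in> smooth_set (x ^ 2) (real r) \<and>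
       (m = 1 \<or> (\<exists>p0. prime p0 \<and> p0 \<le> r \<and> p0 dvd m \<and> \<not> x < real (m div p0)))"
    by (rule smooth_sum_stopping[OF r(1), of "x ^ 2" "\<lambda>m. x < real m"]) blast
  \<comment> \<open>The smoothness bound of \<open>z\<close> is the last prime \<open>p\<close>
    used. Grouping by \<open>p\<close> makes it constant in each bilinear form, at the cost of a
    factor \<open>r\<close>.\<close>
  define M where "M p = {m. (m, p) \<in> B}" for p
  have Mfin: "finite (M p)" for p
  proof -
    have "M p \<subseteq> fst ` B" by (force simp: M_def)
    then show ?thesis using E(2) finite_subset by blast
  qed
  have B: "B = (\<lambda>(p, m). (m, p)) ` (SIGMA p:{1..r}. M p)"
    using E(5) by (force simp: M_def image_iff)
  have Msub: "M p \<subseteq> smooth_set (real r * x) (real r)" for p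
  proof
    fix m assume "m \<in> M p"
    then have m: "x < real m" "m \<in> smooth_set (x ^ 2) (real r)"
      "m = 1 \<or> (\<exists>p0. prime p0 \<and> p0 \<le> r \<and> p0 dvd m \<and> \<not> x < real (m div p0))"
      using E(5) by (auto simp: M_def)
    then obtain p0 where p0: "p0 \<le> r" "p0 dvd m" "real (m div p0) \<le> x" using x by auto
    have "real m = real p0 * real (m div p0)" using p0(2) by (simp flip: of_nat_mult)
    also have "\<dots> \<le> real r * x" using p0 x by (intro mult_mono) auto
    finally show "m \<in> smooth_set (real r * x) (real r)" using m by (auto simp: smooth_set_def)
  qed
  define F where "F y = e (\<gamma> * real y ^ k)" for y :: nat
  have "fsum k \<gamma> (x ^ 2) (real r) = (\<Sum>y\<in>E. F y) + (\<Sum>(m, p)\<in>B. \<Sum>z\<in>smooth_set (x ^ 2 / real m) (real p). F (m * z))"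
    unfolding fsum_def F_def[symmetric] by (rule E(3))
  also have "(\<Sum>(m, p)\<in>B. \<Sum>z\<in>smooth_set (x ^ 2 / real m) (real p). F (m * z))
     = (\<Sum>p\<in>{1..r}. \<Sum>m\<in>M p. \<Sum>z\<in>smooth_set (x ^ 2 / real m) (real p). e (\<gamma> * real m ^ k * real z ^ k))"
    unfolding B by (subst sum.reindex)
      (auto simp: inj_on_def sum.Sigma[OF _ ballI[OF Mfin]] F_def power_mult_distrib mult.assoc intro!: sum.cong)
  finally have "norm (fsum k \<gamma> (x ^ 2) (real r)) \<le> norm (\<Sum>y\<in>E. F y) +
     norm (\<Sum>p\<in>{1..r}. \<Sum>m\<in>M p. \<Sum>z\<in>smooth_set (x ^ 2 / real m) (real p). e (\<gamma> * real m ^ k * real z ^ k))"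
    by (simp only: norm_triangle_ineq)
  also have "\<dots> \<le> x + (\<Sum>p\<in>{1..r}. (1 + 2 * harm (Suc (nat \<lfloor>x\<rfloor>))) * T)"
  proof (intro add_mono sum_norm_le)
    have "norm (\<Sum>y\<in>E. F y) \<le> (\<Sum>y\<in>E. 1)" by (rule sum_norm_le) (simp add: F_def)
    also have "\<dots> = real (card E)" by simp
    also have "\<dots> \<le> real (card (smooth_set x (real r)))"
    proof -
      have "E \<subseteq> smooth_set x (real r)" using E(4) by (force simp: smooth_set_def)
      then show ?thesis by (simp add: card_mono)
    qed
    also have "\<dots> \<le> x" using x by (intro card_smooth_set_le) auto
    finally show "norm (\<Sum>y\<in>E. F y) \<le> x" .
    fix p assume p: "p \<in> {1..r}"
    show "norm (\<Sum>m\<in>M p. \<Sum>z\<in>smooth_set (x ^ 2 / real m) (real p). e (\<gamma> * real m ^ k * real z ^ k))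
       \<le> (1 + 2 * harm (Suc (nat \<lfloor>x\<rfloor>))) * T"
    proof (rule weyl_piece[OF w x r(1) Msub _ _ _ N H DD EM EZ T0 T])
      show "x < real m" if "m \<in> M p" for m using E(5) that by (auto simp: M_def)
      show "1 / (4 * Y) \<le> \<bar>\<gamma> * real l - of_int c\<bar>" if "1 \<le> l" "l \<le> K" for l c
      proof (rule minor_spacing[OF x Y(1) q b eq that(1)])
        show "real l \<le> (x ^ k)\<^sup>2 / (4 * Y)" using that Y1 unfolding K_def by (simp add: le_nat_iff le_floor_iff)
      qed
    qed (use p Y1 in auto)
  qed
  also have "\<dots> = x + real r * ((1 + 2 * harm (Suc (nat \<lfloor>x\<rfloor>))) * T)" by simp
  also have "\<dots> \<le> (x ^ 2) powr (1 - \<tau>) + G * ((3 * c * G) * T)"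
  proof -
    have "1 \<le> c * G" using c G mult_mono[of 1 c 1 G] by simp
    then have "1 + 2 * harm (Suc (nat \<lfloor>x\<rfloor>)) \<le> 3 * c * G" using c by simp
    then show ?thesis using r T0 xT c(1)
      by (intro add_mono mult_mono) (auto intro!: add_nonneg_nonneg harm_nonneg mult_nonneg_nonneg)
  qed
  also have "\<dots> \<le> (1 + 3 * c * C1 * C2) * G powr (EE + 2) * (x ^ 2) powr (1 - \<tau>)"
  proof -
    have "G powr (EE + 2) = G * G * G powr EE" using Gx by (simp add: powr_add power2_eq_square)
    then have "G * ((3 * c * G) * T) = 3 * c * C1 * C2 * G powr (EE + 2) * (x ^ 2) powr (1 - \<tau>)"
      by (simp add: T_def mult_ac)
    moreover have "1 * (x ^ 2) powr (1 - \<tau>) \<le> G powr (EE + 2) * (x ^ 2) powr (1 - \<tau>)"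
      using G \<sigma>0 by (intro mult_right_mono ge_one_powr_ge_zero) (auto simp: EE_def)
    ultimately show ?thesis by (simp only: distrib_right mult_1)
  qed
  finally show ?thesis by (simp add: EE_def C2_def \<sigma>_def algebra_simps)
qed

text \<open>\<open>P\<close> only measures the losses; the estimate is uniform in the length
  \<open>x ^ 2\<close>, which may be as small as \<open>1\<close>. This is needed because the inner
  sums of a factorisation have varying lengths.\<close>

lemma weyl_smooth:
  assumes k: "k \<ge> 1" and w: "w \<ge> 1" and adm: "admissible k (2 * real w) D"
    and \<tau>: "\<tau> = (real k - 2 * D) / (4 * real w ^ 2)" and \<epsilon>: "\<epsilon> > 0"
  shows "\<exists>\<eta>>0. \<exists>C\<ge>1. \<exists>P0\<ge>1. \<forall>P\<ge>P0. \<forall>r R x Y q b \<gamma>.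
    1 \<le> r \<and> real r \<le> R \<and> R \<le> P powr \<eta> \<and> 1 \<le> x \<and> x ^ 2 \<le> P \<and> x ^ k \<le> Y \<and> Y \<le> (4 * R) ^ k * x ^ k \<and>
    1 \<le> q \<and> coprime b (int q) \<and> real q \<le> Y \<and> (x ^ k) ^ 2 * \<bar>real q * \<gamma> - of_int b\<bar> \<le> Y \<and>
    (real q = Y \<or> (x ^ k) ^ 2 * \<bar>real q * \<gamma> - of_int b\<bar> = Y) \<longrightarrow>
    norm (fsum k \<gamma> (x ^ 2) (real r)) \<le> C * P powr \<epsilon> * (x ^ 2) powr (1 - \<tau>)"
proof -
  have D: "D \<ge> real k - real w" using admissible_ge[OF k _ adm] w by simp
  define E where "E = real w ^ 2 + 3 * real k + 5 + (2 * real w - real k + D)"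
  have E: "E > 0" using D zero_le_power2[of "real w"] unfolding E_def by linarith
  \<comment> \<open>\<open>E\<close> is the power of \<open>G = P powr \<epsilon>1\<close> lost in
    the explicit estimate, so the total loss is at most \<open>P powr \<epsilon>\<close>.\<close>
  define \<epsilon>1 where "\<epsilon>1 = min 1 (\<epsilon> / E)"
  have \<epsilon>1: "\<epsilon>1 > 0" "\<epsilon>1 \<le> 1" "\<epsilon>1 * E \<le> \<epsilon>" using \<epsilon> E by (auto simp: \<epsilon>1_def min_def field_simps)
  obtain \<eta> C1 P0 where \<eta>: "\<eta> > 0" and C1: "C1 \<ge> 1" and P0: "P0 \<ge> 1" and
    U: "\<And>P X R. P \<ge> P0 \<Longrightarrow> 1 \<le> X \<Longrightarrow> X \<le> P ^ 2 \<Longrightarrow> 1 \<le> R \<Longrightarrow> R \<le> P powr \<eta> \<Longrightarrow>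
      Umean k (2 * real w) X R \<le> C1 * P powr \<epsilon>1 * X powr (2 * real w - real k + D)"
    using admissible_uniform[OF k _ adm \<epsilon>1(1)] w by auto
  define \<eta>' where "\<eta>' = min \<eta> \<epsilon>1"
  \<comment> \<open>All harmonic sums that occur have at most
    \<open>4 ^ (k + 1) * P ^ (2 * k)\<close> terms, and
    \<open>ln P \<le> P powr \<epsilon>1 / \<epsilon>1\<close>; this constant collects the resulting
    logarithm.\<close>
  define c where "c = 1 + real (k + 1) * ln 4 + 2 * real k / \<epsilon>1"
  have c1: "c \<ge> 1" using \<epsilon>1 by (simp add: c_def)
  define C where "C = 1 + 3 * c * C1 * ((2 * 4 ^ (k + 1) * real w + 1) * (6 * real w + 8 * c * 4 ^ k))"
  have C: "C \<ge> 1" using c1 C1 by (simp add: C_def)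
  have main: "norm (fsum k \<gamma> (x ^ 2) (real r)) \<le> C * P powr \<epsilon> * (x ^ 2) powr (1 - \<tau>)"
    if P: "P \<ge> P0" and r: "1 \<le> r" "real r \<le> R" "R \<le> P powr \<eta>'" and x: "1 \<le> x" "x ^ 2 \<le> P"
      and Y: "x ^ k \<le> Y" "Y \<le> (4 * R) ^ k * x ^ k"
      and q: "1 \<le> q" "coprime b (int q)" "real q \<le> Y" and b: "(x ^ k) ^ 2 * \<bar>real q * \<gamma> - of_int b\<bar> \<le> Y"
      and eq: "real q = Y \<or> (x ^ k) ^ 2 * \<bar>real q * \<gamma> - of_int b\<bar> = Y"
    for P r R x Y q b \<gamma>
  proof -
    define G where "G = P powr \<epsilon>1"
    have P1: "P \<ge> 1" using P P0 by linarith
    have RG: "R \<le> G" unfolding G_def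
      by (rule order_trans[OF r(3) powr_mono]) (use P1 in \<open>auto simp: \<eta>'_def\<close>)
    have R\<eta>: "R \<le> P powr \<eta>"
      by (rule order_trans[OF r(3) powr_mono]) (use P1 in \<open>auto simp: \<eta>'_def\<close>)
    have R1: "R \<ge> 1" using r by linarith
    have G1: "G \<ge> 1" using RG R1 by linarith
    have GP: "G \<le> P" using powr_mono[of \<epsilon>1 1 P] \<epsilon>1 P1 by (simp add: G_def)
    have xP: "x \<le> P"
    proof -
      have "x * 1 \<le> x * x" using x by (intro mult_left_mono) auto
      then show ?thesis using x unfolding power2_eq_square by linarith
    qed
    have Y1: "Y \<ge> 1" using Y(1) one_le_power[OF x(1), of k] by linarith
    have lnP: "1 + real (k + 1) * ln 4 + 2 * real k * ln P \<le> c * G"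
    proof -
      have "ln P \<le> G / \<epsilon>1" unfolding G_def using \<epsilon>1 P1 by (intro ln_powr_bound) auto
      then have "2 * real k * ln P \<le> 2 * real k * (G / \<epsilon>1)" by (intro mult_left_mono) auto
      moreover have "(1 + real (k + 1) * ln 4) * 1 \<le> (1 + real (k + 1) * ln 4) * G"
        using G1 by (intro mult_left_mono) (auto intro!: add_nonneg_nonneg)
      ultimately show ?thesis by (simp add: c_def algebra_simps)
    qed
    have harm: "harm n \<le> c * G" if "real n \<le> 4 ^ (k + 1) * P ^ (2 * k)" for n
    proof -
      have "1 \<le> 4 ^ (k + 1) * P ^ (2 * k)" 
        using mult_mono[of 1 "4 ^ (k + 1)" 1 "P ^ (2 * k)"] one_le_power[of "4::real" "k + 1"] one_le_power[OF P1, of "2 * k"]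
        by simp
      then have "real (max 1 n) \<le> 4 ^ (k + 1) * P ^ (2 * k)" using that by (simp add: max_def)
      then have "ln (real (max 1 n)) \<le> ln (4 ^ (k + 1) * P ^ (2 * k))" by (subst ln_le_cancel_iff) (use P1 in auto)
      also have "\<dots> = real (k + 1) * ln 4 + real (2 * k) * ln P"
        using P1 by (subst ln_mult_pos) (simp_all only: ln_realpow, auto)
      finally show ?thesis using harm_le[of n] lnP by simp
    qed
    have "norm (fsum k \<gamma> (x ^ 2) (real r)) \<le> C * G powr E * (x ^ 2) powr (1 - \<tau>)"
      unfolding C_def E_def
    proof (rule weyl_explicit[OF k w D \<tau> r(1,2) RG x(1) Y q b eq c1])
      have "real (Suc (nat \<lfloor>x\<rfloor>)) \<le> 1 + x" using x by simp
      also have "\<dots> \<le> 4 * P" using xP P1 by linarith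
      also have "\<dots> \<le> 4 ^ (k + 1) * P ^ (2 * k)"
      proof (intro mult_mono)
        show "(4::real) \<le> 4 ^ (k + 1)" using power_increasing[of 1 "k + 1" "4::real"] by simp
        show "P \<le> P ^ (2 * k)" using power_increasing[of 1 "2 * k" P] P1 k by simp
      qed (use P1 in auto)
      finally show "harm (Suc (nat \<lfloor>x\<rfloor>)) \<le> c * G" by (rule harm)
      have "real (nat \<lfloor>4 * Y\<rfloor>) \<le> 4 * Y" using Y1 by simp
      also have "\<dots> \<le> 4 * ((4 * P) ^ k * P ^ k)"
        using Y(2) RG GP xP R1 x
        by (intro mult_left_mono order_trans[OF Y(2)] mult_mono power_mono) auto
      also have "\<dots> = 4 ^ (k + 1) * P ^ (2 * k)" by (simp add: power_mult_distrib mult_2 power_add)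
      finally show "harm (nat \<lfloor>4 * Y\<rfloor>) \<le> c * G" by (rule harm)
      show "C1 \<ge> 1" by (rule C1)
      fix Z p assume Z: "Z \<in> {x, real r * x}" and p: "1 \<le> p" "p \<le> r"
      have "real r * x \<le> P * P" using r RG GP xP x by (intro mult_mono) auto
      moreover have "P * 1 \<le> P * P" using P1 by (intro mult_left_mono) auto
      ultimately have "Z \<le> P ^ 2" using Z xP by (auto simp: power2_eq_square)
      moreover have "1 \<le> Z" using Z x r mult_mono[of 1 "real r" 1 x] by auto
      ultimately show "Umean k (2 * real w) Z (real p) \<le> C1 * G * Z powr (2 * real w - real k + D)"
        unfolding G_def using P p r R\<eta> by (intro U) auto
    qed
    also have "G powr E = P powr (\<epsilon>1 * E)" by (simp add: G_def powr_powr)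
    also have "C * P powr (\<epsilon>1 * E) * (x ^ 2) powr (1 - \<tau>) \<le> C * P powr \<epsilon> * (x ^ 2) powr (1 - \<tau>)"
      using C P1 \<epsilon>1 by (intro mult_right_mono mult_left_mono powr_mono) auto
    finally show ?thesis .
  qed
  have "\<eta>' > 0" using \<eta> \<epsilon>1 by (simp add: \<eta>'_def)
  then show ?thesis using main C P0 by blast
qed

subsection \<open>Common factors with the denominator\<close>

text \<open>For \<open>k, d \<ge> 1\<close> this is the product of
  \<open>p ^ \<lceil>a / k\<rceil>\<close> over the prime powers \<open>p ^ a\<close> exactly
  dividing \<open>d\<close>. Minimality encodes it without any factorisation.\<close>

definition kroot :: "nat \<Rightarrow> nat \<Rightarrow> nat" where
  "kroot k d = (LEAST v. 1 \<le> v \<and> d dvd v ^ k)"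

lemma kroot:
  assumes "k \<ge> 1" "d \<ge> 1"
  shows "1 \<le> kroot k d" "d dvd kroot k d ^ k"
proof -
  have "1 \<le> d \<and> d dvd d ^ k" using assms by (simp add: dvd_power)
  from LeastI[of "\<lambda>v. 1 \<le> v \<and> d dvd v ^ k", OF this]
  show "1 \<le> kroot k d" "d dvd kroot k d ^ k" by (simp_all add: kroot_def)
qed

text \<open>The gcd of \<open>kroot k d\<close> and \<open>m\<close> also has a \<open>k\<close>-th
  power divisible by \<open>d\<close>, so by minimality it is \<open>kroot k d\<close>
  itself.\<close>

lemma kroot_dvd:
  assumes "k \<ge> 1" "d \<ge> 1" "m \<ge> 1" "d dvd m ^ k"
  shows "kroot k d dvd m"
proof -
  define g where "g = gcd (kroot k d) m"
  have "d dvd gcd (kroot k d ^ k) (m ^ k)" using kroot[OF assms(1,2)] assms(4) by (intro gcd_greatest)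
  then have "d dvd g ^ k" by (simp only: g_def gcd_exp)
  moreover have "1 \<le> g" using assms(3) by (simp add: g_def Suc_le_eq)
  ultimately have "kroot k d \<le> g" unfolding kroot_def by (intro Least_le) simp
  moreover have "g dvd kroot k d" by (simp add: g_def)
  ultimately have "g = kroot k d" using kroot(1)[OF assms(1,2)] by (intro antisym dvd_imp_le) auto
  then show ?thesis unfolding g_def by (metis gcd_dvd2)
qed

lemma kroot_ge:
  assumes "k \<ge> 1" "d \<ge> 1"
  shows "real d powr (1 / real k) \<le> real (kroot k d)"
proof -
  have "d \<le> kroot k d ^ k" using kroot[OF assms] by (intro dvd_imp_le) auto
  then have "real d \<le> real (kroot k d) ^ k" by (simp flip: of_nat_power)
  also have "\<dots> = real (kroot k d) powr real k" using kroot(1)[OF assms] by (simp add: powr_realpow)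
  finally have "real d powr (1 / real k) \<le> (real (kroot k d) powr real k) powr (1 / real k)"
    by (intro powr_mono2) auto
  then show ?thesis using assms kroot(1)[OF assms] by (simp add: powr_powr)
qed

section \<open>Multiples and the range of the outer variable\<close>

lemma card_multiples_le:
  fixes t :: real
  assumes "v \<ge> 1" "t \<ge> 0"
  shows "finite {m. v dvd m \<and> 1 \<le> m \<and> real m \<le> t}" "real (card {m. v dvd m \<and> 1 \<le> m \<and> real m \<le> t}) \<le> t / real v"
proof -
  have sub: "{m. v dvd m \<and> 1 \<le> m \<and> real m \<le> t} \<subseteq> (\<lambda>j. v * j) ` {1..nat \<lfloor>t / real v\<rfloor>}"
  proof
    fix m assume m: "m \<in> {m. v dvd m \<and> 1 \<le> m \<and> real m \<le> t}"
    then obtain j where j: "m = v * j" by blast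
    then have "j \<ge> 1" "real j \<le> t / real v" using m assms by (auto simp: field_simps Suc_le_eq)
    then show "m \<in> (\<lambda>j. v * j) ` {1..nat \<lfloor>t / real v\<rfloor>}" using j by (auto simp: le_nat_iff le_floor_iff)
  qed
  then show "finite {m. v dvd m \<and> 1 \<le> m \<and> real m \<le> t}" by (rule finite_subset) auto
  have "card {m. v dvd m \<and> 1 \<le> m \<and> real m \<le> t} \<le> card ((\<lambda>j. v * j) ` {1..nat \<lfloor>t / real v\<rfloor>})"
    by (rule card_mono[OF _ sub]) auto
  also have "\<dots> \<le> nat \<lfloor>t / real v\<rfloor>" using card_image_le[of "{1..nat \<lfloor>t / real v\<rfloor>}" "\<lambda>j. v * j"] by simp
  finally show "real (card {m. v dvd m \<and> 1 \<le> m \<and> real m \<le> t}) \<le> t / real v"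
    using assms by (simp add: le_nat_iff le_floor_iff)
qed

text \<open>The range of the outer variable \<open>m\<close>, and of the smoothness bound for the inner one, among the
  terms with \<open>gcd q (m ^ k) = d\<close>; \<open>t\<close> is the size of \<open>m\<close>.\<close>
definition outer :: "nat \<Rightarrow> nat \<Rightarrow> real \<Rightarrow> nat \<Rightarrow> real \<Rightarrow> (nat \<times> nat) set" where
  "outer k r P d t = {m. kroot k d dvd m \<and> 1 \<le> m \<and> t \<le> real m \<and> real m \<le> real r * t \<and> real m \<le> P} \<times> {1..r}"

lemma outer:
  assumes "k \<ge> 1" "d \<ge> 1" "t \<ge> 0"
  shows "finite (outer k r P d t)" "real (card (outer k r P d t)) \<le> real r ^ 2 * t / real (kroot k d)"
proof -
  let ?S = "{m. kroot k d dvd m \<and> 1 \<le> m \<and> t \<le> real m \<and> real m \<le> real r * t \<and> real m \<le> P}"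
  let ?M = "{m. kroot k d dvd m \<and> 1 \<le> m \<and> real m \<le> real r * t}"
  have M: "finite ?M" "real (card ?M) \<le> (real r * t) / real (kroot k d)"
    using card_multiples_le[of "kroot k d" "real r * t"] kroot(1)[OF assms(1,2)] assms(3) by auto
  have sub: "?S \<subseteq> ?M" by auto
  show "finite (outer k r P d t)" unfolding outer_def using finite_subset[OF sub M(1)] by simp
  have "real (card (outer k r P d t)) = real (card ?S) * real r" by (simp add: outer_def card_cartesian_product)
  also have "\<dots> \<le> ((real r * t) / real (kroot k d)) * real r"
    using card_mono[OF M(1) sub] M(2) by (intro mult_right_mono) auto
  finally show "real (card (outer k r P d t)) \<le> real r ^ 2 * t / real (kroot k d)"
    by (simp add: power2_eq_square mult_ac)
qed

text \<open>The stopping rule depends on \<open>gcd q (m ^ k)\<close>, so that the inner sums have the length suited to the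
  denominator \<open>q div gcd q (m ^ k)\<close> that remains for \<open>\<alpha> * m ^ k\<close>.\<close>
lemma norm_fsum_le_outer:
  fixes T :: "nat \<Rightarrow> real"
  assumes k: "k \<ge> 1" and q: "q \<ge> 1" and r: "r \<ge> 1" and T1: "T 1 \<ge> 1"
    and mono: "\<And>d d'. 1 \<le> d \<Longrightarrow> d \<le> d' \<Longrightarrow> T d \<le> T d'"
  shows "norm (fsum k \<alpha> P (real r)) \<le> (\<Sum>d | d dvd q. T d / real (kroot k d) +
     (\<Sum>(m, p) | (m, p) \<in> outer k r P d (T d) \<and> gcd q (m ^ k) = d. norm (fsum k (\<alpha> * real m ^ k) (P / real m) (real p))))"
proof -
  define g where "g m = gcd q (m ^ k)" for m
  define Dv where "Dv = {d. d dvd q}"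
  have finD: "finite Dv" using q by (simp add: Dv_def finite_divisors_nat)
  have g: "g m \<in> Dv" "g m \<ge> 1" for m using q by (auto simp: g_def Dv_def Suc_le_eq)
  have D1: "d \<ge> 1" if "d \<in> Dv" for d using that q by (auto simp: Dv_def Suc_le_eq intro: dvd_pos_nat)
  have Tpos: "T d \<ge> 1" if "d \<ge> 1" for d using mono[of 1 d] T1 that by simp
  obtain E B where E: "finite E" "finite B"
    "\<And>F :: nat \<Rightarrow> complex. (\<Sum>z\<in>smooth_set P (real r). F z) =
       (\<Sum>x\<in>E. F x) + (\<Sum>(m, p)\<in>B. \<Sum>z\<in>smooth_set (P / real m) (real p). F (m * z))"
    "\<And>y. y \<in> E \<Longrightarrow> \<not> T (g y) \<le> real y \<and> y \<in> smooth_set P (real r)"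
    "\<And>m p. (m, p) \<in> B \<Longrightarrow> T (g m) \<le> real m \<and> 1 \<le> p \<and> p \<le> r \<and> m \<in> smooth_set P (real r) \<and>
       (m = 1 \<or> (\<exists>p0. prime p0 \<and> p0 \<le> r \<and> p0 dvd m \<and> \<not> T (g (m div p0)) \<le> real (m div p0)))"
    by (rule smooth_sum_stopping[OF r(1), of P "\<lambda>m. T (g m) \<le> real m"]) blast
  have kr: "kroot k (g m) dvd m" if "m \<ge> 1" for m
    using k g(2) that by (intro kroot_dvd) (auto simp: g_def)
  have Bout: "(m, p) \<in> outer k r P (g m) (T (g m))" if "(m, p) \<in> B" for m p
  proof -
    note b = E(5)[OF that]
    have m: "m \<ge> 1" "real m \<le> P" using b by (auto simp: smooth_set_def)
    have "real m \<le> real r * T (g m)"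
    proof (cases "m = 1")
      case True
      then show ?thesis using Tpos[OF g(2), of m] r mult_mono[of 1 "real r" 1 "T (g m)"] by simp
    next
      case False
      then obtain p0 where p0: "p0 \<le> r" "p0 dvd m" "real (m div p0) < T (g (m div p0))" using b by force
      \<comment> \<open>Passing to the predecessor can only shrink the gcd, and \<open>T\<close> is
        monotone, so the violated condition at \<open>m div p0\<close> also bounds it by the
        threshold of \<open>m\<close>.\<close>
      have "g (m div p0) dvd g m"
        unfolding g_def using p0(2) by (intro gcd_mono dvd_refl dvd_power_same) (auto intro: dvd_div_mult_self[of p0 m, THEN subst] simp: div_dvd_iff_mult)
      then have "g (m div p0) \<le> g m" using g(2)[of m] by (intro dvd_imp_le) auto
      then have "T (g (m div p0)) \<le> T (g m)" using g(2) by (intro mono) auto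
      then have "real (m div p0) \<le> T (g m)" using p0 by linarith
      have "real m = real p0 * real (m div p0)" using p0(2) by (simp flip: of_nat_mult)
      also have "\<dots> \<le> real r * T (g m)" using p0 \<open>real (m div p0) \<le> T (g m)\<close> by (intro mult_mono) auto
      finally show ?thesis .
    qed
    then show ?thesis using b m kr[OF m(1)] by (auto simp: outer_def)
  qed
  define F where "F y = e (\<alpha> * real y ^ k)" for y :: nat
  define h where "h = (\<lambda>(m, p). norm (fsum k (\<alpha> * real m ^ k) (P / real m) (real p)))"
  have "fsum k \<alpha> P (real r) = (\<Sum>y\<in>E. F y) + (\<Sum>(m, p)\<in>B. \<Sum>z\<in>smooth_set (P / real m) (real p). F (m * z))"
    unfolding fsum_def F_def[symmetric] by (rule E(3))
  also have "norm \<dots> \<le> (\<Sum>y\<in>E. 1) + (\<Sum>b\<in>B. h b)"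
  proof (intro norm_triangle_mono sum_norm_le)
    fix b assume "b \<in> B"
    show "norm (case b of (m, p) \<Rightarrow> \<Sum>z\<in>smooth_set (P / real m) (real p). F (m * z)) \<le> h b"
      by (cases b) (simp add: h_def F_def fsum_def power_mult_distrib mult.assoc)
  qed (simp add: F_def)
  also have "(\<Sum>y\<in>E. 1) = (\<Sum>d\<in>Dv. \<Sum>y | y \<in> E \<and> g y = d. (1::real))"
    using E(1) finD g by (intro sum.group[symmetric]) auto
  \<comment> \<open>A number that never stopped lies below its own threshold and is a multiple of
    \<open>kroot k d\<close>; counting such multiples is enough.\<close>
  also have "\<dots> \<le> (\<Sum>d\<in>Dv. T d / real (kroot k d))"
  proof (intro sum_mono)
    fix d assume d: "d \<in> Dv"
    let ?S = "{m. kroot k d dvd m \<and> 1 \<le> m \<and> real m \<le> T d}"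
    have c: "finite ?S" "real (card ?S) \<le> T d / real (kroot k d)"
      using card_multiples_le[of "kroot k d" "T d"] kroot(1)[OF k D1[OF d]] Tpos[OF D1[OF d]] by auto
    have sub: "{y \<in> E. g y = d} \<subseteq> ?S"
      using E(4) kr by (force simp: smooth_set_def)
    have "(\<Sum>y | y \<in> E \<and> g y = d. (1::real)) = real (card {y \<in> E. g y = d})" by simp
    also have "\<dots> \<le> real (card ?S)" using card_mono[OF c(1) sub] by simp
    finally show "(\<Sum>y | y \<in> E \<and> g y = d. (1::real)) \<le> T d / real (kroot k d)" using c(2) by linarith
  qed
  also have "(\<Sum>b\<in>B. h b) = (\<Sum>d\<in>Dv. \<Sum>b | b \<in> B \<and> g (fst b) = d. h b)"
    using E(2) finD g by (intro sum.group[symmetric]) auto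
  also have "\<dots> \<le> (\<Sum>d\<in>Dv. \<Sum>b | b \<in> outer k r P d (T d) \<and> g (fst b) = d. h b)"
  proof (intro sum_mono sum_mono2)
    fix d assume d: "d \<in> Dv"
    show "finite {b. b \<in> outer k r P d (T d) \<and> g (fst b) = d}"
      using outer(1)[OF k D1[OF d], of "T d" r P] Tpos[OF D1[OF d]] by simp
    show "{b \<in> B. g (fst b) = d} \<subseteq> {b \<in> outer k r P d (T d). g (fst b) = d}"
      using Bout by auto
  qed (auto simp: h_def)
  finally show ?thesis
    by (simp add: sum.distrib Dv_def g_def h_def case_prod_beta')
qed

subsection \<open>The pointwise bound on the minor arcs\<close>

text \<open>Dirichlet's theorem assigns to \<open>\<alpha>\<close> its true level \<open>Qs\<close>,
  which exceeds \<open>Q\<close> off the major arcs. The whole estimate is carried out at level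
  \<open>Qs\<close>, and only at the end does \<open>\<tau> \<ge> 0\<close> allow \<open>Qs\<close>
  to be replaced by \<open>Q\<close>.\<close>

lemma weyl_minor:
  assumes k: "k \<ge> 1" and w: "w \<ge> 1" and adm: "admissible k (2 * real w) D"
    and \<tau>: "\<tau> = (real k - 2 * D) / (4 * real w ^ 2)" "\<tau> \<ge> 0" and \<epsilon>: "\<epsilon> > 0"
  shows "\<exists>\<eta>>0. \<exists>C\<ge>1. \<exists>P0\<ge>1. \<forall>P\<ge>P0. \<forall>R Q \<alpha>.
    1 \<le> R \<and> R \<le> P powr \<eta> \<and> 1 \<le> Q \<and> Q \<le> P powr (real k / 2) \<and> \<alpha> \<in> {0..<1} \<and> \<alpha> \<notin> major_arcs k Q P \<longrightarrow>
    norm (fsum k \<alpha> P R) \<le> C * P powr (1 + \<epsilon>) * Q powr (- 2 * \<tau> / real k)"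
proof -
  have \<tau>2: "\<tau> \<le> 1 / 2"
  proof -
    have "real k - 2 * D \<le> 2 * real w" using admissible_ge[OF k _ adm] w by simp
    also have "\<dots> \<le> 2 * real w ^ 2" using w by (simp add: power2_eq_square mult_left_mono)
    finally show ?thesis using w by (simp add: \<tau> field_simps)
  qed
  \<comment> \<open>Four losses of \<open>P powr \<epsilon>1\<close> are spent: one for the number
    of divisors of \<open>q\<close>, two for \<open>R ^ 2\<close> and one in the inner Weyl
    estimate. The choice of \<open>\<epsilon>2\<close> turns a bound in \<open>q\<close> into one in
    \<open>P\<close>.\<close>
  define \<epsilon>1 where "\<epsilon>1 = \<epsilon> / 4"
  define \<epsilon>2 where "\<epsilon>2 = \<epsilon> / (4 * real k)"
  have \<epsilon>12: "\<epsilon>1 > 0" "\<epsilon>2 > 0" using \<epsilon> k by (auto simp: \<epsilon>1_def \<epsilon>2_def)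
  from weyl_smooth[OF k w adm \<tau>(1) \<epsilon>12(1)]
  obtain \<eta>0 C1 P0 where W: "\<eta>0 > 0" "C1 \<ge> 1" "P0 \<ge> 1" "\<forall>P\<ge>P0. \<forall>r R x Y q b \<gamma>.
    1 \<le> r \<and> real r \<le> R \<and> R \<le> P powr \<eta>0 \<and> 1 \<le> x \<and> x ^ 2 \<le> P \<and> x ^ k \<le> Y \<and> Y \<le> (4 * R) ^ k * x ^ k \<and>
    1 \<le> q \<and> coprime b (int q) \<and> real q \<le> Y \<and> (x ^ k) ^ 2 * \<bar>real q * \<gamma> - of_int b\<bar> \<le> Y \<and>
    (real q = Y \<or> (x ^ k) ^ 2 * \<bar>real q * \<gamma> - of_int b\<bar> = Y) \<longrightarrow>
    norm (fsum k \<gamma> (x ^ 2) (real r)) \<le> C1 * P powr \<epsilon>1 * (x ^ 2) powr (1 - \<tau>)"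
    by auto
  obtain C2 where C2: "C2 \<ge> 1" "\<And>n. n \<ge> 1 \<Longrightarrow> real (card {d::nat. d dvd n}) \<le> C2 * real n powr \<epsilon>2"
    using divisor_bound[OF \<epsilon>12(2)] by auto
  define \<eta> where "\<eta> = min \<eta>0 \<epsilon>1"
  have \<eta>: "\<eta> > 0" using W(1) \<epsilon>12 by (simp add: \<eta>_def)
  define C where "C = C2 * 2 powr \<epsilon>2 * (4 + 2 * C1)"
  have C: "C \<ge> 1"
  proof -
    have "2 powr \<epsilon>2 \<ge> 1" using \<epsilon>12 by (intro ge_one_powr_ge_zero) auto
    then have "1 * 1 * 1 \<le> C2 * 2 powr \<epsilon>2 * (4 + 2 * C1)" using C2(1) W(2) by (intro mult_mono) auto
    then show ?thesis by (simp add: C_def)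
  qed
  have main: "norm (fsum k \<alpha> P R) \<le> C * P powr (1 + \<epsilon>) * Q powr (- 2 * \<tau> / real k)"
    if P: "P \<ge> P0" and R: "1 \<le> R" "R \<le> P powr \<eta>" and Q: "1 \<le> Q" "Q \<le> P powr (real k / 2)"
      and \<alpha>: "\<alpha> \<in> {0..<1}" "\<alpha> \<notin> major_arcs k Q P"
    for P R Q \<alpha>
  proof -
    define r where "r = nat \<lfloor>R\<rfloor>"
    have r: "1 \<le> r" "real r \<le> R" using R by (auto simp: r_def le_nat_iff)
    have P1: "P \<ge> 1" using P W(3) by linarith
    define S where "S = P powr (real k / 2)"
    have S1: "S \<ge> 1" unfolding S_def using P1 by (intro ge_one_powr_ge_zero) auto
    have SS: "S * S = P ^ k" unfolding S_def using P1 by (simp flip: powr_add powr_realpow)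
    define NN where "NN = nat \<lfloor>S\<rfloor>"
    have NN: "NN > 0" "real NN \<le> S" "S \<le> 2 * real NN"
    proof -
      have eq: "real NN = of_int \<lfloor>S\<rfloor>" using S1 unfolding NN_def by (intro of_nat_nat) simp
      show "NN > 0" using S1 unfolding NN_def by simp
      have "1 \<le> \<lfloor>S\<rfloor>" using S1 by simp
      then show "real NN \<le> S" "S \<le> 2 * real NN" unfolding eq by linarith+
    qed
    obtain a q' where aq: "coprime a q'" "0 < q'" "q' \<le> int NN" "\<bar>of_int q' * \<alpha> - of_int a\<bar> < 1 / NN"
      by (rule Dirichlet_approx_coprime[OF NN(1), of \<alpha>]) (metis coprime_commute)
    define q where "q = nat q'"
    have q: "q \<ge> 1" "real q = of_int q'" "q' = int q" using aq(2) by (auto simp: q_def Suc_le_eq)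
    have qS: "real q \<le> S" using aq(3) NN(2) unfolding q(3) by linarith
    define \<beta> where "\<beta> = \<bar>real q * \<alpha> - of_int a\<bar>"
    have \<beta>: "\<beta> < 1 / real NN" using aq(4) by (simp only: \<beta>_def q(2))
    \<comment> \<open>The least level at which the arc around \<open>a / q\<close> contains
      \<open>\<alpha>\<close>.\<close>
    define Qs where "Qs = max (real q) (P ^ k * \<beta>)"
    have Qs1: "Qs \<ge> 1" using q(1) by (simp add: Qs_def)
    have Qs2: "Qs \<le> 2 * S"
    proof -
      have "P ^ k * \<beta> \<le> (S * S) * (2 / S)"
      proof (unfold SS[symmetric], intro mult_left_mono)
        have "1 / real NN \<le> 2 / S" using NN S1 by (simp add: field_simps)
        then show "\<beta> \<le> 2 / S" using \<beta> by linarith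
      qed (use S1 in auto)
      then show ?thesis using S1 qS by (simp add: Qs_def)
    qed
    have Qs3: "Q < Qs"
    proof (rule ccontr)
      assume "\<not> Q < Qs"
      then have 1: "real q \<le> Q" "P ^ k * \<beta> \<le> Q" by (auto simp: Qs_def)
      have "1 / real NN \<le> 1" using NN(1) by simp
      then have \<beta>1: "\<beta> < 1" using \<beta> by linarith
      \<comment> \<open>Dirichlet's theorem only gives an integer numerator;
        \<open>\<alpha> \<in> [0,1)\<close> and an error below \<open>1\<close> force it into
        \<open>0..q\<close>, as the arcs demand.\<close>
      have "0 \<le> real q * \<alpha>" "real q * \<alpha> < real q" using \<alpha>(1) q(1) by auto
      then have "real_of_int a > -1" "real_of_int a < real q + 1" using \<beta>1 unfolding \<beta>_def by linarith+
      then have a: "0 \<le> a" "a \<le> int q" by linarith+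
      define a' where "a' = nat a"
      have a': "a = int a'" "a' \<le> q" using a by (auto simp: a'_def)
      have "coprime a' q" using aq(1) unfolding a' q(3) by simp
      moreover have "\<bar>real q * \<alpha> - real a'\<bar> \<le> Q * P powr (- real k)"
        using 1(2) P1 by (simp add: \<beta>_def a' powr_minus powr_realpow field_simps)
      ultimately have "\<alpha> \<in> major_arcs k Q P"
        unfolding major_arcs_def using a' q(1) 1(1) \<alpha>(1) by auto
      then show False using \<alpha> by simp
    qed
    \<comment> \<open>The factor \<open>4\<close> ensures \<open>T 1 \<ge> 1\<close>, since
      \<open>Qs\<close> can reach twice \<open>P powr (k / 2)\<close>; it also keeps the inner
      length at most \<open>L / 4\<close>, whence \<open>x ^ k \<le> Y\<close> later.\<close>
    define T where "T d = 4 * P * (real d / Qs) powr (2 / real k)" for d :: nat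
    have PT: "P / T d = (Qs / real d) powr (2 / real k) / 4" if "d \<ge> 1" for d
      using that Qs1 P1 by (simp add: T_def powr_divide)
    have Tpos: "T d > 0" if "d \<ge> 1" for d using that Qs1 P1 by (simp add: T_def)
    have bound: "norm (fsum k \<alpha> P (real r)) \<le> (\<Sum>d | d dvd q. T d / real (kroot k d) +
       (\<Sum>(m, p) | (m, p) \<in> outer k r P d (T d) \<and> gcd q (m ^ k) = d. norm (fsum k (\<alpha> * real m ^ k) (P / real m) (real p))))"
    proof (rule norm_fsum_le_outer[OF k q(1) r(1)])
      show "T d \<le> T d'" if "1 \<le> d" "d \<le> d'" for d d'
        unfolding T_def using that Qs1 P1 by (intro mult_left_mono powr_mono2 divide_right_mono) auto
      have "Qs powr (2 / real k) \<le> (2 * S) powr (2 / real k)" using Qs1 Qs2 by (intro powr_mono2) auto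
      also have "\<dots> = 2 powr (2 / real k) * P" using P1 k by (simp add: powr_mult S_def powr_powr)
      also have "\<dots> \<le> 2 powr 2 * P"
        using k P1 by (intro mult_right_mono powr_mono) (auto simp: divide_le_eq)
      finally have "Qs powr (2 / real k) \<le> 4 * P" by simp
      then show "1 \<le> T 1" using Qs1 by (simp add: T_def powr_divide)
    qed
    define X where "X = P * Qs powr (- 2 * \<tau> / real k)"
    have each: "T d / real (kroot k d) + (\<Sum>(m, p) | (m, p) \<in> outer k r P d (T d) \<and> gcd q (m ^ k) = d.
         norm (fsum k (\<alpha> * real m ^ k) (P / real m) (real p))) \<le> (4 + 2 * C1) * (R ^ 2 * P powr \<epsilon>1 * X)"
      if d: "d dvd q" for d
    proof -
      define v where "v = kroot k d"
      have d1: "d \<ge> 1" using dvd_pos_nat[OF _ d] q(1) by (simp add: Suc_le_eq)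
      have dQ: "real d \<le> Qs" using dvd_imp_le[OF d] q(1) by (simp add: Qs_def)
      have v: "real v \<ge> 1" "real d powr (1 / real k) \<le> real v"
        using kroot(1)[OF k d1] kroot_ge[OF k d1] by (auto simp: v_def)
      define L where "L = (Qs / real d) powr (2 / real k)"
      have L1: "L \<ge> 1" unfolding L_def using dQ d1 by (intro ge_one_powr_ge_zero) auto
      have TL: "T d = 4 * P / L" unfolding T_def L_def using Qs1 d1 by (simp add: powr_divide)
      \<comment> \<open>Shortening the inner sum loses \<open>d powr (2 * \<tau> / k)\<close>. As
        \<open>\<tau> \<le> 1 / 2\<close>, this is at most \<open>d powr (1 / k)\<close>, which the
        sparseness \<open>1 / v\<close> of the outer variable recovers.\<close>
      have XL: "P * L powr (- \<tau>) / real v \<le> X"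
      proof -
        have "L powr (- \<tau>) = Qs powr (- 2 * \<tau> / real k) * real d powr (2 * \<tau> / real k)"
          unfolding L_def using Qs1 d1 by (simp add: powr_powr powr_divide powr_minus field_simps)
        moreover have "real d powr (2 * \<tau> / real k) \<le> real v"
        proof -
          have "real d powr (2 * \<tau> / real k) \<le> real d powr (1 / real k)"
            using d1 \<tau>2 k by (intro powr_mono divide_right_mono) auto
          then show ?thesis using v by linarith
        qed
        ultimately have "P * L powr (- \<tau>) \<le> P * (Qs powr (- 2 * \<tau> / real k) * real v)"
          using P1 by (simp add: mult_left_mono)
        then show ?thesis using v P1 by (simp add: X_def field_simps)
      qed
      have first: "T d / real v \<le> 4 * X"
      proof -
        have "L powr (- 1) \<le> L powr (- \<tau>)" using L1 \<tau>2 by (intro powr_mono) auto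
        then have "1 / L \<le> L powr (- \<tau>)" using L1 by (simp add: powr_minus_divide)
        then have "4 * (P * (1 / L) / real v) \<le> 4 * (P * L powr (- \<tau>) / real v)"
          using P1 v by (intro mult_left_mono divide_right_mono) auto
        then show ?thesis using XL by (simp add: TL)
      qed
      have inner: "norm (fsum k (\<alpha> * real m ^ k) (P / real m) (real p)) \<le> C1 * P powr \<epsilon>1 * (P / T d) powr (1 - \<tau>)"
        if mp: "(m, p) \<in> outer k r P d (T d)" and gm: "gcd q (m ^ k) = d" for m p
      proof -
        have m: "m \<ge> 1" "T d \<le> real m" "real m \<le> real r * T d" "real m \<le> P" and p: "1 \<le> p" "p \<le> r"
          using mp by (auto simp: outer_def)
        define x where "x = sqrt (P / real m)"
        have Pm: "P / real m \<ge> 1" using m by simp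
        have x: "x ^ 2 = P / real m" "x \<ge> 1" using Pm by (auto simp: x_def)
        have xk: "(x ^ k) ^ 2 = (P / real m) ^ k" by (metis x(1) power_mult mult.commute)
        obtain q1 where q1: "q = d * q1" using d by blast
        obtain c where c: "m ^ k = d * c" using gm by (metis gcd_dvd2 dvdE)
        have q1': "q1 \<ge> 1" using q(1) q1 by (cases q1) auto
        have cop: "coprime q1 c"
        proof -
          have "gcd (d * q1) (d * c) = d" using gm q1 c by simp
          then have "d * gcd q1 c = d" by (simp add: gcd_mult_distrib_nat)
          then show ?thesis using d1 by (simp add: coprime_iff_gcd_eq_1)
        qed
        \<comment> \<open>The level of \<open>\<alpha> * m ^ k\<close> relative to the inner length:
          the denominator \<open>q\<close> becomes \<open>q1 = q div d\<close>, and the scaled error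
          \<open>P ^ k * \<beta>\<close> is divided by \<open>d\<close> as well, so both entries of
          the maximum \<open>Qs\<close> scale alike.\<close>
        define Y where "Y = Qs / real d"
        define b where "b = a * int c"
        have Lk: "L ^ k = Y ^ 2"
        proof -
          have Y0: "Y > 0" using Qs1 d1 by (simp add: Y_def)
          have "L ^ k = (Y powr (2 / real k)) powr real k"
            unfolding L_def Y_def[symmetric] using Y0 by (intro powr_realpow[symmetric]) simp
          also have "\<dots> = Y powr 2" using k by (simp only: powr_powr) simp
          finally show ?thesis using Y0 by simp
        qed
        have Y1: "Y \<ge> 1" unfolding Y_def using dQ d1 by simp
        have PL: "P / T d = L / 4" unfolding TL using P1 L1 by simp
        have up: "P / real m \<le> L / 4"
        proof -
          have "P / real m \<le> P / T d" using m Tpos[OF d1] P1 by (intro divide_left_mono) auto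
          then show ?thesis by (simp add: PL)
        qed
        have lo: "L \<le> 4 * R * (P / real m)"
        proof -
          have "L = 4 * real r * (P / (real r * T d))" using PL r(1) Tpos[OF d1] by (simp add: field_simps)
          also have "\<dots> \<le> 4 * real r * (P / real m)" using m P1 by (intro mult_left_mono divide_left_mono) (auto intro!: mult_pos_pos Tpos d1)
          also have "\<dots> \<le> 4 * R * (P / real m)" using r Pm by (intro mult_right_mono) auto
          finally show ?thesis .
        qed
        have Yx: "x ^ k \<le> Y"
        proof (rule power2_le_imp_le)
          have "(P / real m) ^ k \<le> L ^ k" 
            by (intro power_mono order_trans[OF up] order_trans[OF zero_le_one Pm]) (use L1 in auto)
          then show "(x ^ k)\<^sup>2 \<le> Y\<^sup>2" by (simp add: xk Lk)
        qed (use Y1 in auto)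
        have Yx2: "Y \<le> (4 * R) ^ k * x ^ k"
        proof (rule power2_le_imp_le)
          have "Y\<^sup>2 \<le> (4 * R * (P / real m)) ^ k" unfolding Lk[symmetric] using lo L1 by (intro power_mono) auto
          also have "\<dots> = (4 * R) ^ k * (x ^ k) ^ 2" by (simp only: xk power_mult_distrib)
          also have "\<dots> \<le> ((4 * R) ^ k) ^ 2 * (x ^ k) ^ 2"
            using power_increasing[of 1 2 "(4 * R) ^ k"] one_le_power[of "4 * R" k] R(1)
            by (intro mult_right_mono) auto
          finally show "Y\<^sup>2 \<le> ((4 * R) ^ k * x ^ k)\<^sup>2" by (simp only: power_mult_distrib)
        qed (use x R in auto)
        have q1Y: "real q1 = real q / real d" using q1 d1 by simp
        have mk: "real m ^ k = real d * real c" using c by (simp flip: of_nat_power of_nat_mult)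
        have "real q1 * (\<alpha> * real m ^ k) - of_int b = real c * (real q * \<alpha> - of_int a)"
          by (simp add: mk b_def q1 algebra_simps)
        then have "(x ^ k) ^ 2 * \<bar>real q1 * (\<alpha> * real m ^ k) - of_int b\<bar> = (P / real m) ^ k * (real c * \<beta>)"
          by (simp add: xk \<beta>_def abs_mult)
        also have "\<dots> = P ^ k * \<beta> / real d"
        proof -
          have "m ^ k \<noteq> 0" using m(1) by simp
          then have "c \<noteq> 0" using c by (metis mult_0_right)
          then show ?thesis using d1 by (simp add: power_divide mk)
        qed
        finally have bb: "(x ^ k) ^ 2 * \<bar>real q1 * (\<alpha> * real m ^ k) - of_int b\<bar> = P ^ k * \<beta> / real d" .
        have "norm (fsum k (\<alpha> * real m ^ k) (x ^ 2) (real p)) \<le> C1 * P powr \<epsilon>1 * (x ^ 2) powr (1 - \<tau>)"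
        proof (rule W(4)[rule_format, OF P, of p R x Y q1 b], intro conjI)
          show "R \<le> P powr \<eta>0"
            by (rule order_trans[OF R(2) powr_mono]) (use P1 in \<open>auto simp: \<eta>_def\<close>)
          show "x\<^sup>2 \<le> P" unfolding x(1) using divide_left_mono[of 1 "real m" P] P1 m(1) by simp
          have "coprime a (int q1)" using aq(1) q1 unfolding q(3) by simp
          then show "coprime b (int q1)" using cop by (simp add: b_def coprime_commute)
          show "real q1 \<le> Y" unfolding q1Y Y_def Qs_def by (intro divide_right_mono) auto
          show "(x ^ k) ^ 2 * \<bar>real q1 * (\<alpha> * real m ^ k) - of_int b\<bar> \<le> Y"
            unfolding bb Y_def Qs_def by (intro divide_right_mono) auto
          show "real q1 = Y \<or> (x ^ k) ^ 2 * \<bar>real q1 * (\<alpha> * real m ^ k) - of_int b\<bar> = Y"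
            using bb unfolding Y_def Qs_def q1Y by (simp only: max_def split: if_split) blast
        qed (use p r x Yx Yx2 q1' in auto)
        also have "\<dots> \<le> C1 * P powr \<epsilon>1 * (P / T d) powr (1 - \<tau>)"
          unfolding x(1) using up Pm \<tau>2 W(2) by (intro mult_left_mono powr_mono2) (auto simp: PL)
        finally show ?thesis by (simp add: x(1))
      qed
      have "(\<Sum>(m, p) | (m, p) \<in> outer k r P d (T d) \<and> gcd q (m ^ k) = d. norm (fsum k (\<alpha> * real m ^ k) (P / real m) (real p)))
        \<le> (\<Sum>b | b \<in> outer k r P d (T d) \<and> gcd q (fst b ^ k) = d. C1 * P powr \<epsilon>1 * (P / T d) powr (1 - \<tau>))"
        by (simp only: case_prod_beta' prod.collapse, intro sum_mono, use inner in auto)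
      also have "\<dots> \<le> real (card (outer k r P d (T d))) * (C1 * P powr \<epsilon>1 * (P / T d) powr (1 - \<tau>))"
        using outer(1)[OF k d1, of "T d" r P] Tpos[OF d1] W(2)
        by (simp, intro mult_right_mono) (auto intro!: card_mono)
      also have "\<dots> \<le> (real r ^ 2 * T d / real v) * (C1 * P powr \<epsilon>1 * (P / T d) powr (1 - \<tau>))"
        using outer(2)[OF k d1, of "T d" r P] Tpos[OF d1] W(2) by (intro mult_right_mono) (auto simp: v_def)
      also have "\<dots> = real r ^ 2 * C1 * P powr \<epsilon>1 * (4 powr \<tau> * (P * L powr (- \<tau>) / real v))"
      proof -
        have "T d * (P / T d) powr (1 - \<tau>) = 4 powr \<tau> * P * L powr (- \<tau>)"
          unfolding PT[OF d1, folded L_def] TL using L1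
          by (simp add: powr_diff powr_minus powr_divide field_simps)
        then show ?thesis by (simp add: mult_ac)
      qed
      also have "\<dots> \<le> R ^ 2 * C1 * P powr \<epsilon>1 * (2 * X)"
      proof (intro mult_mono)
        have "4 powr \<tau> \<le> 4 powr (1 / 2)" using \<tau>2 by (intro powr_mono) auto
        then show "4 powr \<tau> \<le> 2" by (simp add: powr_half_sqrt)
      qed (use XL r W(2) P1 v in \<open>auto intro!: power_mono mult_nonneg_nonneg divide_nonneg_nonneg\<close>)
      finally have second: "(\<Sum>(m, p) | (m, p) \<in> outer k r P d (T d) \<and> gcd q (m ^ k) = d.
         norm (fsum k (\<alpha> * real m ^ k) (P / real m) (real p))) \<le> 2 * C1 * (R ^ 2 * P powr \<epsilon>1 * X)" by (simp add: mult_ac)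
      have "1 * X \<le> (R ^ 2 * P powr \<epsilon>1) * X"
      proof (intro mult_right_mono)
        have "P powr \<epsilon>1 \<ge> 1" using P1 \<epsilon>12 by (intro ge_one_powr_ge_zero) auto
        then show "1 \<le> R ^ 2 * P powr \<epsilon>1" using R(1) mult_mono[of 1 "R ^ 2" 1 "P powr \<epsilon>1"] by simp
      qed (use P1 in \<open>auto simp: X_def\<close>)
      then have "T d / real v \<le> 4 * (R ^ 2 * P powr \<epsilon>1 * X)" using first by linarith
      then show ?thesis using second by (simp add: v_def algebra_simps)
    qed
    have "norm (fsum k \<alpha> P R) = norm (fsum k \<alpha> P (real r))" 
      using fsum_floor[of R k \<alpha> P] R(1) by (simp only: r_def)
    also have "\<dots> \<le> (\<Sum>d | d dvd q. (4 + 2 * C1) * (R ^ 2 * P powr \<epsilon>1 * X))"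
      by (rule order_trans[OF bound sum_mono]) (use each in auto)
    also have "\<dots> = real (card {d. d dvd q}) * ((4 + 2 * C1) * (R ^ 2 * P powr \<epsilon>1 * X))" by simp
    also have "\<dots> \<le> (C2 * 2 powr \<epsilon>2 * P powr \<epsilon>1) * ((4 + 2 * C1) * (P powr (2 * \<epsilon>1) * P powr \<epsilon>1 * (P * Q powr (- 2 * \<tau> / real k))))"
    proof (intro mult_mono)
      have "real (card {d. d dvd q}) \<le> C2 * real q powr \<epsilon>2" by (rule C2(2)[OF q(1)])
      also have "\<dots> \<le> C2 * (2 powr \<epsilon>2 * P powr \<epsilon>1)"
      proof (intro mult_left_mono)
        have "real q powr \<epsilon>2 \<le> S powr \<epsilon>2" using qS \<epsilon>12 by (intro powr_mono2) auto
        also have "\<dots> = P powr (real k / 2 * \<epsilon>2)" by (simp add: S_def powr_powr)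
        also have "\<dots> \<le> P powr \<epsilon>1" using P1 \<epsilon> k by (intro powr_mono) (auto simp: \<epsilon>1_def \<epsilon>2_def)
        finally have "real q powr \<epsilon>2 \<le> P powr \<epsilon>1" .
        moreover have "1 * P powr \<epsilon>1 \<le> 2 powr \<epsilon>2 * P powr \<epsilon>1"
          using \<epsilon>12 by (intro mult_right_mono ge_one_powr_ge_zero) auto
        ultimately show "real q powr \<epsilon>2 \<le> 2 powr \<epsilon>2 * P powr \<epsilon>1" by simp
      qed (use C2 in auto)
      finally show "real (card {d. d dvd q}) \<le> C2 * 2 powr \<epsilon>2 * P powr \<epsilon>1" by (simp add: mult_ac)
      have "R ^ 2 \<le> (P powr \<epsilon>1) ^ 2"
      proof (intro power_mono)
        show "R \<le> P powr \<epsilon>1" by (rule order_trans[OF R(2) powr_mono]) (use P1 in \<open>auto simp: \<eta>_def\<close>)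
      qed (use R in auto)
      also have "\<dots> = P powr (2 * \<epsilon>1)" by (simp add: power2_eq_square flip: powr_add)
      finally show "R ^ 2 \<le> P powr (2 * \<epsilon>1)" .
      show "X \<le> P * Q powr (- 2 * \<tau> / real k)" unfolding X_def
        using Qs3 Q(1) \<tau>(2) P1 by (intro mult_left_mono powr_mono2') auto
    qed (use P1 C2 W(2) R in \<open>auto simp: X_def\<close>)
    also have "\<dots> = C * (P powr \<epsilon>1 * (P powr (2 * \<epsilon>1) * P powr \<epsilon>1 * P)) * Q powr (- 2 * \<tau> / real k)"
      by (simp add: C_def mult_ac)
    also have "P powr \<epsilon>1 * (P powr (2 * \<epsilon>1) * P powr \<epsilon>1 * P) = P powr (1 + \<epsilon>)"
    proof -
      have "P powr \<epsilon>1 * (P powr (2 * \<epsilon>1) * P powr \<epsilon>1 * P powr 1) = P powr (\<epsilon>1 + (2 * \<epsilon>1 + \<epsilon>1 + 1))"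
        by (simp only: powr_add)
      then show ?thesis using P1 by (simp add: \<epsilon>1_def add.commute)
    qed
    finally show ?thesis .
  qed
  then show ?thesis using \<eta> C W(3) by blast
qed

subsection \<open>Mean values over the major arcs\<close>

lemma abs_diff_le_eq_atLeastAtMost: "{y. \<bar>y - c\<bar> \<le> r} = {c - r..c + (r::real)}"
  by (auto simp: abs_le_iff)

lemma coprime_fraction_unique:
  fixes b b' q q' :: nat
  assumes "coprime b q" "coprime b' q'" "b * q' = b' * q" "q \<ge> 1" "q' \<ge> 1"
  shows "q = q' \<and> b = b'"
proof -
  have "q dvd b * q'" using assms(3) by simp
  then have 1: "q dvd q'" using assms(1) by (simp add: coprime_commute coprime_dvd_mult_right_iff)
  have "q' dvd b' * q" using assms(3) by (metis dvd_triv_right)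
  then have 2: "q' dvd q" using assms(2) by (simp add: coprime_commute coprime_dvd_mult_right_iff)
  from 1 2 have "q = q'" by (rule dvd_antisym)
  then show ?thesis using assms by simp
qed

text \<open>The map sending \<open>a\<close> to \<open>a * c mod q1\<close> takes reduced numerators
  to reduced numerators. A fibre is determined by \<open>a div q1\<close>, which lies in
  \<open>0..d\<close>, so it has at most \<open>d + 1 \<le> 2 * d\<close> elements.\<close>

lemma sum_reduced_fraction_shift_le:
  fixes J :: "real \<Rightarrow> real" and c d q1 :: nat
  assumes J: "\<And>x n. J (x + of_int n) = J x" "\<And>x. J x \<ge> 0"
    and q: "q1 \<ge> 1" "d \<ge> 1" "coprime q1 c"
  shows "(\<Sum>a | a \<le> d * q1 \<and> coprime a (d * q1). J (real (a * c) / real q1))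
    \<le> 2 * real d * (\<Sum>b | b < q1 \<and> coprime b q1. J (real b / real q1))"
proof -
  define A where "A = {a. a \<le> d * q1 \<and> coprime a (d * q1)}"
  define B where "B = {b. b < q1 \<and> coprime b q1}"
  define g where "g a = a * c mod q1" for a
  have finA: "finite A" unfolding A_def by (rule finite_subset[of _ "{..d * q1}"]) auto
  have finB: "finite B" unfolding B_def by (rule finite_subset[of _ "{..q1}"]) auto
  have gB: "g ` A \<subseteq> B"
  proof
    fix b assume "b \<in> g ` A"
    then obtain a where a: "a \<in> A" "b = g a" by auto
    have "coprime (a * c) q1" using a q(3) by (auto simp: A_def coprime_commute)
    then have "coprime (a * c mod q1) q1" using q(1) by (simp add: coprime_mod_left_iff)
    then show "b \<in> B" using a(2) q(1) by (simp add: B_def g_def)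
  qed
  have Jg: "J (real (a * c) / real q1) = J (real (g a) / real q1)" for a
  proof -
    have "a * c = q1 * (a * c div q1) + g a" by (simp add: g_def)
    then have "real (a * c) = real q1 * real (a * c div q1) + real (g a)" by (metis of_nat_add of_nat_mult)
    then have "real (a * c) / real q1 = real (g a) / real q1 + of_int (int (a * c div q1))"
      using q(1) by (simp add: field_simps)
    then show ?thesis by (simp only: J)
  qed
  have fib: "card {a \<in> A. g a = b} \<le> 2 * d" for b
  proof -
    have inj: "inj_on (\<lambda>a. a div q1) {a \<in> A. g a = b}"
    proof (rule inj_onI)
      fix x y assume xy: "x \<in> {a \<in> A. g a = b}" "y \<in> {a \<in> A. g a = b}" "x div q1 = y div q1"
      have "int (x * c) mod int q1 = int (y * c) mod int q1"
        using xy by (simp only: zmod_int[symmetric] of_nat_eq_iff) (simp add: g_def)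
      then have "int q1 dvd (int x - int y) * int c" by (simp add: mod_eq_dvd_iff left_diff_distrib)
      then have "int q1 dvd int x - int y" using q(3) by (simp add: coprime_dvd_mult_left_iff)
      then have "int x mod int q1 = int y mod int q1" by (simp add: mod_eq_dvd_iff)
      then have "x mod q1 = y mod q1" by (simp flip: of_nat_mod)
      then show "x = y" using xy(3) by (metis div_mult_mod_eq)
    qed
    have sub: "(\<lambda>a. a div q1) ` {a \<in> A. g a = b} \<subseteq> {..d}"
    proof
      fix j assume "j \<in> (\<lambda>a. a div q1) ` {a \<in> A. g a = b}"
      then obtain a where "a \<le> d * q1" "j = a div q1" by (auto simp: A_def)
      then show "j \<in> {..d}" using q(1) div_le_mono[of a "d * q1" q1] by simp
    qed
    have "card {a \<in> A. g a = b} \<le> card {..d}" by (rule card_inj_on_le[OF inj sub]) simp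
    then show ?thesis using q(2) by simp
  qed
  have "(\<Sum>a\<in>A. J (real (a * c) / real q1)) = (\<Sum>a\<in>A. J (real (g a) / real q1))" by (simp only: Jg)
  also have "\<dots> = (\<Sum>b\<in>B. \<Sum>a | a \<in> A \<and> g a = b. J (real (g a) / real q1))"
    by (rule sum.group[OF finA finB gB, symmetric])
  also have "\<dots> = (\<Sum>b\<in>B. real (card {a \<in> A. g a = b}) * J (real b / real q1))"
    by (intro sum.cong refl) simp
  also have "\<dots> \<le> (\<Sum>b\<in>B. (2 * real d) * J (real b / real q1))"
  proof (intro sum_mono mult_right_mono J(2))
    fix b show "real (card {a \<in> A. g a = b}) \<le> 2 * real d" using fib[of b] by linarith
  qed
  finally show ?thesis by (simp add: A_def B_def sum_distrib_left mult_ac)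
qed

text \<open>After the substitution \<open>y = \<alpha> * m ^ k\<close> the arcs become short intervals around reduced fractions
  with denominators \<open>q div d\<close>, which are disjoint.\<close>
lemma sum_arcs_le:
  fixes g :: "real \<Rightarrow> real" and m k d :: nat
  assumes g: "\<And>x. g (x + 1) = g x" "continuous_on UNIV g" "\<And>x. g x \<ge> 0"
    and m: "m \<ge> 1" and d: "d \<ge> 1" and \<rho>: "\<rho> \<ge> 0" "4 * real m ^ k * \<rho> * Q \<le> real d ^ 2"
  shows "(\<Sum>q | 1 \<le> q \<and> real q \<le> Q \<and> gcd q (m ^ k) = d. \<Sum>a | a \<le> q \<and> coprime a q.
      (LBINT \<alpha>:{\<alpha>. \<bar>\<alpha> - real a / real q\<bar> \<le> \<rho> / real q}. g (\<alpha> * real m ^ k)))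
    \<le> 6 * real d / real m ^ k * (LBINT \<alpha>:{0..1}. g \<alpha>)"
proof -
  define S where "S = {q. 1 \<le> q \<and> real q \<le> Q \<and> gcd q (m ^ k) = d}"
  define I where "I = (SIGMA q:S. {b. b < q div d \<and> coprime b (q div d)})"
  define rad where "rad q = \<rho> / real q * real m ^ k" for q :: nat
  define J where "J q x = (LBINT y:{y. \<bar>y - x\<bar> \<le> rad q}. g y)" for q x
  have finS: "finite S" unfolding S_def
    by (rule finite_subset[of _ "{..nat \<lfloor>Q\<rfloor>}"]) (auto simp: le_nat_iff le_floor_iff)
  have finB: "finite {b. b < n \<and> coprime b n}" for n :: nat by (rule finite_subset[of _ "{..n}"]) auto
  have Jper: "J q (x + of_int n) = J q x" for q x n
    unfolding J_def by (rule set_integral_periodic_shift[where g = g, OF g(1)])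
  have J0: "J q x \<ge> 0" for q x unfolding J_def by (rule set_integral_nonneg'[OF g(3)])
  have mk: "real m ^ k > 0" using m by simp
  have one: "(\<Sum>a | a \<le> q \<and> coprime a q. (LBINT \<alpha>:{\<alpha>. \<bar>\<alpha> - real a / real q\<bar> \<le> \<rho> / real q}. g (\<alpha> * real m ^ k)))
     \<le> 2 * real d / real m ^ k * (\<Sum>b | b < q div d \<and> coprime b (q div d). J q (real b / real (q div d)))"
    if q: "q \<in> S" for q
  proof -
    have gq: "gcd q (m ^ k) = d" "q \<ge> 1" using q by (auto simp: S_def)
    obtain q1 where q1: "q = d * q1" using gq by (metis gcd_dvd1 dvdE)
    obtain c where c: "m ^ k = d * c" using gq by (metis gcd_dvd2 dvdE)
    have q1d: "q div d = q1" using q1 d by simp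
    have q1': "q1 \<ge> 1" using gq q1 by (cases q1) auto
    have cop: "coprime q1 c"
    proof -
      have "gcd (d * q1) (d * c) = d" using gq q1 c by simp
      then have "d * gcd q1 c = d" by (simp add: gcd_mult_distrib_nat)
      then show ?thesis using d by (simp add: coprime_iff_gcd_eq_1)
    qed
    have mc: "real m ^ k = real d * real c" using c by (simp flip: of_nat_power of_nat_mult)
    have "(LBINT \<alpha>:{\<alpha>. \<bar>\<alpha> - real a / real q\<bar> \<le> \<rho> / real q}. g (\<alpha> * real m ^ k)) = J q (real (a * c) / real q1) / real m ^ k" for a
    proof -
      have "real a / real q * real m ^ k = real (a * c) / real q1" using d by (simp add: mc q1)
      then show ?thesis using set_integral_scale_shift[OF mk, of "real a / real q" "\<rho> / real q" g 0]
        by (simp add: J_def rad_def)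
    qed
    then have "(\<Sum>a | a \<le> q \<and> coprime a q. (LBINT \<alpha>:{\<alpha>. \<bar>\<alpha> - real a / real q\<bar> \<le> \<rho> / real q}. g (\<alpha> * real m ^ k)))
      = (\<Sum>a | a \<le> d * q1 \<and> coprime a (d * q1). J q (real (a * c) / real q1)) / real m ^ k"
      by (simp only: sum_divide_distrib q1)
    also have "\<dots> \<le> (2 * real d * (\<Sum>b | b < q1 \<and> coprime b q1. J q (real b / real q1))) / real m ^ k"
      using mk by (intro divide_right_mono sum_reduced_fraction_shift_le Jper J0 q1' d cop) auto
    finally show ?thesis by (simp add: q1d)
  qed
  have "(\<Sum>q\<in>S. \<Sum>a | a \<le> q \<and> coprime a q. (LBINT \<alpha>:{\<alpha>. \<bar>\<alpha> - real a / real q\<bar> \<le> \<rho> / real q}. g (\<alpha> * real m ^ k)))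
     \<le> (\<Sum>q\<in>S. 2 * real d / real m ^ k * (\<Sum>b | b < q div d \<and> coprime b (q div d). J q (real b / real (q div d))))"
    by (rule sum_mono[OF one])
  also have "\<dots> = 2 * real d / real m ^ k * (\<Sum>(q, b)\<in>I. J q (real b / real (q div d)))"
    unfolding I_def using finS finB by (simp add: sum_distrib_left flip: sum.Sigma)
  also have "(\<Sum>(q, b)\<in>I. J q (real b / real (q div d)))
      = (\<Sum>i\<in>I. (LBINT y:{y. \<bar>y - real (snd i) / real (fst i div d)\<bar> \<le> rad (fst i)}. g y))"
    by (simp add: J_def case_prod_beta')
  also have "\<dots> \<le> (LBINT y:{-1..2}. g y)"
  proof (rule set_integral_sum_disjoint_le[OF _ g(2,3)])
    show "finite I" unfolding I_def using finS finB by auto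
    have I: "1 \<le> fst i div d" "fst i = d * (fst i div d)" "real (fst i div d) * real d \<le> Q" "snd i < fst i div d"
      "coprime (snd i) (fst i div d)" "rad (fst i) * (4 * real (fst i div d) * Q) \<le> real d" if "i \<in> I" for i
    proof -
      have q: "fst i \<ge> 1" "real (fst i) \<le> Q" "d dvd fst i" using that by (auto simp: I_def S_def)
      show eq: "fst i = d * (fst i div d)" using q(3) by simp
      show q1: "1 \<le> fst i div d" using q(1) eq by (metis One_nat_def Suc_leI gr0I mult_0_right not_one_le_zero)
      have eqr: "real (fst i) = real d * real (fst i div d)" using eq by (metis of_nat_mult)
      then show "real (fst i div d) * real d \<le> Q" using q(2) by (simp add: mult.commute)
      show "snd i < fst i div d" "coprime (snd i) (fst i div d)" using that by (auto simp: I_def)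
      have "rad (fst i) * (4 * real (fst i div d) * Q) = (4 * real m ^ k * \<rho> * Q) / real d"
        unfolding rad_def eqr using q1 d by (simp add: field_simps)
      also have "\<dots> \<le> real d ^ 2 / real d" using \<rho>(2) by (intro divide_right_mono) auto
      also have "\<dots> = real d" using d by (simp add: power2_eq_square)
      finally show "rad (fst i) * (4 * real (fst i div d) * Q) \<le> real d" .
    qed
    \<comment> \<open>The second denominator satisfies \<open>n \<le> Q / d\<close>, so the
      hypothesis on \<open>\<rho>\<close>, with its \<open>real d ^ 2\<close>, bounds the radius by
      a quarter of \<open>1 / (q' * n)\<close>, where \<open>q'\<close> is the reduced denominator.
      Two radii are then less than the distance of distinct fractions.\<close>
    have Ir: "rad (fst i) \<le> 1 / 4 * (1 / (real (fst i div d) * real n))" if "i \<in> I" "1 \<le> n" "real n * real d \<le> Q" for i n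
    proof -
      have "rad (fst i) * (4 * real (fst i div d) * (real n * real d)) \<le> rad (fst i) * (4 * real (fst i div d) * Q)"
        using that(3) \<rho>(1) by (intro mult_left_mono) (auto simp: rad_def)
      then have "rad (fst i) * (4 * real (fst i div d) * real n) * real d \<le> real d"
        using I(6)[OF that(1)] by (simp add: mult_ac)
      then have "rad (fst i) * (4 * real (fst i div d) * real n) \<le> 1" using d by simp
      then show ?thesis using I(1)[OF that(1)] that(2) by (simp add: field_simps)
    qed
    show "{y. \<bar>y - real (snd i) / real (fst i div d)\<bar> \<le> rad (fst i)} \<in> sets borel \<and>
        {y. \<bar>y - real (snd i) / real (fst i div d)\<bar> \<le> rad (fst i)} \<subseteq> {-1..2}" if "i \<in> I" for i
    proof -
      note i = I[OF that]
      have "real (fst i div d) \<ge> 1" using i(1) by simp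
      then have "1 / (real (fst i div d) * real 1) \<le> 1" by simp
      moreover have "real 1 * real d \<le> Q"
        using i(1,3) mult_right_mono[of 1 "real (fst i div d)" "real d"] by simp
      ultimately have "rad (fst i) \<le> 1" using Ir[OF that, of 1] by simp
      moreover define z where "z = real (snd i) / real (fst i div d)"
      moreover have "0 \<le> z" "z \<le> 1" unfolding z_def using i(4) by auto
      ultimately show ?thesis unfolding abs_diff_le_eq_atLeastAtMost z_def[symmetric] by auto
    qed
    fix i j x assume ij: "i \<in> I" "j \<in> I"
      and x: "x \<in> {y. \<bar>y - real (snd i) / real (fst i div d)\<bar> \<le> rad (fst i)}"
        "x \<in> {y. \<bar>y - real (snd j) / real (fst j div d)\<bar> \<le> rad (fst j)}"
    define q q' b b' where "q = fst i div d" and "q' = fst j div d" and "b = snd i" and "b' = snd j"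
    note i = I[OF ij(1), folded q_def b_def] and j = I[OF ij(2), folded q'_def b'_def]
    have "rad (fst i) \<le> 1 / 4 * (1 / (real q * real q'))" using Ir[OF ij(1) j(1,3)] by (simp add: q_def)
    moreover have "rad (fst j) \<le> 1 / 4 * (1 / (real q * real q'))"
      using Ir[OF ij(2) i(1,3)] by (simp add: q'_def mult.commute)
    ultimately have "\<bar>real b / real q - real b' / real q'\<bar> \<le> 1 / 2 * (1 / (real q * real q'))"
      using x by (simp add: q_def q'_def b_def b'_def)
    then have "\<bar>real b / real q - real b' / real q'\<bar> * (real q * real q') \<le> 1 / 2 * (1 / (real q * real q')) * (real q * real q')"
      by (rule mult_right_mono) simp
    also have "\<dots> = 1 / 2" using i(1) j(1) by simp
    also have "\<bar>real b / real q - real b' / real q'\<bar> * (real q * real q') = \<bar>(real b / real q - real b' / real q') * (real q * real q')\<bar>"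
      by (simp add: abs_mult)
    also have "(real b / real q - real b' / real q') * (real q * real q') = of_int (int (b * q') - int (b' * q))"
      using i(1) j(1) by (simp add: field_simps)
    finally have "int (b * q') - int (b' * q) = 0" by linarith
    then have "b * q' = b' * q" by linarith
    then have "q = q' \<and> b = b'" using i(1,5) j(1,5) by (intro coprime_fraction_unique)
    then show "i = j" using i(2) j(2) by (auto simp: prod_eq_iff b_def b'_def)
  qed auto
  also have "(LBINT y:{-1..2}. g y) \<le> 3 * (LBINT y:{0..1}. g y)" by (rule set_integral_three_periods[OF g])
  finally show ?thesis using mk by (simp add: S_def mult_left_mono divide_right_mono)
qed

lemma set_integral_sum:
  fixes f :: "'i \<Rightarrow> 'a \<Rightarrow> real"
  assumes "\<And>i. i \<in> I \<Longrightarrow> set_integrable M S (f i)"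
  shows "(LINT x:S|M. \<Sum>i\<in>I. f i x) = (\<Sum>i\<in>I. (LINT x:S|M. f i x))"
  using assms unfolding set_lebesgue_integral_def set_integrable_def scaleR_sum_right
  by (intro Bochner_Integration.integral_sum)

text \<open>The power mean inequality is applied over the divisors \<open>d\<close>, to the two
  contributions of each \<open>d\<close>, and over the outer variable. On the right only the inner
  sums still depend on \<open>\<alpha>\<close>, ready for integration over an arc.\<close>

lemma arc_interior_mean_le:
  fixes u Q P \<alpha> :: real and T :: "nat \<Rightarrow> real"
  assumes k: "k \<ge> 1" and u: "u \<ge> 1" and q: "q \<ge> 1" and r: "r \<ge> 1" and T1: "T 1 \<ge> 1"
    and mono: "\<And>d d'. 1 \<le> d \<Longrightarrow> d \<le> d' \<Longrightarrow> T d \<le> T d'"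
    and D: "real (card {d. d dvd q}) \<le> D"
  shows "norm (fsum k \<alpha> P (real r)) powr u \<le> (2 * D) powr u * (\<Sum>d | d dvd q. (T d / real (kroot k d)) powr u +
     (real r ^ 2 * T d / real (kroot k d)) powr (u - 1) *
       (\<Sum>(m, p) | (m, p) \<in> outer k r P d (T d) \<and> gcd q (m ^ k) = d. norm (fsum k (\<alpha> * real m ^ k) (P / real m) (real p)) powr u))"
proof -
  define Dv where "Dv = {d. d dvd q}"
  define O' where "O' d = {b. b \<in> outer k r P d (T d) \<and> gcd q (fst b ^ k) = d}" for d
  define h where "h b = norm (fsum k (\<alpha> * real (fst b) ^ k) (P / real (fst b)) (real (snd b)))" for b :: "nat \<times> nat"
  define A where "A d = T d / real (kroot k d)" for d
  have D1: "d \<ge> 1" if "d \<in> Dv" for d using that dvd_pos_nat[of q d] q by (simp add: Dv_def Suc_le_eq)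
  have Tpos: "T d \<ge> 1" if "d \<ge> 1" for d using mono[of 1 d] T1 that by simp
  have A0: "A d \<ge> 0" if "d \<in> Dv" for d using Tpos[OF D1[OF that]] by (simp add: A_def)
  have h0: "h b \<ge> 0" for b by (simp add: h_def)
  have finD: "finite Dv" using q by (simp add: Dv_def finite_divisors_nat)
  have "norm (fsum k \<alpha> P (real r)) \<le> (\<Sum>d\<in>Dv. A d + (\<Sum>b\<in>O' d. h b))"
    using norm_fsum_le_outer[where T = T, OF k q r T1 mono, of \<alpha> P]
    by (simp add: Dv_def O'_def h_def A_def case_prod_beta')
  then have "norm (fsum k \<alpha> P (real r)) powr u \<le> (\<Sum>d\<in>Dv. A d + (\<Sum>b\<in>O' d. h b)) powr u"
    using u by (intro powr_mono2) auto
  also have "\<dots> \<le> real (card Dv) powr (u - 1) * (\<Sum>d\<in>Dv. (A d + (\<Sum>b\<in>O' d. h b)) powr u)"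
    using u A0 h0 by (intro power_mean) (auto intro!: add_nonneg_nonneg sum_nonneg)
  also have "\<dots> \<le> D powr u * (\<Sum>d\<in>Dv. 2 powr u * (A d powr u + (real r ^ 2 * T d / real (kroot k d)) powr (u - 1) * (\<Sum>b\<in>O' d. h b powr u)))"
  proof (intro mult_mono sum_mono)
    have "1 \<in> Dv" by (simp add: Dv_def)
    then have c1: "card Dv \<ge> 1" using finD by (metis One_nat_def Suc_leI card_gt_0_iff empty_iff)
    then have "real (card Dv) powr (u - 1) \<le> real (card Dv) powr u" by (intro powr_mono) auto
    also have "\<dots> \<le> D powr u" using D u by (intro powr_mono2) (auto simp: Dv_def)
    finally show "real (card Dv) powr (u - 1) \<le> D powr u" .
    fix d assume d: "d \<in> Dv"
    define B where "B = (\<Sum>b\<in>O' d. h b)"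
    have B0: "B \<ge> 0" by (simp add: B_def h0 sum_nonneg)
    have "(A d + B) powr u \<le> (2 * max (A d) B) powr u" using A0[OF d] B0 u by (intro powr_mono2) auto
    also have "\<dots> = 2 powr u * max (A d) B powr u" using A0[OF d] by (simp add: powr_mult)
    also have "\<dots> \<le> 2 powr u * (A d powr u + B powr u)" by (intro mult_left_mono) (auto simp: max_def)
    also have "B powr u \<le> real (card (O' d)) powr (u - 1) * (\<Sum>b\<in>O' d. h b powr u)"
      unfolding B_def using u h0 by (intro power_mean)
    also have "\<dots> \<le> (real r ^ 2 * T d / real (kroot k d)) powr (u - 1) * (\<Sum>b\<in>O' d. h b powr u)"
    proof (intro mult_right_mono powr_mono2)
      have T0: "T d \<ge> 0" using Tpos[OF D1[OF d]] by simp
      have "card (O' d) \<le> card (outer k r P d (T d))"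
        unfolding O'_def using outer(1)[OF k D1[OF d] T0] by (intro card_mono) auto
      then show "real (card (O' d)) \<le> real r ^ 2 * T d / real (kroot k d)"
        using outer(2)[OF k D1[OF d] T0, of r P] by linarith
    qed (use u in \<open>auto intro!: sum_nonneg\<close>)
    finally show "(A d + B) powr u \<le> 2 powr u * (A d powr u + (real r ^ 2 * T d / real (kroot k d)) powr (u - 1) * (\<Sum>b\<in>O' d. h b powr u))"
      by (simp add: mult_left_mono)
  qed (auto intro!: sum_nonneg)
  also have "\<dots> = (2 * D) powr u * (\<Sum>d\<in>Dv. A d powr u + (real r ^ 2 * T d / real (kroot k d)) powr (u - 1) * (\<Sum>b\<in>O' d. h b powr u))"
    using D by (simp add: powr_mult sum_distrib_left mult_ac)
  finally show ?thesis by (simp add: Dv_def O'_def h_def A_def case_prod_beta')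
qed

text \<open>\<open>T\<close> and \<open>V\<close> stay abstract; the last hypothesis is the
  disjointness condition of \<open>sum_arcs_le\<close> for the largest outer variable
  \<open>r * T d\<close>. The numbers that never stop are estimated by their count, times the total
  length of the arcs with \<open>d dvd q\<close>.\<close>

lemma major_arcs_mean_explicit:
  fixes u Q P D :: real and T V :: "nat \<Rightarrow> real"
  assumes k: "k \<ge> 1" and u: "u \<ge> 2" and r: "r \<ge> 1" and P: "P \<ge> 1" and Q: "Q \<ge> 1" and T1: "T 1 \<ge> 1"
    and mono: "\<And>d d'. 1 \<le> d \<Longrightarrow> d \<le> d' \<Longrightarrow> T d \<le> T d'"
    and D: "\<And>q. 1 \<le> q \<Longrightarrow> real q \<le> Q \<Longrightarrow> real (card {d. d dvd q}) \<le> D"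
    and V0: "\<And>d. V d \<ge> 0"
    and V: "\<And>d m p. 1 \<le> d \<Longrightarrow> real d \<le> Q \<Longrightarrow> (m, p) \<in> outer k r P d (T d) \<Longrightarrow> Umean k u (P / real m) (real p) \<le> V d"
    and T: "\<And>d. 1 \<le> d \<Longrightarrow> real d \<le> Q \<Longrightarrow> 4 * (real r * T d) ^ k * (Q * P powr (- real k)) * Q \<le> real d ^ 2"
  shows "(LBINT \<alpha>:major_arcs k Q P. norm (fsum k \<alpha> P (real r)) powr u) \<le> (2 * D) powr u *
    (\<Sum>d | 1 \<le> d \<and> real d \<le> Q. (T d / real (kroot k d)) powr u * (4 * (Q * P powr (- real k)) * (Q / real d)) +
      (real r ^ 2 * T d / real (kroot k d)) powr u * (6 * real d / T d ^ k * V d))"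
proof -
  define \<rho> where "\<rho> = Q * P powr (- real k)"
  have \<rho>0: "\<rho> \<ge> 0" using Q by (simp add: \<rho>_def)
  define QQ where "QQ = {q::nat. 1 \<le> q \<and> real q \<le> Q}"
  define Aq where "Aq q = {a::nat. a \<le> q \<and> coprime a q}" for q
  define arc where "arc q a = {\<alpha>. \<bar>\<alpha> - real a / real q\<bar> \<le> \<rho> / real q}" for q a :: nat
  have finQ: "finite QQ" unfolding QQ_def
    by (rule finite_subset[of _ "{..nat \<lfloor>Q\<rfloor>}"]) (auto simp: le_nat_iff le_floor_iff)
  have finA: "finite (Aq q)" for q unfolding Aq_def by (rule finite_subset[of _ "{..q}"]) auto
  have arc: "arc q a \<in> sets borel" "bounded (arc q a)" for q a
    unfolding arc_def abs_diff_le_eq_atLeastAtMost by auto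
  have Tpos: "T d \<ge> 1" if "d \<ge> 1" for d using mono[of 1 d] T1 that by simp
  define O' where "O' q d = {b. b \<in> outer k r P d (T d) \<and> gcd q (fst b ^ k) = d}" for q d
  define g where "g b \<alpha> = norm (fsum k \<alpha> (P / real (fst b)) (real (snd b))) powr u" for b :: "nat \<times> nat" and \<alpha>
  define A N where "A d = (T d / real (kroot k d)) powr u" and "N d = (real r ^ 2 * T d / real (kroot k d))" for d
  have gcont: "continuous_on UNIV (g b)" for b unfolding g_def using u by (intro continuous_intros) auto
  have gcont': "continuous_on UNIV (\<lambda>\<alpha>. g b (\<alpha> * real m ^ k))" for b m
    unfolding g_def using u by (intro continuous_intros) auto
  have finO: "finite (outer k r P d (T d))" if "d \<ge> 1" for d
    using outer(1)[OF k that, of "T d"] Tpos[OF that] by simp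
  have finO': "finite (O' q d)" if "d \<ge> 1" for q d using finO[OF that] by (simp add: O'_def)
  have Dv: "d \<in> QQ" if "q \<in> QQ" "d dvd q" for q d
    using that dvd_pos_nat[of q d] dvd_imp_le[of d q] by (auto simp: QQ_def Suc_le_eq)
  define K where "K = (2 * D) powr u"
  have K0: "K \<ge> 0" by (simp add: K_def)
  have arc_int: "(LBINT \<alpha>:arc q a. norm (fsum k \<alpha> P (real r)) powr u) \<le>
     K * (\<Sum>d | d dvd q. A d * (2 * \<rho> / real q) + N d powr (u - 1) * (\<Sum>b\<in>O' q d. (LBINT \<alpha>:arc q a. g b (\<alpha> * real (fst b) ^ k))))"
    if q: "q \<in> QQ" for q a
  proof -
    have q1: "q \<ge> 1" "real q \<le> Q" using q by (auto simp: QQ_def)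
    have dd: "d \<ge> 1" if "d dvd q" for d using Dv[OF q that] by (simp add: QQ_def)
    have finDv: "finite {d. d dvd q}" using q1 by (simp add: finite_divisors_nat)
    have "(LBINT \<alpha>:arc q a. norm (fsum k \<alpha> P (real r)) powr u) \<le>
      (LBINT \<alpha>:arc q a. K * (\<Sum>d | d dvd q. A d + N d powr (u - 1) * (\<Sum>b\<in>O' q d. g b (\<alpha> * real (fst b) ^ k))))"
    proof (rule set_integral_mono_continuous[OF arc])
      show "continuous_on UNIV (\<lambda>\<alpha>. norm (fsum k \<alpha> P (real r)) powr u)" using u by (intro continuous_intros) auto
      show "continuous_on UNIV (\<lambda>\<alpha>. K * (\<Sum>d | d dvd q. A d + N d powr (u - 1) * (\<Sum>b\<in>O' q d. g b (\<alpha> * real (fst b) ^ k))))"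
        by (intro continuous_intros gcont')
      show "norm (fsum k \<alpha> P (real r)) powr u \<le> K * (\<Sum>d | d dvd q. A d + N d powr (u - 1) * (\<Sum>b\<in>O' q d. g b (\<alpha> * real (fst b) ^ k)))" for \<alpha>
        using arc_interior_mean_le[where T = T, OF k _ q1(1) r T1 mono D[OF q1], of u \<alpha> P] u
        by (simp add: K_def A_def N_def O'_def g_def case_prod_beta')
    qed
    also have "\<dots> = K * (LBINT \<alpha>:arc q a. (\<Sum>d | d dvd q. A d + N d powr (u - 1) * (\<Sum>b\<in>O' q d. g b (\<alpha> * real (fst b) ^ k))))"
      by simp
    also have "(LBINT \<alpha>:arc q a. (\<Sum>d | d dvd q. A d + N d powr (u - 1) * (\<Sum>b\<in>O' q d. g b (\<alpha> * real (fst b) ^ k))))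
      = (\<Sum>d | d dvd q. A d * (2 * \<rho> / real q) + N d powr (u - 1) * (\<Sum>b\<in>O' q d. (LBINT \<alpha>:arc q a. g b (\<alpha> * real (fst b) ^ k))))"
    proof -
      have int: "set_integrable lborel (arc q a) (\<lambda>\<alpha>. g b (\<alpha> * real m ^ k))" for b m
        by (rule set_integrable_continuous[OF arc gcont'])
      have len: "(LBINT \<alpha>:arc q a. A d) = A d * (2 * \<rho> / real q)" for d
        using \<rho>0 unfolding arc_def abs_diff_le_eq_atLeastAtMost by (simp add: set_integral_const)
      have inner: "set_integrable lborel (arc q a) (\<lambda>\<alpha>. \<Sum>b\<in>O' q d. g b (\<alpha> * real (fst b) ^ k))" for d
        by (intro set_integrable_continuous[OF arc] continuous_intros gcont')
      have "(LBINT \<alpha>:arc q a. (\<Sum>d | d dvd q. A d + N d powr (u - 1) * (\<Sum>b\<in>O' q d. g b (\<alpha> * real (fst b) ^ k))))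
        = (\<Sum>d | d dvd q. (LBINT \<alpha>:arc q a. A d + N d powr (u - 1) * (\<Sum>b\<in>O' q d. g b (\<alpha> * real (fst b) ^ k))))"
        using finDv by (intro set_integral_sum set_integrable_continuous[OF arc] continuous_intros gcont')
      also have "\<dots> = (\<Sum>d | d dvd q. A d * (2 * \<rho> / real q) + N d powr (u - 1) * (LBINT \<alpha>:arc q a. \<Sum>b\<in>O' q d. g b (\<alpha> * real (fst b) ^ k)))"
        by (subst set_integral_add(2))
           (auto simp: len intro!: set_integrable_continuous[OF arc] inner continuous_intros gcont')
      also have "\<dots> = (\<Sum>d | d dvd q. A d * (2 * \<rho> / real q) + N d powr (u - 1) * (\<Sum>b\<in>O' q d. (LBINT \<alpha>:arc q a. g b (\<alpha> * real (fst b) ^ k))))"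
        using finO' dd int by (intro sum.cong refl) (subst set_integral_sum, auto)
      finally show ?thesis .
    qed
    finally show ?thesis .
  qed
  have "(LBINT \<alpha>:major_arcs k Q P. norm (fsum k \<alpha> P (real r)) powr u) \<le> (\<Sum>i\<in>Sigma QQ Aq. (LBINT \<alpha>:arc (fst i) (snd i). norm (fsum k \<alpha> P (real r)) powr u))"
  proof (rule set_integral_le_cover)
    show "finite (Sigma QQ Aq)" using finQ finA by auto
    show "continuous_on UNIV (\<lambda>\<alpha>. norm (fsum k \<alpha> P (real r)) powr u)" using u by (intro continuous_intros) auto
    have eq: "major_arcs k Q P = (\<Union>i\<in>Sigma QQ Aq. arc (fst i) (snd i) \<inter> {0..<1})"
    proof -
      have "\<bar>\<alpha> - real a / real q\<bar> \<le> \<rho> / real q \<longleftrightarrow> \<bar>real q * \<alpha> - real a\<bar> \<le> \<rho>" if "q \<ge> 1" for q a :: nat and \<alpha>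
      proof -
        have "\<bar>real q * \<alpha> - real a\<bar> = \<bar>\<alpha> - real a / real q\<bar> * real q"
          using that by (simp add: field_simps flip: abs_mult_pos)
        then show ?thesis using that by (simp add: pos_le_divide_eq)
      qed
      then show ?thesis unfolding major_arcs_def QQ_def Aq_def arc_def \<rho>_def by fastforce
    qed
    show "major_arcs k Q P \<in> sets borel" unfolding eq using finQ finA arc by (intro sets.finite_UN) auto
    show "bounded (major_arcs k Q P)" unfolding eq by (rule bounded_subset[of "{0..1}"]) auto
    show "major_arcs k Q P \<subseteq> (\<Union>i\<in>Sigma QQ Aq. arc (fst i) (snd i))" unfolding eq by auto
  qed (use arc in auto)
  also have "\<dots> = (\<Sum>q\<in>QQ. \<Sum>a\<in>Aq q. (LBINT \<alpha>:arc q a. norm (fsum k \<alpha> P (real r)) powr u))"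
    using finQ finA by (simp add: sum.Sigma case_prod_beta')
  also have "\<dots> \<le> (\<Sum>q\<in>QQ. \<Sum>a\<in>Aq q. K * (\<Sum>d | d dvd q. A d * (2 * \<rho> / real q) +
      N d powr (u - 1) * (\<Sum>b\<in>O' q d. (LBINT \<alpha>:arc q a. g b (\<alpha> * real (fst b) ^ k)))))"
    by (intro sum_mono arc_int)
  also have "\<dots> = K * (\<Sum>q\<in>QQ. \<Sum>d | d \<in> QQ \<and> d dvd q. \<Sum>a\<in>Aq q. A d * (2 * \<rho> / real q) +
      N d powr (u - 1) * (\<Sum>b\<in>O' q d. (LBINT \<alpha>:arc q a. g b (\<alpha> * real (fst b) ^ k))))"
  proof -
    have *: "{d. d dvd q} = {d. d \<in> QQ \<and> d dvd q}" if "q \<in> QQ" for q using Dv[OF that] by auto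
    show ?thesis
      unfolding sum_distrib_left[symmetric] 
      by (rule arg_cong[of _ _ "(*) K"], rule sum.cong[OF refl], subst sum.swap) (simp add: *)
  qed
  \<comment> \<open>With \<open>d\<close> outermost the range of \<open>(m, p)\<close> no longer
    depends on \<open>q\<close>. For each \<open>m\<close> all arcs with
    \<open>gcd q (m ^ k) = d\<close> can then be treated together, which is what makes their dilates
    cover a period only boundedly often.\<close>
  also have "\<dots> = K * (\<Sum>d\<in>QQ. \<Sum>q | q \<in> QQ \<and> d dvd q. \<Sum>a\<in>Aq q. A d * (2 * \<rho> / real q) +
      N d powr (u - 1) * (\<Sum>b\<in>O' q d. (LBINT \<alpha>:arc q a. g b (\<alpha> * real (fst b) ^ k))))"
    using finQ by (subst sum.swap_restrict) auto
  also have "\<dots> \<le> K * (\<Sum>d\<in>QQ. A d * (4 * \<rho> * (Q / real d)) + N d powr u * (6 * real d / T d ^ k * V d))"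
  proof (intro mult_left_mono sum_mono K0)
    fix d assume d: "d \<in> QQ"
    then have d1: "d \<ge> 1" "real d \<le> Q" by (auto simp: QQ_def)
    have T0: "T d \<ge> 1" by (rule Tpos[OF d1(1)])
    have A0: "A d \<ge> 0" by (simp add: A_def)
    define Qd where "Qd = {q. q \<in> QQ \<and> d dvd q}"
    have finQd: "finite Qd" using finQ by (simp add: Qd_def)
    have "(\<Sum>q\<in>Qd. \<Sum>a\<in>Aq q. A d * (2 * \<rho> / real q) + N d powr (u - 1) * (\<Sum>b\<in>O' q d. (LBINT \<alpha>:arc q a. g b (\<alpha> * real (fst b) ^ k))))
      = (\<Sum>q\<in>Qd. \<Sum>a\<in>Aq q. A d * (2 * \<rho> / real q)) +
        N d powr (u - 1) * (\<Sum>q\<in>Qd. \<Sum>a\<in>Aq q. \<Sum>b\<in>O' q d. (LBINT \<alpha>:arc q a. g b (\<alpha> * real (fst b) ^ k)))"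
      by (simp add: sum.distrib sum_distrib_left)
    also have "\<dots> \<le> A d * (4 * \<rho> * (Q / real d)) + N d powr (u - 1) * (N d * (6 * real d / T d ^ k * V d))"
    proof (intro add_mono mult_left_mono)
      \<comment> \<open>At most \<open>q + 1 \<le> 2 * q\<close> numerators compensate the arc
        length \<open>2 * \<rho> / q\<close>; afterwards the multiples of \<open>d\<close> up to
        \<open>Q\<close> contribute \<open>Q / d\<close>.\<close>
      have "(\<Sum>a\<in>Aq q. A d * (2 * \<rho> / real q)) \<le> A d * (4 * \<rho>)" if q: "q \<in> Qd" for q
      proof -
        have q1: "q \<ge> 1" using q by (auto simp: Qd_def QQ_def)
        have "card (Aq q) \<le> card {..q}" by (rule card_mono) (auto simp: Aq_def)
        then have "real (card (Aq q)) \<le> 2 * real q" using q1 by simp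
        then have "real (card (Aq q)) * (A d * (2 * \<rho> / real q)) \<le> (2 * real q) * (A d * (2 * \<rho> / real q))"
          using A0 \<rho>0 by (intro mult_right_mono) auto
        then show ?thesis using q1 by simp
      qed
      then have "(\<Sum>q\<in>Qd. \<Sum>a\<in>Aq q. A d * (2 * \<rho> / real q)) \<le> (\<Sum>q\<in>Qd. A d * (4 * \<rho>))" by (rule sum_mono)
      also have "\<dots> = real (card Qd) * (A d * (4 * \<rho>))" by simp
      also have "\<dots> \<le> (Q / real d) * (A d * (4 * \<rho>))"
      proof (intro mult_right_mono)
        have "Qd = {m. d dvd m \<and> 1 \<le> m \<and> real m \<le> Q}" by (auto simp: Qd_def QQ_def)
        then show "real (card Qd) \<le> Q / real d" using card_multiples_le(2)[OF d1(1), of Q] Q by simp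
      qed (use A0 \<rho>0 in auto)
      finally show "(\<Sum>q\<in>Qd. \<Sum>a\<in>Aq q. A d * (2 * \<rho> / real q)) \<le> A d * (4 * \<rho> * (Q / real d))" by (simp add: mult_ac)
      define Od where "Od = outer k r P d (T d)"
      have finOd: "finite Od" unfolding Od_def by (rule finO[OF d1(1)])
      have N: "real (card Od) \<le> N d" using outer(2)[OF k d1(1), of "T d" r P] T0 by (simp add: Od_def N_def)
      have "(\<Sum>q\<in>Qd. \<Sum>a\<in>Aq q. \<Sum>b\<in>O' q d. (LBINT \<alpha>:arc q a. g b (\<alpha> * real (fst b) ^ k)))
        = (\<Sum>q\<in>Qd. \<Sum>b | b \<in> Od \<and> gcd q (fst b ^ k) = d. \<Sum>a\<in>Aq q. (LBINT \<alpha>:arc q a. g b (\<alpha> * real (fst b) ^ k)))"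
        by (rule sum.cong[OF refl], subst sum.swap) (simp add: O'_def Od_def)
      also have "\<dots> = (\<Sum>b\<in>Od. \<Sum>q | q \<in> Qd \<and> gcd q (fst b ^ k) = d. \<Sum>a\<in>Aq q. (LBINT \<alpha>:arc q a. g b (\<alpha> * real (fst b) ^ k)))"
        by (rule sum.swap_restrict[OF finQd finOd])
      also have "\<dots> \<le> (\<Sum>b\<in>Od. 6 * real d / T d ^ k * V d)"
      proof (rule sum_mono)
        fix b assume b: "b \<in> Od"
        obtain m p where mp: "b = (m, p)" by (cases b)
        have m: "m \<ge> 1" "T d \<le> real m" "real m \<le> real r * T d" using b by (auto simp: Od_def outer_def mp)
        have "{q. q \<in> Qd \<and> gcd q (m ^ k) = d} = {q. 1 \<le> q \<and> real q \<le> Q \<and> gcd q (m ^ k) = d}"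
          by (auto simp: Qd_def QQ_def)
        then have "(\<Sum>q | q \<in> Qd \<and> gcd q (m ^ k) = d. \<Sum>a\<in>Aq q. (LBINT \<alpha>:arc q a. g b (\<alpha> * real m ^ k)))
          \<le> 6 * real d / real m ^ k * (LBINT \<alpha>:{0..1}. g b \<alpha>)"
          unfolding Aq_def arc_def
        proof (simp only:, intro sum_arcs_le gcont m(1) d1(1) \<rho>0)
          show "g b (x + 1) = g b x" for x using fsum_add_int[of k x 1] by (simp add: g_def)
          have "4 * real m ^ k * \<rho> * Q \<le> 4 * (real r * T d) ^ k * \<rho> * Q"
            using m(3) \<rho>0 Q by (intro mult_right_mono mult_left_mono power_mono) auto
          then show "4 * real m ^ k * \<rho> * Q \<le> real d ^ 2" using T[OF d1] by (simp add: \<rho>_def)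
        qed (simp add: g_def)
        also have "(LBINT \<alpha>:{0..1}. g b \<alpha>) = Umean k u (P / real m) (real p)"
          using u by (simp add: g_def mp Umean_eq)
        also have "6 * real d / real m ^ k * Umean k u (P / real m) (real p) \<le> 6 * real d / T d ^ k * V d"
        proof (intro mult_mono divide_left_mono power_mono)
          show "Umean k u (P / real m) (real p) \<le> V d" using V[OF d1, of m p] b by (simp add: Od_def mp)
        qed (use m T0 Umean_nonneg in auto)
        finally show "(\<Sum>q | q \<in> Qd \<and> gcd q (fst b ^ k) = d. \<Sum>a\<in>Aq q. (LBINT \<alpha>:arc q a. g b (\<alpha> * real (fst b) ^ k))) \<le> 6 * real d / T d ^ k * V d"
          by (simp add: mp)
      qed
      also have "\<dots> = real (card Od) * (6 * real d / T d ^ k * V d)" by simp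
      also have "\<dots> \<le> N d * (6 * real d / T d ^ k * V d)"
        using T0 V0[of d] by (intro mult_right_mono N) auto
      finally show "(\<Sum>q\<in>Qd. \<Sum>a\<in>Aq q. \<Sum>b\<in>O' q d. (LBINT \<alpha>:arc q a. g b (\<alpha> * real (fst b) ^ k)))
        \<le> N d * (6 * real d / T d ^ k * V d)" .
    qed simp
    also have "N d powr (u - 1) * (N d * (6 * real d / T d ^ k * V d)) = N d powr u * (6 * real d / T d ^ k * V d)"
    proof -
      have "N d > 0" using T0 r kroot(1)[OF k d1(1)] by (auto simp: N_def intro!: divide_pos_pos mult_pos_pos)
      then show ?thesis by (simp add: powr_diff)
    qed
    finally show "(\<Sum>q | q \<in> QQ \<and> d dvd q. \<Sum>a\<in>Aq q. A d * (2 * \<rho> / real q) +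
      N d powr (u - 1) * (\<Sum>b\<in>O' q d. (LBINT \<alpha>:arc q a. g b (\<alpha> * real (fst b) ^ k))))
      \<le> A d * (4 * \<rho> * (Q / real d)) + N d powr u * (6 * real d / T d ^ k * V d)" by (simp only: Qd_def)
  qed
  finally show ?thesis by (simp only: K_def A_def N_def \<rho>_def QQ_def)
qed

text \<open>The exponent can have either sign; comparable bases lose at most a power with exponent
  \<open>\<bar>D\<bar>\<close>.\<close>

lemma powr_ratio_le:
  fixes x y c D :: real
  assumes "0 < x" "x \<le> y" "y \<le> c * x" "c \<ge> 1"
  shows "y powr D \<le> c powr \<bar>D\<bar> * x powr D"
proof -
  have "y / x \<ge> 1" "y / x \<le> c" using assms by (auto simp: field_simps)
  then have "(y / x) powr D \<le> (y / x) powr \<bar>D\<bar>" "(y / x) powr \<bar>D\<bar> \<le> c powr \<bar>D\<bar>"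
    by (auto intro!: powr_mono powr_mono2)
  then have "(y / x) powr D \<le> c powr \<bar>D\<bar>" by linarith
  then show ?thesis using assms by (simp add: powr_divide field_simps)
qed

text \<open>The lower bound on admissible exponents makes the contribution of \<open>d\<close> at most \<open>1 / d\<close> times the
  expected total.\<close>
lemma major_arcs_term_le:
  fixes P Q D V C u t :: real and k r d :: nat
  assumes k: "k \<ge> 1" and u: "u \<ge> 2" and D: "D \<ge> real k - u / 2" and d: "d \<ge> 1" "real d \<le> Q"
    and r: "r \<ge> 1" and P: "P \<ge> 1" and C: "C \<ge> 1"
    and t: "t = P * (real d / Q) powr (2 / real k) / (4 * real r)"
    and V: "V \<le> C * (P / t) powr (u - real k + D)" "V \<ge> 0"
  shows "(t / real (kroot k d)) powr u * (4 * (Q * P powr (- real k)) * (Q / real d)) +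
      (real r ^ 2 * t / real (kroot k d)) powr u * (6 * real d / t ^ k * V)
    \<le> 10 * C * (4 * real r) powr (2 * u + \<bar>D\<bar>) * P powr (u - real k) * Q powr (2 * D / real k) * (1 / real d)"
proof -
  define v where "v = real (kroot k d)"
  have v: "v \<ge> 1" "real d powr (1 / real k) \<le> v" using kroot(1)[OF k d(1)] kroot_ge[OF k d(1)] by (auto simp: v_def)
  have Q1: "Q > 0" using d by (metis less_le_trans of_nat_0_less_iff less_eq_Suc_le One_nat_def)
  define L where "L = (Q / real d) powr (2 / real k)"
  have L1: "L \<ge> 1" unfolding L_def using d by (intro ge_one_powr_ge_zero) auto
  have tL: "t = P / (4 * real r * L)" unfolding t L_def using d Q1 by (simp add: powr_divide)
  have t0: "t > 0" using tL P r L1 by simp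
  have Pt: "P / t = 4 * real r * L" using tL P r L1 by simp
  have Pt1: "P / t \<ge> 1" unfolding Pt using r L1 mult_mono[of 1 "4 * real r" 1 L] by simp
  have Lk: "L ^ k = (Q / real d) ^ 2"
  proof -
    have Y0: "Q / real d > 0" using Q1 d by simp
    have "L ^ k = ((Q / real d) powr (2 / real k)) powr real k"
      unfolding L_def using Q1 d by (intro powr_realpow[symmetric]) simp
    also have "\<dots> = (Q / real d) powr 2" using k by (simp only: powr_powr) simp
    also have "\<dots> = (Q / real d) ^ 2" using Y0 by (intro powr_numeral less_imp_le)
    finally show ?thesis .
  qed
  define M where "M = P powr (u - real k) * (P / t) powr D"
  have M0: "M \<ge> 0" by (simp add: M_def)
  have tu: "t powr u / t ^ k * (P / t) powr (u - real k + D) = M"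
  proof -
    have "t powr u / t ^ k = t powr (u - real k)" using t0 by (simp add: powr_diff powr_realpow)
    moreover have "(P / t) powr (u - real k + D) = (P / t) powr (u - real k) * (P / t) powr D" by (rule powr_add)
    moreover have "t powr (u - real k) * (P / t) powr (u - real k) = P powr (u - real k)"
      using t0 P by (simp flip: powr_mult)
    ultimately show ?thesis by (simp add: M_def mult_ac)
  qed
  have dv: "real d / v powr u \<le> real d powr (1 - u / real k)"
  proof -
    have "(real d powr (1 / real k)) powr u \<le> v powr u" using v u by (intro powr_mono2) auto
    then have "real d powr (u / real k) \<le> v powr u" by (simp add: powr_powr)
    then have "real d / v powr u \<le> real d / real d powr (u / real k)" using d v by (intro divide_left_mono) auto
    then show ?thesis using d by (simp add: powr_diff)
  qed
  have dM: "real d / v powr u * M \<le> (4 * real r) powr \<bar>D\<bar> * P powr (u - real k) * Q powr (2 * D / real k) * (1 / real d)"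
  proof -
    have "(P / t) powr D = (4 * real r) powr D * L powr D" unfolding Pt using L1 by (simp add: powr_mult)
    also have "\<dots> \<le> (4 * real r) powr \<bar>D\<bar> * L powr D" using r by (intro mult_right_mono powr_mono) auto
    also have "L powr D = Q powr (2 * D / real k) * real d powr (- (2 * D / real k))"
      unfolding L_def using Q1 d by (simp add: powr_powr powr_divide powr_minus field_simps)
    finally have "M \<le> P powr (u - real k) * ((4 * real r) powr \<bar>D\<bar> * (Q powr (2 * D / real k) * real d powr (- (2 * D / real k))))"
      unfolding M_def by (intro mult_left_mono) auto
    then have "real d / v powr u * M \<le> real d powr (1 - u / real k) *
       (P powr (u - real k) * ((4 * real r) powr \<bar>D\<bar> * (Q powr (2 * D / real k) * real d powr (- (2 * D / real k)))))"
      using M0 by (intro mult_mono dv) auto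
    also have "\<dots> = (4 * real r) powr \<bar>D\<bar> * P powr (u - real k) * Q powr (2 * D / real k) *
       (real d powr (1 - u / real k) * real d powr (- (2 * D / real k)))" by (simp only: mult_ac)
    also have "\<dots> \<le> (4 * real r) powr \<bar>D\<bar> * P powr (u - real k) * Q powr (2 * D / real k) * (1 / real d)"
    proof (rule mult_left_mono)
      \<comment> \<open>Equivalent to \<open>D \<ge> k - u / 2\<close>, the lower bound for
        admissible exponents.\<close>
      have "1 - u / real k - 2 * D / real k \<le> - 1"
      proof -
        have "2 * real k \<le> u + 2 * D" using D by simp
        then have "2 * real k / real k \<le> (u + 2 * D) / real k" by (rule divide_right_mono) simp
        then show ?thesis using k by (simp add: add_divide_distrib)
      qed
      then have "real d powr (1 - u / real k - 2 * D / real k) \<le> real d powr (- 1)" using d by (intro powr_mono) auto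
      also have "\<dots> = 1 / real d" using d by (simp add: powr_minus_divide)
      also have "1 - u / real k - 2 * D / real k = 1 - u / real k + - (2 * D / real k)" by simp
      finally show "real d powr (1 - u / real k) * real d powr (- (2 * D / real k)) \<le> 1 / real d"
        by (simp only: powr_add)
    qed auto
    finally show ?thesis .
  qed
  have r1: "(4 * real r) powr (2 * u) \<ge> 1" using r u by (intro ge_one_powr_ge_zero) auto
  \<comment> \<open>The count term is dominated by the moment term:
    \<open>(Q / d) ^ 2 = L ^ k\<close> is at most \<open>(P / t) ^ k\<close>, and the remaining
    factor \<open>(P / t) powr (u - k + D)\<close> is at least \<open>1\<close>.\<close>
  have first: "(t / v) powr u * (4 * (Q * P powr (- real k)) * (Q / real d)) \<le> 4 * (real d / v powr u * M)"
  proof -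
    have "(Q * P powr (- real k)) * (Q / real d) = real d * (Q / real d) ^ 2 / P ^ k"
      using P d by (simp add: powr_minus powr_realpow power2_eq_square field_simps)
    also have "\<dots> = real d * L ^ k / P ^ k" by (simp only: Lk)
    also have "\<dots> \<le> real d * (P / t) ^ k / P ^ k"
    proof (intro divide_right_mono mult_left_mono power_mono)
      have "1 * L \<le> 4 * real r * L" using r L1 by (intro mult_right_mono) auto
      then show "L \<le> P / t" by (simp add: Pt)
    qed (use P L1 in auto)
    also have "\<dots> = real d / t ^ k" using P t0 by (simp add: power_divide)
    finally have "(t / v) powr u * (4 * ((Q * P powr (- real k)) * (Q / real d))) \<le> (t / v) powr u * (4 * (real d / t ^ k))"
      by (intro mult_left_mono) auto
    also have "\<dots> = 4 * (real d / v powr u) * (t powr u / t ^ k * 1)"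
      using v t0 by (simp add: powr_divide)
    also have "\<dots> \<le> 4 * (real d / v powr u) * (t powr u / t ^ k * (P / t) powr (u - real k + D))"
      using Pt1 D u t0 by (intro mult_left_mono ge_one_powr_ge_zero) auto
    finally show ?thesis unfolding tu by (simp add: mult_ac)
  qed
  have second: "(real r ^ 2 * t / v) powr u * (6 * real d / t ^ k * V) \<le> (4 * real r) powr (2 * u) * C * 6 * (real d / v powr u * M)"
  proof -
    have "(real r ^ 2 * t / v) powr u = (real r ^ 2) powr u * (t powr u / v powr u)"
      using v t0 by (simp add: powr_mult powr_divide)
    also have "\<dots> \<le> (4 * real r) powr (2 * u) * (t powr u / v powr u)"
    proof (rule mult_right_mono)
      have "real r ^ 2 = real r powr 2" using r by simp
      then have "(real r ^ 2) powr u = real r powr (2 * u)" by (simp only: powr_powr)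
      also have "\<dots> \<le> (4 * real r) powr (2 * u)" using r u by (intro powr_mono2) auto
      finally show "(real r ^ 2) powr u \<le> (4 * real r) powr (2 * u)" .
    qed simp
    finally have "(real r ^ 2 * t / v) powr u \<le> (4 * real r) powr (2 * u) * (t powr u / v powr u)" .
    then have "(real r ^ 2 * t / v) powr u * (6 * real d / t ^ k * V)
      \<le> (4 * real r) powr (2 * u) * (t powr u / v powr u) * (6 * real d / t ^ k * (C * (P / t) powr (u - real k + D)))"
      using V t0 by (intro mult_mono mult_left_mono) auto
    also have "\<dots> = (4 * real r) powr (2 * u) * C * 6 * (real d / v powr u * (t powr u / t ^ k * (P / t) powr (u - real k + D)))"
      by simp
    finally show ?thesis by (simp only: tu)
  qed
  have "4 * (real d / v powr u * M) \<le> (4 * real r) powr (2 * u) * C * 4 * (real d / v powr u * M)"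
  proof -
    have "1 \<le> (4 * real r) powr (2 * u) * C" using r1 C mult_mono[of 1 "(4 * real r) powr (2 * u)" 1 C] by simp
    then have "1 * (4 * (real d / v powr u * M)) \<le> ((4 * real r) powr (2 * u) * C) * (4 * (real d / v powr u * M))"
      using M0 by (intro mult_right_mono) auto
    then show ?thesis by (simp add: mult_ac)
  qed
  \<comment> \<open>The constants \<open>4\<close> and \<open>6\<close> of the two terms add up to
    the \<open>10\<close> in the statement.\<close>
  from add_mono[OF order_trans[OF first this] second]
  have "(t / v) powr u * (4 * (Q * P powr (- real k)) * (Q / real d)) + (real r ^ 2 * t / v) powr u * (6 * real d / t ^ k * V)
     \<le> (4 * real r) powr (2 * u) * C * 10 * (real d / v powr u * M)" by (simp only: distrib_right[symmetric] distrib_left[symmetric]) simp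
  also have "\<dots> \<le> (4 * real r) powr (2 * u) * C * 10 * ((4 * real r) powr \<bar>D\<bar> * P powr (u - real k) * Q powr (2 * D / real k) * (1 / real d))"
    using C by (intro mult_left_mono dM) auto
  also have "\<dots> = 10 * C * (4 * real r) powr (2 * u + \<bar>D\<bar>) * P powr (u - real k) * Q powr (2 * D / real k) * (1 / real d)"
    by (simp add: powr_add)
  finally show ?thesis by (simp add: v_def)
qed

lemma major_arcs_borel: "major_arcs k Q P \<in> sets borel"
proof -
  have fin: "finite {q::nat. 1 \<le> q \<and> real q \<le> Q}"
    by (rule finite_subset[of _ "{..nat \<lfloor>Q\<rfloor>}"]) (auto simp: le_nat_iff le_floor_iff)
  have fin2: "finite {a::nat. a \<le> q \<and> coprime a q}" for q by (rule finite_subset[of _ "{..q}"]) auto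
  show ?thesis unfolding major_arcs_def
    by (intro sets.finite_UN fin fin2) measurable
qed

lemma major_arcs_subset: "major_arcs k Q P \<subseteq> {0..<1}"
  by (auto simp: major_arcs_def)

text \<open>If the threshold for \<open>d = 1\<close> is below \<open>1\<close>, there is no room
  for an outer variable. Then \<open>Q powr (2 / k)\<close> agrees with \<open>P\<close> up to the
  factor \<open>4 * r\<close>, and the moment over the whole interval already has the claimed
  size.\<close>

lemma major_arcs_mean:
  assumes k: "k \<ge> 1" and u: "u \<ge> 2" and adm: "admissible k u D" and \<epsilon>: "\<epsilon> > 0"
  shows "\<exists>\<eta>>0. \<exists>C\<ge>1. \<exists>P0\<ge>1. \<forall>P\<ge>P0. \<forall>R Q. 1 \<le> R \<and> R \<le> P powr \<eta> \<and> 1 \<le> Q \<and> Q \<le> P powr (real k / 2) \<longrightarrow>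
    (LBINT \<alpha>:major_arcs k Q P. norm (fsum k \<alpha> P R) powr u) \<le> C * P powr (u - real k + \<epsilon>) * Q powr (2 * D / real k)"
proof -
  have D: "D \<ge> real k - u / 2" by (rule admissible_ge[OF k u adm])
  define B where "B = 2 * u + \<bar>D\<bar>"
  have B: "B \<ge> 4" using u by (simp add: B_def)
  \<comment> \<open>The powers of \<open>G = P powr \<epsilon>1\<close> lost are \<open>u\<close>
    from divisors, \<open>B\<close> from \<open>4 * r\<close>, one from the moment and one from a
    harmonic sum: at most \<open>2 * B + 2\<close> in all.\<close>
  define \<epsilon>1 where "\<epsilon>1 = \<epsilon> / (2 * B + 2)"
  have \<epsilon>1: "\<epsilon>1 > 0" using \<epsilon> B by (simp add: \<epsilon>1_def)
  define \<epsilon>2 where "\<epsilon>2 = \<epsilon>1 / real k"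
  have \<epsilon>2: "\<epsilon>2 > 0" using \<epsilon>1 k by (simp add: \<epsilon>2_def)
  obtain \<eta>0 C1 P0 where \<eta>0: "\<eta>0 > 0" and C1: "C1 \<ge> 1" and P0: "P0 \<ge> 1" and
    U: "\<And>P X R. P \<ge> P0 \<Longrightarrow> 1 \<le> X \<Longrightarrow> X \<le> P ^ 2 \<Longrightarrow> 1 \<le> R \<Longrightarrow> R \<le> P powr \<eta>0 \<Longrightarrow>
      Umean k u X R \<le> C1 * P powr \<epsilon>1 * X powr (u - real k + D)"
    using admissible_uniform[OF k u adm \<epsilon>1] by auto
  obtain C2 where C2: "C2 \<ge> 1" "\<And>n. n \<ge> 1 \<Longrightarrow> real (card {d::nat. d dvd n}) \<le> C2 * real n powr \<epsilon>2"
    using divisor_bound[OF \<epsilon>2] by auto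
  define \<eta> where "\<eta> = min \<eta>0 \<epsilon>1"
  have \<eta>: "\<eta> > 0" using \<eta>0 \<epsilon>1 by (simp add: \<eta>_def)
  define c where "c = 1 + real k / \<epsilon>1"
  have c: "c \<ge> 1" using \<epsilon>1 by (simp add: c_def)
  define C where "C = (2 * C2) powr u * (10 * C1 * 4 powr B * c)"
  have C2u: "(2 * C2) powr u \<ge> 1" using C2 u by (intro ge_one_powr_ge_zero) auto
  have B4: "(4::real) powr B \<ge> 1" using B by (intro ge_one_powr_ge_zero) auto
  have CC: "C1 * 4 powr B \<le> C"
  proof -
    have "1 * (C1 * 4 powr B) \<le> (10 * c) * (C1 * 4 powr B)" using c C1 by (intro mult_right_mono) auto
    also have "\<dots> = 1 * (10 * C1 * 4 powr B * c)" by simp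
    also have "\<dots> \<le> C" unfolding C_def using C2u c C1 by (intro mult_right_mono) auto
    finally show ?thesis by simp
  qed
  have C: "C \<ge> 1" using CC C1 B4 mult_mono[of 1 C1 1 "4 powr B"] by simp
  have main: "(LBINT \<alpha>:major_arcs k Q P. norm (fsum k \<alpha> P R) powr u) \<le> C * P powr (u - real k + \<epsilon>) * Q powr (2 * D / real k)"
    if P: "P \<ge> P0" and R: "1 \<le> R" "R \<le> P powr \<eta>" and Q: "1 \<le> Q" "Q \<le> P powr (real k / 2)" for P R Q
  proof -
    define r where "r = nat \<lfloor>R\<rfloor>"
    have r: "1 \<le> r" "real r \<le> R" using R by (auto simp: r_def le_nat_iff)
    have fr: "fsum k \<alpha> P R = fsum k \<alpha> P (real r)" for \<alpha>
      using fsum_floor[of R k \<alpha> P] R(1) by (simp only: r_def)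
    have P1: "P \<ge> 1" using P P0 by linarith
    define G where "G = P powr \<epsilon>1"
    have G1: "G \<ge> 1" unfolding G_def using P1 \<epsilon>1 by (intro ge_one_powr_ge_zero) auto
    have RG: "R \<le> G" unfolding G_def
      by (rule order_trans[OF R(2) powr_mono]) (use P1 in \<open>auto simp: \<eta>_def\<close>)
    have R\<eta>: "R \<le> P powr \<eta>0"
      by (rule order_trans[OF R(2) powr_mono]) (use P1 in \<open>auto simp: \<eta>_def\<close>)
    have rB: "(4 * real r) powr B \<le> 4 powr B * G powr B"
    proof -
      have "(4 * real r) powr B \<le> (4 * G) powr B" using r RG B by (intro powr_mono2) auto
      then show ?thesis using G1 by (simp add: powr_mult)
    qed
    have Gpow: "G powr x = P powr (\<epsilon>1 * x)" for x by (simp add: G_def powr_powr)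
    have ex0: "u - real k + D \<ge> 0" using D u by simp
    have X1: "P powr (u - real k) * Q powr (2 * D / real k) \<ge> 0" by simp
    show ?thesis
    proof (cases "P * (1 / Q) powr (2 / real k) / (4 * real r) \<ge> 1")
      case True
      \<comment> \<open>The outer variable reaches \<open>r * T d\<close>; the divisor
        \<open>4 * r\<close> keeps this at a quarter of \<open>P * (d / Q) powr (2 / k)\<close>, so
        that the dilated arcs are disjoint.\<close>
      define T where "T d = P * (real d / Q) powr (2 / real k) / (4 * real r)" for d :: nat
      have T1: "T 1 \<ge> 1" using True by (simp add: T_def)
      have mono: "T d \<le> T d'" if "1 \<le> d" "d \<le> d'" for d d'
        unfolding T_def using that Q P1 by (intro divide_right_mono mult_left_mono powr_mono2) auto
      have Tpos: "T d \<ge> 1" if "d \<ge> 1" for d using mono[of 1 d] T1 that by simp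
      define V where "V d = (C1 * G) * (P / T d) powr (u - real k + D)" for d
      have "(LBINT \<alpha>:major_arcs k Q P. norm (fsum k \<alpha> P (real r)) powr u) \<le> (2 * (C2 * G)) powr u *
         (\<Sum>d | 1 \<le> d \<and> real d \<le> Q. (T d / real (kroot k d)) powr u * (4 * (Q * P powr (- real k)) * (Q / real d)) +
           (real r ^ 2 * T d / real (kroot k d)) powr u * (6 * real d / T d ^ k * V d))"
      proof (rule major_arcs_mean_explicit[where T = T and V = V, OF k u r(1) P1 Q(1) T1 mono])
        show "real (card {d. d dvd q}) \<le> C2 * G" if q: "1 \<le> q" "real q \<le> Q" for q
        proof -
          have "real (card {d. d dvd q}) \<le> C2 * real q powr \<epsilon>2" by (rule C2(2)[OF q(1)])
          also have "real q powr \<epsilon>2 \<le> (P powr (real k / 2)) powr \<epsilon>2" using q Q \<epsilon>2 by (intro powr_mono2) auto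
          also have "\<dots> = P powr (real k / 2 * \<epsilon>2)" by (rule powr_powr)
          also have "\<dots> \<le> G" unfolding G_def using P1 \<epsilon>1 k by (intro powr_mono) (auto simp: \<epsilon>2_def)
          finally show ?thesis using C2 by (simp add: mult_left_mono)
        qed
        show "V d \<ge> 0" for d using C1 G1 by (simp add: V_def)
        show "Umean k u (P / real m) (real p) \<le> V d" if d: "1 \<le> d" "real d \<le> Q" and mp: "(m, p) \<in> outer k r P d (T d)" for d m p
        proof -
          have m: "1 \<le> m" "T d \<le> real m" "real m \<le> P" and p: "1 \<le> p" "p \<le> r" using mp by (auto simp: outer_def)
          have "P / real m \<le> P / 1" using m(1) P1 by (intro divide_left_mono) auto
          also have "\<dots> \<le> P ^ 2" using P1 mult_left_mono[of 1 P P] by (simp add: power2_eq_square)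
          finally have "Umean k u (P / real m) (real p) \<le> C1 * P powr \<epsilon>1 * (P / real m) powr (u - real k + D)"
            using m p P r R\<eta> by (intro U) auto
          also have "\<dots> \<le> V d" unfolding V_def G_def
            using C1 P1 m Tpos[OF d(1)] ex0 by (intro mult_left_mono powr_mono2 divide_left_mono) auto
          finally show ?thesis .
        qed
        show "4 * (real r * T d) ^ k * (Q * P powr (- real k)) * Q \<le> (real d)\<^sup>2" if d: "1 \<le> d" "real d \<le> Q" for d
        proof -
          have Y0: "real d / Q > 0" using Q d by simp
          have "((real d / Q) powr (2 / real k)) ^ k = ((real d / Q) powr (2 / real k)) powr real k"
            using Q d by (intro powr_realpow[symmetric]) simp
          also have "\<dots> = (real d / Q) powr 2" using k by (simp only: powr_powr) simp
          also have "\<dots> = (real d / Q) ^ 2" using Y0 by (intro powr_numeral less_imp_le)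
          finally have dk: "((real d / Q) powr (2 / real k)) ^ k = (real d / Q) ^ 2" .
          have "real r * T d = (P / 4) * (real d / Q) powr (2 / real k)" using r by (simp add: T_def)
          then have "(real r * T d) ^ k = P ^ k / 4 ^ k * (real d / Q) ^ 2"
            by (simp only: power_mult_distrib[of "P / 4"] power_divide[of P] dk)
          then have "4 * (real r * T d) ^ k * (Q * P powr (- real k)) * Q = 4 / 4 ^ k * real d ^ 2"
            using P1 Q by (simp add: powr_minus powr_realpow power2_eq_square field_simps)
          also have "\<dots> \<le> 1 * real d ^ 2"
          proof (intro mult_right_mono)
            show "(4::real) / 4 ^ k \<le> 1" using power_increasing[of 1 k "4::real"] k by simp
          qed simp
          finally show ?thesis by simp
        qed
      qed
      also have "\<dots> \<le> (2 * (C2 * G)) powr u * (\<Sum>d | 1 \<le> d \<and> real d \<le> Q.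
         10 * (C1 * G) * (4 * real r) powr (2 * u + \<bar>D\<bar>) * P powr (u - real k) * Q powr (2 * D / real k) * (1 / real d))"
      proof (intro mult_left_mono sum_mono)
        fix d assume "d \<in> {d. 1 \<le> d \<and> real d \<le> Q}"
        then have d: "1 \<le> d" "real d \<le> Q" by auto
        have "C1 * G \<ge> 1" using C1 G1 mult_mono[of 1 C1 1 G] by simp
        then show "(T d / real (kroot k d)) powr u * (4 * (Q * P powr (- real k)) * (Q / real d)) +
           (real r ^ 2 * T d / real (kroot k d)) powr u * (6 * real d / T d ^ k * V d)
          \<le> 10 * (C1 * G) * (4 * real r) powr (2 * u + \<bar>D\<bar>) * P powr (u - real k) * Q powr (2 * D / real k) * (1 / real d)"
          using C1 G1 by (intro major_arcs_term_le[OF k u D d r(1) P1 _ T_def]) (auto simp: V_def)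
      qed simp
      also have "\<dots> = (2 * (C2 * G)) powr u * (10 * (C1 * G) * (4 * real r) powr B * P powr (u - real k) * Q powr (2 * D / real k) *
          (\<Sum>d | 1 \<le> d \<and> real d \<le> Q. 1 / real d))"
        by (simp only: B_def sum_distrib_left)
      also have "\<dots> \<le> (2 * (C2 * G)) powr u * (10 * (C1 * G) * (4 powr B * G powr B) * P powr (u - real k) * Q powr (2 * D / real k) * (c * G))"
      proof (intro mult_left_mono mult_mono rB order_refl)
        have "{d::nat. 1 \<le> d \<and> real d \<le> Q} = {1..nat \<lfloor>Q\<rfloor>}" using Q by (auto simp: le_nat_iff le_floor_iff)
        then have "(\<Sum>d | 1 \<le> d \<and> real d \<le> Q. 1 / real d) = harm (nat \<lfloor>Q\<rfloor>)" by (simp add: harm_def inverse_eq_divide)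
        also have "\<dots> \<le> 1 + ln (real (max 1 (nat \<lfloor>Q\<rfloor>)))" by (rule harm_le)
        also have "\<dots> \<le> 1 + ln (P powr (real k / 2))"
        proof -
          have "real (nat \<lfloor>Q\<rfloor>) = of_int \<lfloor>Q\<rfloor>" using Q by (intro of_nat_nat) simp
          then have "real (max 1 (nat \<lfloor>Q\<rfloor>)) \<le> Q" using Q unfolding of_nat_max by simp
          then have "real (max 1 (nat \<lfloor>Q\<rfloor>)) \<le> P powr (real k / 2)" using Q by linarith
          then have "ln (real (max 1 (nat \<lfloor>Q\<rfloor>))) \<le> ln (P powr (real k / 2))"
            using P1 by (subst ln_le_cancel_iff) auto
          then show ?thesis by (rule add_left_mono)
        qed
        also have "\<dots> = 1 + real k / 2 * ln P" using P1 by (simp add: ln_powr)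
        also have "\<dots> \<le> c * G"
        proof -
          have "ln P \<le> G / \<epsilon>1" unfolding G_def using \<epsilon>1 P1 by (intro ln_powr_bound) auto
          then have "real k / 2 * ln P \<le> real k / 2 * (G / \<epsilon>1)" by (intro mult_left_mono) auto
          also have "\<dots> \<le> real k * (G / \<epsilon>1)" using G1 \<epsilon>1 by (intro mult_right_mono) auto
          finally have "real k / 2 * ln P \<le> real k * (G / \<epsilon>1)" .
          moreover have "c * G = G + real k * (G / \<epsilon>1)" by (simp add: c_def distrib_right)
          ultimately show ?thesis using G1 by linarith
        qed
        finally show "(\<Sum>d | 1 \<le> d \<and> real d \<le> Q. 1 / real d) \<le> c * G" .
      qed (use C1 G1 in \<open>auto intro!: sum_nonneg\<close>)
      also have "\<dots> = C * (G powr u * (G * G powr B * G)) * (P powr (u - real k) * Q powr (2 * D / real k))"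
        using C2 G1 by (simp add: C_def powr_mult mult_ac)
      also have "\<dots> \<le> C * P powr \<epsilon> * (P powr (u - real k) * Q powr (2 * D / real k))"
      proof (intro mult_right_mono mult_left_mono X1)
        have "G powr u * (G * G powr B * G) = G powr (u + (1 + B + 1))"
          using G1 by (simp add: powr_add power2_eq_square)
        also have "\<dots> \<le> G powr (2 * B + 2)" using G1 u by (intro powr_mono) (auto simp: B_def)
        also have "\<dots> = P powr \<epsilon>" unfolding Gpow using B by (simp add: \<epsilon>1_def)
        finally show "G powr u * (G * G powr B * G) \<le> P powr \<epsilon>" .
      qed (use C in auto)
      also have "\<dots> = C * P powr (u - real k + \<epsilon>) * Q powr (2 * D / real k)" by (simp add: powr_add mult_ac)
      finally show ?thesis by (simp only: fr)
    next
      case False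
      define X where "X = Q powr (2 / real k)"
      have X0: "X > 0" using Q by (simp add: X_def)
      have XP: "X \<le> P"
      proof -
        have "X \<le> (P powr (real k / 2)) powr (2 / real k)" unfolding X_def using Q by (intro powr_mono2) auto
        also have "\<dots> = P" using P1 k by (simp add: powr_powr)
        finally show ?thesis .
      qed
      have PX: "P \<le> 4 * real r * X"
      proof -
        have "P / X / (4 * real r) < 1" using False Q by (simp add: X_def powr_divide)
        then show ?thesis using X0 r by (simp add: field_simps)
      qed
      have "(LBINT \<alpha>:major_arcs k Q P. norm (fsum k \<alpha> P R) powr u) \<le> (LBINT \<alpha>:{0..1}. norm (fsum k \<alpha> P R) powr u)"
        using major_arcs_subset[of k Q P] u
        by (intro set_integral_mono_set major_arcs_borel continuous_intros) auto
      also have "\<dots> = Umean k u P R" using u by (simp add: Umean_eq)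
      also have "\<dots> \<le> C1 * P powr \<epsilon>1 * P powr (u - real k + D)"
        using P P1 R R\<eta> mult_left_mono[of 1 P P] by (intro U) (auto simp: power2_eq_square)
      also have "\<dots> = C1 * G * P powr (u - real k) * P powr D" by (simp add: G_def powr_add mult_ac)
      also have "\<dots> \<le> C1 * G * P powr (u - real k) * ((4 powr B * G powr B) * Q powr (2 * D / real k))"
      proof (intro mult_left_mono)
        have "P powr D \<le> (4 * real r) powr \<bar>D\<bar> * X powr D" using X0 XP PX r by (intro powr_ratio_le) auto
        also have "\<dots> \<le> (4 * real r) powr B * X powr D" using r u by (intro mult_right_mono powr_mono) (auto simp: B_def)
        also have "\<dots> \<le> (4 powr B * G powr B) * X powr D" by (intro mult_right_mono rB) auto
        also have "X powr D = Q powr (2 * D / real k)" by (simp add: X_def powr_powr)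
        finally show "P powr D \<le> (4 powr B * G powr B) * Q powr (2 * D / real k)" .
      qed (use C1 G1 in auto)
      also have "\<dots> = (C1 * 4 powr B) * (G * G powr B) * (P powr (u - real k) * Q powr (2 * D / real k))" by (simp add: mult_ac)
      also have "\<dots> \<le> C * P powr \<epsilon> * (P powr (u - real k) * Q powr (2 * D / real k))"
      proof (intro mult_right_mono mult_mono CC X1)
        have "G * G powr B = G powr (1 + B)" using G1 by (simp add: powr_add)
        also have "\<dots> \<le> G powr (2 * B + 2)" using G1 B by (intro powr_mono) auto
        also have "\<dots> = P powr \<epsilon>" unfolding Gpow using B by (simp add: \<epsilon>1_def)
        finally show "G * G powr B \<le> P powr \<epsilon>" .
      qed (use C G1 in auto)
      also have "\<dots> = C * P powr (u - real k + \<epsilon>) * Q powr (2 * D / real k)" by (simp add: powr_add mult_ac)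
      finally show ?thesis .
    qed
  qed
  then show ?thesis using \<eta> C P0 by blast
qed

subsection \<open>Pruning\<close>

lemma minor_arcs_borel: "minor_arcs k Q P \<in> sets borel"
  unfolding minor_arcs_def using major_arcs_borel by auto

text \<open>The arcs lie in the half-open interval, so the point \<open>1\<close> always belongs to
  the minor arcs and is split off by this lemma.\<close>

lemma set_integral_singleton_eq_0:
  fixes g :: "real \<Rightarrow> real"
  shows "(LBINT x:{a}. g x) = 0"
proof -
  have "(LBINT x:{a}. g x) = (LBINT x:{a}. g a)"
    unfolding set_lebesgue_integral_def by (rule arg_cong[of _ _ "integral\<^sup>L lborel"]) (auto simp: indicator_def)
  also have "\<dots> = 0" by (simp add: set_integral_const)
  finally show ?thesis .
qed

text \<open>For negative \<open>\<tau>\<close> the factor in \<open>Q\<close> is at least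
  \<open>1\<close>, and the trivial bound \<open>P\<close> suffices.\<close>

lemma fsum_minor_bound:
  assumes k: "k \<ge> 1" and w: "w \<ge> 1" and adm: "admissible k (2 * real w) D"
    and \<tau>: "\<tau> = (real k - 2 * D) / (4 * real w ^ 2)" and \<epsilon>: "\<epsilon> > 0"
  shows "\<exists>\<eta>>0. \<exists>C\<ge>1. \<exists>P0\<ge>1. \<forall>P\<ge>P0. \<forall>R Q \<alpha>.
    1 \<le> R \<and> R \<le> P powr \<eta> \<and> 1 \<le> Q \<and> Q \<le> P powr (real k / 2) \<and> \<alpha> \<in> {0..<1} \<and> \<alpha> \<notin> major_arcs k Q P \<longrightarrow>
    norm (fsum k \<alpha> P R) \<le> C * P powr (1 + \<epsilon>) * Q powr (- 2 * \<tau> / real k)"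
proof (cases "\<tau> \<ge> 0")
  case True
  then show ?thesis using weyl_minor[OF k w adm \<tau> _ \<epsilon>] by blast
next
  case False
  have "norm (fsum k \<alpha> P R) \<le> 1 * P powr (1 + \<epsilon>) * Q powr (- 2 * \<tau> / real k)" if "P \<ge> 1" "Q \<ge> 1" for P Q R \<alpha>
  proof -
    have "norm (fsum k \<alpha> P R) \<le> P powr 1 * 1" using that norm_fsum_le[of P k \<alpha> R] by simp
    also have "\<dots> \<le> P powr (1 + \<epsilon>) * Q powr (- 2 * \<tau> / real k)"
      using that False \<epsilon> by (intro mult_mono powr_mono ge_one_powr_ge_zero) (auto intro!: divide_nonpos_nonneg)
    finally show ?thesis by simp
  qed
  then show ?thesis by (intro exI[of _ 1] conjI allI impI) auto
qed

lemma set_integral_powr_split_le: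
  assumes S: "S \<in> sets borel" "bounded S" and t: "t \<ge> 0" "u > 0"
    and b: "\<And>\<alpha>. \<alpha> \<in> S \<Longrightarrow> norm (fsum k \<alpha> P R) \<le> b"
  shows "(LBINT \<alpha>:S. norm (fsum k \<alpha> P R) powr (t + u)) \<le> b powr t * (LBINT \<alpha>:S. norm (fsum k \<alpha> P R) powr u)"
proof -
  have "(LBINT \<alpha>:S. norm (fsum k \<alpha> P R) powr (t + u)) \<le> (LBINT \<alpha>:S. b powr t * norm (fsum k \<alpha> P R) powr u)"
  proof (rule set_integral_mono_continuous[OF S])
    fix \<alpha> assume \<alpha>: "\<alpha> \<in> S"
    show "norm (fsum k \<alpha> P R) powr (t + u) \<le> b powr t * norm (fsum k \<alpha> P R) powr u"
      unfolding powr_add using b[OF \<alpha>] t by (intro mult_right_mono powr_mono2) auto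
  qed (use t in \<open>auto intro!: continuous_intros\<close>)
  then show ?thesis by simp
qed

theorem theorem5p3:
  fixes k :: nat and s \<theta> \<tau> Ds :: real and \<Delta> :: "real \<Rightarrow> real"
  assumes "k \<ge> 1" and "s \<ge> 2"
    and adm_range: "\<forall>u\<in>{2..s}. admissible k u (\<Delta> u)"
    and adm_even: "\<forall>w::nat. w \<ge> 1 \<longrightarrow> admissible k (2 * real w) (\<Delta> (2 * real w))"
    and tau: "is_tau k \<Delta> \<tau>"
    and Dstar: "is_minor_exp s \<Delta> \<tau> Ds"
    and "Ds < 0"
    and "0 < \<theta>" and "\<theta> \<le> real k / 2"
  shows "\<forall>\<epsilon>>0. \<exists>\<eta>>0. \<exists>C. \<exists>P0. \<forall>P\<ge>P0. \<forall>R Q.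
           2 \<le> R \<and> R \<le> P powr \<eta> \<and> P powr \<theta> \<le> Q \<and> Q \<le> P powr (real k / 2) \<longrightarrow>
           integral (minor_arcs k Q P) (\<lambda>\<alpha>. norm (fsum k \<alpha> P R) powr s)
             \<le> C * P powr (s - real k) * Q powr (\<epsilon> - 2 * \<bar>Ds\<bar> / real k)"
proof (intro allI impI)
  fix \<epsilon> :: real assume \<epsilon>: "\<epsilon> > 0"
  note k = \<open>k \<ge> 1\<close> and s = \<open>s \<ge> 2\<close> and \<theta> = \<open>0 < \<theta>\<close>
  obtain w :: nat where w: "w \<ge> 1" "\<tau> = (real k - 2 * \<Delta> (2 * real w)) / (4 * real w ^ 2)"
    using tau by (auto simp: is_tau_def)
  have admw: "admissible k (2 * real w) (\<Delta> (2 * real w))" using adm_even w(1) by blast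
  obtain t where t: "0 \<le> t" "t \<le> s - 2" "Ds = \<Delta> (s - t) - t * \<tau>"
    using Dstar by (auto simp: is_minor_exp_def)
  define u D where "u = s - t" and "D = \<Delta> u"
  have u: "u \<ge> 2" "s = t + u" using t by (auto simp: u_def)
  have admu: "admissible k u D" using adm_range t by (auto simp: u_def D_def)
  have Ds: "Ds = D - t * \<tau>" using t by (simp add: D_def u_def)
  \<comment> \<open>The final loss is \<open>P\<close> to the power
    \<open>\<epsilon>1 * (t + 1) + 2 * \<delta> * \<bar>D\<bar>\<close>: \<open>t\<close> times from
    the pointwise bound, once from the mean value, and from the ratio of consecutive levels. Each
    half is at most \<open>\<epsilon> * \<theta> / 2\<close>, and
    \<open>P powr (\<theta> * \<epsilon>) \<le> Q powr \<epsilon>\<close>.\<close>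
  define \<epsilon>1 where "\<epsilon>1 = \<epsilon> * \<theta> / (2 * (t + 1))"
  define \<delta> where "\<delta> = \<epsilon> * \<theta> / (4 * (\<bar>D\<bar> + 1))"
  have \<epsilon>1: "\<epsilon>1 > 0" using \<epsilon> \<theta> t by (simp add: \<epsilon>1_def)
  have \<delta>: "\<delta> > 0" using \<epsilon> \<theta> by (simp add: \<delta>_def add_nonneg_pos)
  obtain \<eta>1 C1 P1 where \<eta>1: "\<eta>1 > 0" and C1: "C1 \<ge> 1" and P1: "P1 \<ge> 1" and
    minor: "\<And>P R Q \<alpha>. P \<ge> P1 \<Longrightarrow> 1 \<le> R \<Longrightarrow> R \<le> P powr \<eta>1 \<Longrightarrow> 1 \<le> Q \<Longrightarrow> Q \<le> P powr (real k / 2) \<Longrightarrow>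
      \<alpha> \<in> {0..<1} \<Longrightarrow> \<alpha> \<notin> major_arcs k Q P \<Longrightarrow>
      norm (fsum k \<alpha> P R) \<le> C1 * P powr (1 + \<epsilon>1) * Q powr (- 2 * \<tau> / real k)"
    using fsum_minor_bound[OF k w(1) admw w(2) \<epsilon>1] by auto
  obtain \<eta>2 C2 P2 where \<eta>2: "\<eta>2 > 0" and C2: "C2 \<ge> 1" and P2: "P2 \<ge> 1" and
    major: "\<And>P R Q. P \<ge> P2 \<Longrightarrow> 1 \<le> R \<Longrightarrow> R \<le> P powr \<eta>2 \<Longrightarrow> 1 \<le> Q \<Longrightarrow> Q \<le> P powr (real k / 2) \<Longrightarrow>
      (LBINT \<alpha>:major_arcs k Q P. norm (fsum k \<alpha> P R) powr u) \<le> C2 * P powr (u - real k + \<epsilon>1) * Q powr (2 * D / real k)"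
    using major_arcs_mean[OF k u(1) admu \<epsilon>1] by auto
  obtain \<eta>3 C3 P3 where \<eta>3: "\<eta>3 > 0" and
    full: "\<And>P R. P \<ge> P3 \<Longrightarrow> 1 \<le> R \<Longrightarrow> R \<le> P powr \<eta>3 \<Longrightarrow> Umean k u P R \<le> C3 * P powr (u - real k + D + \<epsilon>1)"
  proof -
    from admu \<epsilon>1 obtain \<eta>' C' P' where "\<eta>' > 0"
      "\<forall>P\<ge>P'. \<forall>R. 1 \<le> R \<and> R \<le> P powr \<eta>' \<longrightarrow> Umean k u P R \<le> C' * P powr (u - real k + D + \<epsilon>1)"
      unfolding admissible_def by meson
    then show thesis by (intro that[of \<eta>' P' C']) auto
  qed
  define C4 where "C4 = max C2 C3"
  define \<eta> where "\<eta> = min \<eta>1 (min \<eta>2 \<eta>3)"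
  define P0 where "P0 = max P1 (max P2 P3)"
  \<comment> \<open>The number of levels depends on \<open>k\<close> and \<open>\<delta>\<close> but
    not on \<open>P\<close>, so summing over the pieces costs only a constant.\<close>
  obtain J :: nat where J: "real J * \<delta> \<ge> real k / 2"
    using reals_Archimedean3[OF \<delta>, THEN spec, of "real k / 2"] less_imp_le by blast
  define K where "K = real (J + 1) * (C1 powr t * C4)"
  have "integral (minor_arcs k Q P) (\<lambda>\<alpha>. norm (fsum k \<alpha> P R) powr s)
      \<le> K * P powr (s - real k) * Q powr (\<epsilon> - 2 * \<bar>Ds\<bar> / real k)"
    if P: "P \<ge> P0" and R: "2 \<le> R" "R \<le> P powr \<eta>" and Q: "P powr \<theta> \<le> Q" "Q \<le> P powr (real k / 2)" for P R Q
  proof -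
    have Pge: "P \<ge> P1" "P \<ge> P2" "P \<ge> P3" using P by (auto simp: P0_def)
    have P1': "P \<ge> 1" using Pge P1 by linarith
    have R1: "1 \<le> R" using R by simp
    have R\<eta>: "R \<le> P powr \<eta>1" "R \<le> P powr \<eta>2" "R \<le> P powr \<eta>3"
      by (rule order_trans[OF R(2) powr_mono]; use P1' in \<open>simp add: \<eta>_def\<close>)+
    define S where "S = P powr (real k / 2)"
    \<comment> \<open>The levels are capped at \<open>P powr (k / 2)\<close>, the end of the range
      of both bounds; all points beyond it form the last piece.\<close>
    define Qj where "Qj j = min (Q * P powr (real j * \<delta>)) S" for j
    have Q1: "Q \<ge> 1" using Q(1) ge_one_powr_ge_zero[OF P1', of \<theta>] \<theta> by linarith
    have pj: "P powr (real j * \<delta>) \<ge> 1" for j using P1' \<delta> by (intro ge_one_powr_ge_zero) auto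
    have QS: "Q \<le> S" using Q by (simp add: S_def)
    have QQj: "Q \<le> Qj j" for j using pj[of j] Q1 QS mult_left_mono[OF pj[of j], of Q] by (simp add: Qj_def)
    have Qj: "1 \<le> Qj j" "Qj j \<le> P powr (real k / 2)" for j
      by (rule order_trans[OF Q1 QQj]) (simp add: Qj_def S_def)
    have Q0: "Qj 0 = Q" using QS P1' by (simp add: Qj_def)
    have QJ: "Qj J = S"
    proof -
      have "S \<le> P powr (real J * \<delta>)" unfolding S_def using J P1' by (intro powr_mono) auto
      also have "\<dots> \<le> Q * P powr (real J * \<delta>)"
        using mult_right_mono[OF Q1, of "P powr (real J * \<delta>)"] by simp
      finally show ?thesis by (simp add: Qj_def)
    qed
    have step: "Qj j \<le> Qj (Suc j)" "Qj (Suc j) \<le> P powr \<delta> * Qj j" for j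
    proof -
      have e: "Q * P powr (real (Suc j) * \<delta>) = P powr \<delta> * (Q * P powr (real j * \<delta>))"
        by (simp add: distrib_right powr_add)
      have p\<delta>: "P powr \<delta> \<ge> 1" using P1' \<delta> by (intro ge_one_powr_ge_zero) auto
      have "Q * P powr (real j * \<delta>) \<le> P powr \<delta> * (Q * P powr (real j * \<delta>))"
        using mult_right_mono[OF p\<delta>, of "Q * P powr (real j * \<delta>)"] Q1 by simp
      then show "Qj j \<le> Qj (Suc j)" unfolding Qj_def e by linarith
      have "S \<le> P powr \<delta> * S" using mult_right_mono[OF p\<delta>, of S] by (simp add: S_def)
      then show "Qj (Suc j) \<le> P powr \<delta> * Qj j" unfolding Qj_def e by (auto simp: min_def)
    qed
    define Mj where "Mj j = major_arcs k (Qj j) P" for j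
    define piece where "piece j = (if j < J then Mj (Suc j) - Mj j else {0..<1} - Mj J)" for j
    have Mb: "Mj j \<in> sets borel" "Mj j \<subseteq> {0..<1}" for j
      unfolding Mj_def by (rule major_arcs_borel major_arcs_subset)+
    have piece: "piece j \<in> sets borel" "bounded (piece j)" "piece j \<subseteq> {0..<1}" for j
    proof -
      show "piece j \<in> sets borel" using Mb(1) by (auto simp: piece_def)
      show sub: "piece j \<subseteq> {0..<1}" using Mb(2) by (auto simp: piece_def)
      show "bounded (piece j)" by (rule bounded_subset[OF _ sub]) simp
    qed
    define g where "g x \<alpha> = norm (fsum k \<alpha> P R) powr x" for x \<alpha>
    have gcont: "continuous_on UNIV (g x)" if "x > 0" for x
      unfolding g_def using that by (intro continuous_intros)
    have g0: "g x \<alpha> \<ge> 0" for x \<alpha> by (simp add: g_def)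
    have C4: "C4 \<ge> 1" "C2 \<le> C4" "C3 \<le> C4" using C2 by (auto simp: C4_def)
    \<comment> \<open>Since \<open>D\<close> may have either sign, moving from one level to the next
      is charged with \<open>\<bar>D\<bar>\<close>.\<close>
    have Qpow: "Qj (Suc j) powr (2 * D / real k) \<le> P powr (2 * \<delta> * \<bar>D\<bar>) * Qj j powr (2 * D / real k)" for j
    proof -
      have "Qj (Suc j) powr (2 * D / real k) \<le> (P powr \<delta>) powr \<bar>2 * D / real k\<bar> * Qj j powr (2 * D / real k)"
        using step[of j] Qj(1)[of j] P1' \<delta> by (intro powr_ratio_le ge_one_powr_ge_zero) auto
      also have "(P powr \<delta>) powr \<bar>2 * D / real k\<bar> \<le> P powr (2 * \<delta> * \<bar>D\<bar>)"
      proof -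
        have "\<bar>2 * D / real k\<bar> \<le> 2 * \<bar>D\<bar> / 1" unfolding abs_divide abs_mult using k by (intro frac_le) auto
        then have "\<delta> * \<bar>2 * D / real k\<bar> \<le> \<delta> * (2 * \<bar>D\<bar>)" using \<delta> by (intro mult_left_mono) auto
        then show ?thesis unfolding powr_powr using P1' by (intro powr_mono) (auto simp: mult_ac)
      qed
      finally show ?thesis by (simp add: mult_right_mono)
    qed
    have mean: "(LBINT \<alpha>:piece j. g u \<alpha>) \<le> C4 * P powr (u - real k + \<epsilon>1) * (P powr (2 * \<delta> * \<bar>D\<bar>) * Qj j powr (2 * D / real k))"
      if j: "j \<le> J" for j
    proof (cases "j < J")
      case True
      have "(LBINT \<alpha>:piece j. g u \<alpha>) \<le> (LBINT \<alpha>:Mj (Suc j). g u \<alpha>)"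
        using True u Mb bounded_subset[OF _ Mb(2)]
        by (intro set_integral_mono_set piece gcont g0) (auto simp: piece_def)
      also have "\<dots> \<le> C2 * P powr (u - real k + \<epsilon>1) * Qj (Suc j) powr (2 * D / real k)"
        unfolding g_def Mj_def by (rule major[OF Pge(2) R1 R\<eta>(2) Qj])
      also have "\<dots> \<le> C4 * P powr (u - real k + \<epsilon>1) * (P powr (2 * \<delta> * \<bar>D\<bar>) * Qj j powr (2 * D / real k))"
        using C4 C2 by (intro mult_mono Qpow mult_right_mono) auto
      finally show ?thesis .
    next
      case False
      then have "j = J" using j by simp
      have "(LBINT \<alpha>:piece j. g u \<alpha>) \<le> (LBINT \<alpha>:{0..1}. g u \<alpha>)"
        using piece(3)[of j] u by (intro set_integral_mono_set piece gcont g0) auto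
      also have "\<dots> = Umean k u P R" using u by (simp add: g_def Umean_eq)
      also have "\<dots> \<le> C3 * P powr (u - real k + D + \<epsilon>1)" by (rule full[OF Pge(3) R1 R\<eta>(3)])
      also have "\<dots> \<le> C4 * P powr (u - real k + D + \<epsilon>1)" using C4 by (intro mult_right_mono) auto
      also have "\<dots> = C4 * P powr (u - real k + \<epsilon>1) * (1 * Qj j powr (2 * D / real k))"
      proof -
        \<comment> \<open>At the top level \<open>Q powr (2 * D / k)\<close> is
          \<open>P powr D\<close>, so the moment over the whole interval fits the same form.\<close>
        have "Qj j powr (2 * D / real k) = P powr D" using k by (simp add: \<open>j = J\<close> QJ S_def powr_powr)
        moreover have "P powr (u - real k + D + \<epsilon>1) = P powr (u - real k + \<epsilon>1) * P powr D"
          by (simp add: add_ac flip: powr_add)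
        ultimately show ?thesis by simp
      qed
      also have "\<dots> \<le> C4 * P powr (u - real k + \<epsilon>1) * (P powr (2 * \<delta> * \<bar>D\<bar>) * Qj j powr (2 * D / real k))"
        using C4 P1' \<delta> by (intro mult_left_mono mult_right_mono ge_one_powr_ge_zero) auto
      finally show ?thesis .
    qed
    have final: "(LBINT \<alpha>:piece j. g s \<alpha>) \<le> C1 powr t * C4 * P powr (s - real k) * Q powr (\<epsilon> - 2 * \<bar>Ds\<bar> / real k)"
      if j: "j \<le> J" for j
    proof -
      define b where "b = C1 * P powr (1 + \<epsilon>1) * Qj j powr (- 2 * \<tau> / real k)"
      have "(LBINT \<alpha>:piece j. g s \<alpha>) \<le> b powr t * (LBINT \<alpha>:piece j. g u \<alpha>)"
        unfolding g_def u(2)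
      proof (rule set_integral_powr_split_le[OF piece(1,2) t(1)])
        fix \<alpha> assume \<alpha>: "\<alpha> \<in> piece j"
        then have "\<alpha> \<notin> major_arcs k (Qj j) P" using j by (auto simp: piece_def Mj_def split: if_splits)
        then show "norm (fsum k \<alpha> P R) \<le> b"
          unfolding b_def using \<alpha> piece(3)[of j] by (intro minor Pge R1 R\<eta> Qj) auto
      qed (use u in auto)
      also have "\<dots> \<le> b powr t * (C4 * P powr (u - real k + \<epsilon>1) * (P powr (2 * \<delta> * \<bar>D\<bar>) * Qj j powr (2 * D / real k)))"
        by (intro mult_left_mono mean[OF j]) simp
      also have "b powr t = C1 powr t * P powr ((1 + \<epsilon>1) * t) * Qj j powr (- 2 * \<tau> / real k * t)"
        using C1 by (simp add: b_def powr_mult powr_powr)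
      also have "C1 powr t * P powr ((1 + \<epsilon>1) * t) * Qj j powr (- 2 * \<tau> / real k * t)
           * (C4 * P powr (u - real k + \<epsilon>1) * (P powr (2 * \<delta> * \<bar>D\<bar>) * Qj j powr (2 * D / real k)))
        = C1 powr t * C4 * (P powr ((1 + \<epsilon>1) * t) * P powr (u - real k + \<epsilon>1) * P powr (2 * \<delta> * \<bar>D\<bar>))
           * (Qj j powr (- 2 * \<tau> / real k * t) * Qj j powr (2 * D / real k))" by (simp only: mult_ac)
      also have "P powr ((1 + \<epsilon>1) * t) * P powr (u - real k + \<epsilon>1) * P powr (2 * \<delta> * \<bar>D\<bar>)
         = P powr (s - real k) * P powr (\<epsilon>1 * (t + 1) + 2 * \<delta> * \<bar>D\<bar>)"
        unfolding powr_add[symmetric] by (rule arg_cong[of _ _ "(powr) P"]) (simp add: u(2) algebra_simps)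
      \<comment> \<open>The combined exponent is \<open>2 * Ds / k\<close>. As \<open>Ds\<close> is
        negative the bound decreases with the level, and every piece may be estimated at the lowest
        level \<open>Q\<close>.\<close>
      also have "Qj j powr (- 2 * \<tau> / real k * t) * Qj j powr (2 * D / real k) = Qj j powr (- (2 * \<bar>Ds\<bar> / real k))"
      proof -
        have "- 2 * \<tau> / real k * t + 2 * D / real k = - (2 * \<bar>Ds\<bar> / real k)"
          using \<open>Ds < 0\<close> Ds k by (simp add: field_simps)
        then show ?thesis by (simp only: powr_add[symmetric])
      qed
      also have "C1 powr t * C4 * (P powr (s - real k) * P powr (\<epsilon>1 * (t + 1) + 2 * \<delta> * \<bar>D\<bar>)) * Qj j powr (- (2 * \<bar>Ds\<bar> / real k))
        \<le> C1 powr t * C4 * (P powr (s - real k) * Q powr \<epsilon>) * Q powr (- (2 * \<bar>Ds\<bar> / real k))"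
      proof (intro mult_mono mult_left_mono)
        have e1: "\<epsilon>1 * (t + 1) = \<epsilon> * \<theta> / 2" using t(1) by (simp add: \<epsilon>1_def field_simps)
        have e2: "2 * \<delta> * \<bar>D\<bar> \<le> \<epsilon> * \<theta> / 2"
        proof -
          have "2 * \<delta> * \<bar>D\<bar> \<le> 2 * \<delta> * (\<bar>D\<bar> + 1)" using \<delta> by (intro mult_left_mono) auto
          also have "\<dots> = \<epsilon> * \<theta> / 2"
          proof -
            have "2 * (\<epsilon> * \<theta> / (4 * x)) * x = \<epsilon> * \<theta> / 2" if "x > 0" for x using that by simp
            from this[of "\<bar>D\<bar> + 1"] show ?thesis by (simp add: \<delta>_def add_nonneg_pos)
          qed
          finally show ?thesis .
        qed
        have "\<epsilon>1 * (t + 1) + 2 * \<delta> * \<bar>D\<bar> \<le> \<theta> * \<epsilon>" using add_mono[OF eq_refl[OF e1] e2] by (simp only: mult.commute[of \<theta>])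
        then have "P powr (\<epsilon>1 * (t + 1) + 2 * \<delta> * \<bar>D\<bar>) \<le> (P powr \<theta>) powr \<epsilon>"
          unfolding powr_powr using P1' by (intro powr_mono)
        also have "\<dots> \<le> Q powr \<epsilon>" using Q \<epsilon> by (intro powr_mono2) auto
        finally show "P powr (\<epsilon>1 * (t + 1) + 2 * \<delta> * \<bar>D\<bar>) \<le> Q powr \<epsilon>" .
        show "Qj j powr (- (2 * \<bar>Ds\<bar> / real k)) \<le> Q powr (- (2 * \<bar>Ds\<bar> / real k))"
          using QQj[of j] Q1 by (intro powr_mono2') auto
      qed (use C4 in auto)
      also have "\<dots> = C1 powr t * C4 * P powr (s - real k) * (Q powr \<epsilon> * Q powr (- (2 * \<bar>Ds\<bar> / real k)))" by (simp only: mult_ac)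
      also have "Q powr \<epsilon> * Q powr (- (2 * \<bar>Ds\<bar> / real k)) = Q powr (\<epsilon> - 2 * \<bar>Ds\<bar> / real k)"
        unfolding powr_add[symmetric] by simp
      finally show ?thesis .
    qed
    have mb: "minor_arcs k Q P \<in> sets borel" "bounded (minor_arcs k Q P)"
      using minor_arcs_borel bounded_subset[of "{0..1::real}" "minor_arcs k Q P"] by (auto simp: minor_arcs_def)
    \<comment> \<open>The index \<open>None\<close> stands for the single point \<open>1\<close>;
      \<open>Some j\<close> stands for the piece of level \<open>j\<close>.\<close>
    have cover: "minor_arcs k Q P \<subseteq> (\<Union>j\<in>insert None (Some ` {..J}). case j of None \<Rightarrow> {1} | Some j \<Rightarrow> piece j)"
    proof
      fix \<alpha> assume \<alpha>: "\<alpha> \<in> minor_arcs k Q P"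
      show "\<alpha> \<in> (\<Union>j\<in>insert None (Some ` {..J}). case j of None \<Rightarrow> {1} | Some j \<Rightarrow> piece j)"
      proof (cases "\<alpha> = 1")
        case False
        then have \<alpha>': "\<alpha> \<in> {0..<1}" "\<alpha> \<notin> Mj 0" using \<alpha> by (auto simp: minor_arcs_def Mj_def Q0)
        have "\<exists>j\<le>J. \<alpha> \<in> piece j"
        proof (cases "\<alpha> \<in> Mj J")
          case False
          then show ?thesis using \<alpha>' by (auto simp: piece_def intro!: exI[of _ J])
        next
          case True
          then obtain j where "j < J" "\<alpha> \<notin> Mj j" "\<alpha> \<in> Mj (Suc j)"
          proof -
            define i where "i = (LEAST i. \<alpha> \<in> Mj i)"
            have i: "\<alpha> \<in> Mj i" unfolding i_def by (rule LeastI[of _ J]) (rule True)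
            have iJ: "i \<le> J" unfolding i_def by (rule Least_le) (rule True)
            obtain j where j: "i = Suc j" using i \<alpha>'(2) by (cases i) auto
            have "\<alpha> \<notin> Mj j" using not_less_Least[of j "\<lambda>i. \<alpha> \<in> Mj i"] j by (simp add: i_def)
            then show thesis using that[of j] i iJ j by simp
          qed
          then show ?thesis by (auto simp: piece_def intro!: exI[of _ j])
        qed
        then show ?thesis by auto
      qed auto
    qed
    have "integral (minor_arcs k Q P) (\<lambda>\<alpha>. norm (fsum k \<alpha> P R) powr s) = (LBINT \<alpha>:minor_arcs k Q P. g s \<alpha>)"
      unfolding g_def[symmetric]
      by (rule set_borel_integral_eq_integral(2)[symmetric], rule set_integrable_continuous[OF mb gcont]) (use s in auto)
    also have "\<dots> \<le> (\<Sum>j\<in>insert None (Some ` {..J}). (LBINT \<alpha>:(case j of None \<Rightarrow> {1} | Some j \<Rightarrow> piece j). g s \<alpha>))"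
      using s by (intro set_integral_le_cover[OF _ mb gcont g0 _ cover]) (auto simp: piece)
    also have "\<dots> = (LBINT \<alpha>:{1}. g s \<alpha>) + (\<Sum>j\<le>J. (LBINT \<alpha>:piece j. g s \<alpha>))"
      by (subst sum.insert) (auto simp: sum.reindex)
    also have "\<dots> \<le> 0 + (\<Sum>j\<le>J. C1 powr t * C4 * P powr (s - real k) * Q powr (\<epsilon> - 2 * \<bar>Ds\<bar> / real k))"
      by (intro add_mono sum_mono final) (auto simp: set_integral_singleton_eq_0)
    also have "\<dots> = K * P powr (s - real k) * Q powr (\<epsilon> - 2 * \<bar>Ds\<bar> / real k)"
      by (simp add: K_def mult_ac)
    finally show ?thesis .
  qed
  moreover have "\<eta> > 0" using \<eta>1 \<eta>2 \<eta>3 by (simp add: \<eta>_def)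
  ultimately show "\<exists>\<eta>>0. \<exists>C. \<exists>P0. \<forall>P\<ge>P0. \<forall>R Q.
           2 \<le> R \<and> R \<le> P powr \<eta> \<and> P powr \<theta> \<le> Q \<and> Q \<le> P powr (real k / 2) \<longrightarrow>
           integral (minor_arcs k Q P) (\<lambda>\<alpha>. norm (fsum k \<alpha> P R) powr s)
             \<le> C * P powr (s - real k) * Q powr (\<epsilon> - 2 * \<bar>Ds\<bar> / real k)"
    by blast
qed

end
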